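(* Let $i\colon N\to M$ be a subdivision of a finite simplicial complex $N$, with induced injective chain map $i_*\colon C_*(N)\to C_*(M)$. Then there exist subspaces $V_k\subset C_k(M)$ such that, for all $k$, $$C_k(M)=i_*C_k(N)\oplus V_k\oplus \partial_{k+1}V_{k+1}.$$ If $h$ is an inner product on $C_*(N)$, then this decomposition defines (as described in the context) an inner product $g'$ on $C_*(M)$ which satisfies $$i_*\,\square_h=\square_{g'}\,i_*,$$ where $\square_h$ and $\square_{g'}$ are the Laplacians relative to $h$ and $g'$ respectively.
   Context: All simplicial complexes are finite and $C_k(\cdot)$ denotes the space of simplicial $k$-chains with real coefficients, with boundary maps $\partial_k$. A subdivision $i\colon N\to M$ induces the chain map $i_*\colon C_*(N)\to C_*(M)$ sending an oriented $k$-simplex of $N$ to the sum of the $k$-simplices of $M$ subdividing it, oriented compatibly; $i_*$ is injective and induces an isomorphism on homology. An inner product on a chain complex means an inner product on each chain space. For such an inner product $g$, $\partial_g^*$ denotes the adjoint of $\partial$ and the Laplacian is $\square_g=\partial_g^*\partial+\partial\partial_g^*$ (in degree $k$: $\partial_k^*\partial_k+\partial_{k+1}\partial_{k+1}^*$). The inner product $g'$ defined by the decomposition: fix an inner product $g$ on $C_*(M)$ (e.g. the one for which the simplices are orthonormal). Then $g'$ is the inner product on $C_*(M)$ for which the three summands $i_*C_k(N)$, $\partial_{k+1}V_{k+1}$, $V_k$ are mutually orthogonal, which restricts to $g$ on $\partial_{k+1}V_{k+1}$ and on $V_k$, and which on $i_*C_k(N)$ is determined by $i^*g'=h$, i.e.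 $g'(i_*a,i_*b)=h(a,b)$. *)

theory Defs
  imports
    "HOL-Analysis.Analysis"
    "HOL-Combinatorics.Permutations"
    "HOL-Library.Function_Algebras"
    "Jordan_Normal_Form.Determinant"
begin

section \<open>The pointwise real vector space of functions\<close>

instantiation "fun" :: (type, real_vector) real_vector
begin

definition scaleR_fun :: "real \<Rightarrow> ('a \<Rightarrow> 'b) \<Rightarrow> 'a \<Rightarrow> 'b"
  where "scaleR_fun r f = (\<lambda>x. r *\<^sub>R f x)"

instance
  by standard (auto simp: scaleR_fun_def fun_eq_iff algebra_simps)

end

section \<open>Simplicial chains with real coefficients\<close>

text \<open>
  Simplicial complexes are those of \<open>HOL-Analysis\<close> (\<open>simplicial_complex\<close>): finite sets of closed
  simplices in a Euclidean space. They may contain the empty (\<open>-1\<close>-dimensional) simplex, which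
  never contributes to the chains below, since these are indexed by \<open>k \<ge> 0\<close>.

  An ordering of the vertices of a simplex is a list. Two orderings represent the same oriented
  simplex iff they differ by an even permutation. A \<open>k\<close>-chain is a function on the ordered
  \<open>k\<close>-simplices that changes by the sign of the permutation when the vertices are reordered.
\<close>

type_synonym 'a chain = "'a list \<Rightarrow> real"

definition ordered_simplices :: "'a::euclidean_space set set \<Rightarrow> nat \<Rightarrow> 'a list set" where
  "ordered_simplices K k =
     {xs. length xs = k + 1 \<and> distinct xs \<and> \<not> affine_dependent (set xs) \<and> convex hull (set xs) \<in> K}"

definition simplicial_chains :: "'a::euclidean_space set set \<Rightarrow> nat \<Rightarrow> 'a chain set" where
  "simplicial_chains K k =
     {c. (\<forall>xs. xs \<notin> ordered_simplices K k \<longrightarrow> c xs = 0) \<and>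
         (\<forall>xs \<in> ordered_simplices K k. \<forall>p. p permutes {..<length xs} \<longrightarrow>
            c (permute_list p xs) = of_int (sign p) * c xs)}"

text \<open>
  The oriented simplex \<open>[x\<^sub>0, \<dots>, x\<^sub>k]\<close> as a chain: its value at a reordering of \<open>xs\<close> is the sign of
  that reordering, and its value elsewhere is \<open>0\<close>. For distinct \<open>xs\<close> the sum has at most one term.
\<close>

definition oriented_simplex :: "'a list \<Rightarrow> 'a chain" where
  "oriented_simplex xs =
     (\<lambda>ys. \<Sum>p | p permutes {..<length xs} \<and> permute_list p xs = ys. of_int (sign p))"

text \<open>
  The linear map on \<open>k\<close>-chains determined by the images \<open>\<phi> xs\<close> of the oriented \<open>k\<close>-simplices, where
  \<open>\<phi>\<close> changes sign with the orientation. Each \<open>k\<close>-simplex has \<open>(k + 1)!\<close> orderings \<open>xs\<close>, and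
  \<open>c xs *\<^sub>R \<phi> xs\<close> does not depend on the ordering, whence the factor.
\<close>

definition linear_extension ::
    "'a::euclidean_space set set \<Rightarrow> nat \<Rightarrow> ('a list \<Rightarrow> 'a chain) \<Rightarrow> 'a chain \<Rightarrow> 'a chain" where
  "linear_extension K k \<phi> c = (\<Sum>xs \<in> ordered_simplices K k. (c xs / fact (k + 1)) *\<^sub>R \<phi> xs)"

definition boundary_simplex :: "'a list \<Rightarrow> 'a chain" where
  "boundary_simplex xs =
     (\<Sum>i<length xs. (-1) ^ i *\<^sub>R oriented_simplex (take i xs @ drop (Suc i) xs))"

text \<open>
  \<open>boundary K k\<close> is \<open>\<partial>\<^sub>k : C\<^sub>k(K) \<rightarrow> C\<^sub>k\<^sub>-\<^sub>1(K)\<close>. The chain complex is not augmented, so \<open>\<partial>\<^sub>0 = 0\<close>.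
\<close>

definition boundary :: "'a::euclidean_space set set \<Rightarrow> nat \<Rightarrow> 'a chain \<Rightarrow> 'a chain" where
  "boundary K k = (if k = 0 then (\<lambda>_. 0) else linear_extension K k boundary_simplex)"

section \<open>Subdivisions\<close>

definition subdivision :: "'a::euclidean_space set set \<Rightarrow> 'a set set \<Rightarrow> bool" where
  "subdivision N M \<longleftrightarrow>
     simplicial_complex N \<and> simplicial_complex M \<and> \<Union>M = \<Union>N \<and> (\<forall>\<tau>\<in>M. \<exists>\<sigma>\<in>N. \<tau> \<subseteq> \<sigma>)"

text \<open>
  Two orderings of affinely independent sets spanning the same affine subspace are compatible if
  the affine automorphism of that subspace carrying \<open>xs ! i\<close> to \<open>ys ! i\<close> preserves orientation. Row
  \<open>i\<close> of \<open>A\<close> consists of the barycentric coordinates of \<open>ys ! i\<close> with respect to \<open>xs\<close>, and \<open>det A\<close> is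
  the determinant of the linear part of that automorphism.
\<close>

definition compatibly_oriented :: "'a::euclidean_space list \<Rightarrow> 'a list \<Rightarrow> bool" where
  "compatibly_oriented xs ys \<longleftrightarrow>
     length ys = length xs \<and>
     (\<exists>A \<in> carrier_mat (length xs) (length xs).
        (\<forall>i<length xs. (\<Sum>j<length xs. A $$ (i, j)) = 1 \<and>
                       ys ! i = (\<Sum>j<length xs. A $$ (i, j) *\<^sub>R xs ! j)) \<and>
        Determinant.det A > 0)"

text \<open>
  The sum of the \<open>k\<close>-simplices \<open>\<tau>\<close> of \<open>M\<close> subdividing the \<open>k\<close>-simplex \<open>xs\<close>, each of them oriented
  by some vertex ordering compatible with \<open>xs\<close>; any two such orderings define the same chain.
\<close>

definition subdivide_simplex :: "'a::euclidean_space set set \<Rightarrow> nat \<Rightarrow> 'a list \<Rightarrow> 'a chain" where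
  "subdivide_simplex M k xs =
     (\<Sum>\<tau> | \<tau> \<in> M \<and> int k simplex \<tau> \<and> \<tau> \<subseteq> convex hull (set xs).
        oriented_simplex
          (SOME ys. ys \<in> ordered_simplices M k \<and> convex hull (set ys) = \<tau> \<and> compatibly_oriented xs ys))"

definition subdivision_map ::
    "'a::euclidean_space set set \<Rightarrow> 'a set set \<Rightarrow> nat \<Rightarrow> 'a chain \<Rightarrow> 'a chain" where
  "subdivision_map N M k = linear_extension N k (subdivide_simplex M k)"

section \<open>Inner products and Laplacians\<close>

definition inner_product_on :: "'v::real_vector set \<Rightarrow> ('v \<Rightarrow> 'v \<Rightarrow> real) \<Rightarrow> bool" where
  "inner_product_on S g \<longleftrightarrow>
     (\<forall>x\<in>S. \<forall>y\<in>S. g x y = g y x) \<and>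
     (\<forall>x\<in>S. \<forall>y\<in>S. \<forall>z\<in>S. g (x + y) z = g x z + g y z) \<and>
     (\<forall>r. \<forall>x\<in>S. \<forall>y\<in>S. g (r *\<^sub>R x) y = r * g x y) \<and>
     (\<forall>x\<in>S. x \<noteq> 0 \<longrightarrow> g x x > 0)"

type_synonym 'a chain_metric = "nat \<Rightarrow> 'a chain \<Rightarrow> 'a chain \<Rightarrow> real"

definition chain_inner_product :: "'a::euclidean_space set set \<Rightarrow> 'a chain_metric \<Rightarrow> bool" where
  "chain_inner_product K g \<longleftrightarrow> (\<forall>k. inner_product_on (simplicial_chains K k) (g k))"

text \<open>
  \<open>boundary_adjoint K g k\<close> is the adjoint \<open>C\<^sub>k\<^sub>-\<^sub>1(K) \<rightarrow> C\<^sub>k(K)\<close> of \<open>\<partial>\<^sub>k\<close>; it is \<open>0\<close> for \<open>k = 0\<close>, where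
  the truncated \<open>k - 1\<close> is harmless because \<open>\<partial>\<^sub>0 = 0\<close>.
\<close>

definition boundary_adjoint ::
    "'a::euclidean_space set set \<Rightarrow> 'a chain_metric \<Rightarrow> nat \<Rightarrow> 'a chain \<Rightarrow> 'a chain" where
  "boundary_adjoint K g k y =
     (THE z. z \<in> simplicial_chains K k \<and> (\<forall>x \<in> simplicial_chains K k. g k x z = g (k - 1) (boundary K k x) y))"

definition laplacian ::
    "'a::euclidean_space set set \<Rightarrow> 'a chain_metric \<Rightarrow> nat \<Rightarrow> 'a chain \<Rightarrow> 'a chain" where
  "laplacian K g k c =
     boundary_adjoint K g k (boundary K k c) + boundary K (k + 1) (boundary_adjoint K g (k + 1) c)"

section \<open>The decomposition and the inner product it defines\<close>

definition direct_sum3 ::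
    "'v::real_vector set \<Rightarrow> 'v set \<Rightarrow> 'v set \<Rightarrow> 'v set \<Rightarrow> bool" where
  "direct_sum3 S A B D \<longleftrightarrow>
     S = {a + b + d | a b d. a \<in> A \<and> b \<in> B \<and> d \<in> D} \<and>
     (\<forall>a\<in>A. \<forall>b\<in>B. \<forall>d\<in>D. a + b + d = 0 \<longrightarrow> a = 0 \<and> b = 0 \<and> d = 0)"

definition subdivision_decomposition ::
    "'a::euclidean_space set set \<Rightarrow> 'a set set \<Rightarrow> (nat \<Rightarrow> 'a chain set) \<Rightarrow> bool" where
  "subdivision_decomposition N M V \<longleftrightarrow>
     (\<forall>k. subspace (V k) \<and> V k \<subseteq> simplicial_chains M k) \<and>
     (\<forall>k. direct_sum3 (simplicial_chains M k)
            (subdivision_map N M k ` simplicial_chains N k) (V k) (boundary M (k + 1) ` V (k + 1)))"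

definition decomposition_inner_product ::
    "'a::euclidean_space set set \<Rightarrow> 'a set set \<Rightarrow> (nat \<Rightarrow> 'a chain set) \<Rightarrow>
     'a chain_metric \<Rightarrow> 'a chain_metric \<Rightarrow> 'a chain_metric \<Rightarrow> bool" where
  "decomposition_inner_product N M V g h g' \<longleftrightarrow>
     chain_inner_product M g' \<and>
     (\<forall>k. let I = subdivision_map N M k ` simplicial_chains N k; W = boundary M (k + 1) ` V (k + 1) in
        (\<forall>x\<in>I. \<forall>y\<in>W. g' k x y = 0) \<and>
        (\<forall>x\<in>I. \<forall>y\<in>V k. g' k x y = 0) \<and>
        (\<forall>x\<in>W. \<forall>y\<in>V k. g' k x y = 0) \<and>
        (\<forall>x\<in>W. \<forall>y\<in>W. g' k x y = g k x y) \<and>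
        (\<forall>x\<in>V k. \<forall>y\<in>V k. g' k x y = g k x y) \<and>
        (\<forall>a\<in>simplicial_chains N k. \<forall>b\<in>simplicial_chains N k.
           g' k (subdivision_map N M k a) (subdivision_map N M k b) = h k a b))"

end

theory Submission
  imports Defs
begin

text \<open>
  The map \<open>i\<^sub>*\<close> is a chain map because an interior codimension one simplex of a subdivided simplex
  has exactly two cofaces, which lie on opposite sides of it. A vertex map sending each point to a
  vertex of the simplex of \<open>N\<close> containing it in its interior induces \<open>\<phi> : C(M) \<rightarrow> C(N)\<close>, and \<open>\<phi> i\<^sub>* = 1\<close>
  on the nose: both sides send a simplex to a multiple of itself and have the same boundary. A cycle
  \<open>z\<close> of \<open>M\<close> with \<open>\<phi> z = 0\<close> is bounded by the affine prism from \<open>z\<close> to \<open>\<phi> z\<close>; barycentric subdivision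
  followed by simplicial approximation turns the prism into a chain of \<open>M\<close>. Hence \<open>C(M) / i\<^sub>* C(N)\<close>
  is acyclic, and \<open>V\<^sub>k\<close> may be any complement of \<open>{x. \<partial>x \<in> i\<^sub>* C(N)}\<close> in \<open>C\<^sub>k(M)\<close>. For the metric
  \<open>g'\<close>, orthogonality of the decomposition gives \<open>\<partial>\<^sup>* i\<^sub>* = i\<^sub>* \<partial>\<^sup>*\<close>, whence the Laplacians commute with \<open>i\<^sub>*\<close>.
\<close>

section \<open>Inner products on subspaces\<close>

text \<open>The obstacle is degeneracy. Prisms and barycentric subdivisions yield lists with
  repeated or affinely dependent entries, which belong to no complex. They are therefore formed from
  ordered chains, real combinations of arbitrary lists, where the homotopies are iterated cones and
  their formulas hold without exception. \<open>antisym\<close> leads back to alternating chains and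
  annihilates lists with repetitions. An alternating chain is itself an ordered chain, but one that
  lists each simplex in all its orderings; this is the origin of the factorials. The auxiliary
  boundary operators are augmented. Inductions over faces can then start at the empty list, and in
  degree 0 a cycle is a chain whose coefficients have sum zero, which is what must hold for it to
  bound. Signs are handled by determinants: oriented simplices are determinants of incidence
  matrices, orientations are determinants of barycentric coordinates. Laplace expansion along the
  first row gives both the boundary formula and the fact that the orientation of a coface is an
  affine function of the added vertex.\<close>

lemma inner_product_on_sym:
  "inner_product_on S g \<Longrightarrow> x \<in> S \<Longrightarrow> y \<in> S \<Longrightarrow> g x y = g y x"
  by (auto simp: inner_product_on_def)

lemma inner_product_on_add_left:
  "inner_product_on S g \<Longrightarrow> x \<in> S \<Longrightarrow> y \<in> S \<Longrightarrow> z \<in> S \<Longrightarrow> g (x + y) z = g x z + g y z"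
  by (auto simp: inner_product_on_def)

lemma inner_product_on_scale_left:
  "inner_product_on S g \<Longrightarrow> x \<in> S \<Longrightarrow> y \<in> S \<Longrightarrow> g (r *\<^sub>R x) y = r * g x y"
  by (auto simp: inner_product_on_def)

lemma inner_product_on_add_right:
  assumes "subspace S" "inner_product_on S g" "x \<in> S" "y \<in> S" "z \<in> S"
  shows "g z (x + y) = g z x + g z y"
  using inner_product_on_sym[OF assms(2,5) subspace_add[OF assms(1,3,4)]]
    inner_product_on_sym[OF assms(2,3,5)] inner_product_on_sym[OF assms(2,4,5)]
    inner_product_on_add_left[OF assms(2-5)] by simp

lemma inner_product_on_scale_right:
  assumes "subspace S" "inner_product_on S g" "x \<in> S" "y \<in> S"
  shows "g x (r *\<^sub>R y) = r * g x y"
  using inner_product_on_sym[OF assms(2,3) subspace_scale[OF assms(1,4)]]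
    inner_product_on_sym[OF assms(2-4)] inner_product_on_scale_left[OF assms(2,4,3)] by simp

lemma inner_product_on_zero_left:
  assumes "subspace S" "inner_product_on S g" "x \<in> S"
  shows "g 0 x = 0"
  using inner_product_on_scale_left[OF assms(2,3,3), of 0] by simp

lemma inner_product_on_zero_right:
  assumes "subspace S" "inner_product_on S g" "x \<in> S"
  shows "g x 0 = 0"
  using inner_product_on_scale_right[OF assms(1,2,3,3), of 0] by simp

lemma inner_product_on_pos:
  "inner_product_on S g \<Longrightarrow> x \<in> S \<Longrightarrow> x \<noteq> 0 \<Longrightarrow> g x x > 0"
  by (auto simp: inner_product_on_def)

lemma inner_product_on_eqI:
  assumes S: "subspace S" and g: "inner_product_on S g" and "y \<in> S" "z \<in> S"
    and eq: "\<And>x. x \<in> S \<Longrightarrow> g x y = g x z"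
  shows "y = z"
proof (rule ccontr)
  assume "y \<noteq> z"
  have d: "y - z = y + (-1) *\<^sub>R z" "y - z \<in> S" "(-1) *\<^sub>R z \<in> S"
    by (simp_all only: subspace_diff[OF S assms(3,4)] subspace_scale[OF S assms(4)]) simp
  have "g (y - z) (y - z) = g (y - z) y - g (y - z) z"
    using inner_product_on_add_right[OF S g \<open>y \<in> S\<close> d(3) d(2)]
      inner_product_on_scale_right[OF S g d(2) \<open>z \<in> S\<close>, of "-1"]
    unfolding d(1)[symmetric] by linarith
  also have "\<dots> = 0" using eq[OF d(2)] by simp
  finally show False using inner_product_on_pos[OF g d(2)] \<open>y \<noteq> z\<close> by simp
qed

lemma inner_product_on_subset:
  "inner_product_on S g \<Longrightarrow> T \<subseteq> S \<Longrightarrow> inner_product_on T g"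
  unfolding inner_product_on_def by (simp add: subset_iff)

text \<open>Gram-Schmidt by induction on a finite spanning set, which is how finite dimension enters
  the existence of adjoints. \<open>f\<close> varies because the induction hypothesis is used twice:
  to represent \<open>f\<close> itself, and to represent the functional \<open>g _ b\<close>, which
  yields the orthogonal projection \<open>p\<close> of the new vector.\<close>

lemma riesz_representation_span:
  fixes f :: "'v::real_vector \<Rightarrow> real"
  assumes "finite B" and "inner_product_on (span B) g"
    and "\<And>x y. x \<in> span B \<Longrightarrow> y \<in> span B \<Longrightarrow> f (x + y) = f x + f y"
    and "\<And>r x. x \<in> span B \<Longrightarrow> f (r *\<^sub>R x) = r * f x"
  shows "\<exists>z\<in>span B. \<forall>x\<in>span B. g x z = f x"
  using assms
proof (induction B arbitrary: f rule: finite_induct)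
  case empty
  have "f 0 = 0" using empty(3)[of 0 0] by simp
  moreover have "g 0 0 = 0"
    using inner_product_on_scale_left[OF empty(1), of 0 0 0] by simp
  ultimately show ?case by simp
next
  case (insert b B)
  have sub: "span B \<subseteq> span (insert b B)" by (rule span_mono) auto
  have bS: "b \<in> span (insert b B)" by (simp add: span_base)
  note g = insert.prems(1)
  have gB: "inner_product_on (span B) g" by (rule inner_product_on_subset[OF g sub])
  have "\<exists>z\<in>span B. \<forall>x\<in>span B. g x z = f x"
    by (rule insert.IH[OF gB]) (use insert.prems(2,3) sub in \<open>simp_all add: subset_iff\<close>)
  then obtain z0 where z0: "z0 \<in> span B" "\<And>x. x \<in> span B \<Longrightarrow> g x z0 = f x" by blast
  show ?case
  proof (cases "b \<in> span B")
    case True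
    then have "span (insert b B) = span B" by (rule span_redundant)
    then show ?thesis using z0 by auto
  next
    case False
    have "\<exists>p\<in>span B. \<forall>x\<in>span B. g x p = g x b"
    proof (rule insert.IH[OF gB])
      show "g (x + y) b = g x b + g y b" if "x \<in> span B" "y \<in> span B" for x y
        using inner_product_on_add_left[OF g] that sub bS by blast
      show "g (r *\<^sub>R x) b = r * g x b" if "x \<in> span B" for x r
        using inner_product_on_scale_left[OF g] that sub bS by blast
    qed
    then obtain p where p: "p \<in> span B" "\<And>x. x \<in> span B \<Longrightarrow> g x p = g x b" by blast
    define c where "c = b - p"
    have S: "subspace (span (insert b B))" by simp
    have pS: "p \<in> span (insert b B)" and z0S: "z0 \<in> span (insert b B)" using p z0 sub by auto
    have cS: "c \<in> span (insert b B)" unfolding c_def using bS pS by (rule span_diff)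
    have c0: "c \<noteq> 0" using False p by (auto simp: c_def)
    have gxc: "g x c = 0" if "x \<in> span B" for x
    proof -
      have xS: "x \<in> span (insert b B)" using that sub by auto
      have "g x (c + p) = g x c + g x p" by (rule inner_product_on_add_right[OF S g cS pS xS])
      then show ?thesis using p(2)[OF that] by (simp add: c_def)
    qed
    have gcc: "g c c > 0" using inner_product_on_pos[OF g cS c0] .
    \<comment> \<open>\<open>c\<close> is orthogonal to \<open>span B\<close>, so adding a multiple
      of it to \<open>z0\<close> leaves the values there unchanged; this \<open>t\<close> solves
      \<open>g c (z0 + t *\<^sub>R c) = f c\<close>.\<close>
    define t where "t = (f c - g c z0) / g c c"
    have tS: "t *\<^sub>R c \<in> span (insert b B)" using cS by (rule span_scale)
    define z where "z = z0 + t *\<^sub>R c"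
    have zS: "z \<in> span (insert b B)" unfolding z_def using z0S tS by (rule span_add)
    have gz: "g y z = g y z0 + t * g y c" if "y \<in> span (insert b B)" for y
      unfolding z_def using inner_product_on_add_right[OF S g z0S tS that]
        inner_product_on_scale_right[OF S g that cS] by simp
    have "g x z = f x" if x: "x \<in> span (insert b B)" for x
    proof -
      obtain k where k: "x - k *\<^sub>R b \<in> span B" using x by (auto simp: span_insert)
      define y where "y = x - k *\<^sub>R b + k *\<^sub>R p"
      have yB: "y \<in> span B" unfolding y_def using k p by (auto intro: span_add span_scale)
      have yS: "y \<in> span (insert b B)" using yB sub by auto
      have xe: "x = y + k *\<^sub>R c" by (simp add: y_def c_def algebra_simps)
      have kS: "k *\<^sub>R c \<in> span (insert b B)" using cS by (rule span_scale)
      have "g x z = g y z + k * g c z"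
        unfolding xe using inner_product_on_add_left[OF g yS kS zS]
          inner_product_on_scale_left[OF g cS zS] by simp
      also have "g y z = f y" using gz[OF yS] gxc[OF yB] z0(2)[OF yB] by simp
      also have "g c z = f c" using gz[OF cS] gcc by (simp add: t_def)
      also have "f y + k * f c = f x"
        unfolding xe using insert.prems(2)[OF yS kS] insert.prems(3)[OF cS] by simp
      finally show ?thesis .
    qed
    then show ?thesis using zS by blast
  qed
qed

section \<open>Injective quasi-isomorphisms of chain complexes\<close>

lemma direct_sum3_unique:
  assumes "direct_sum3 S A B D" "subspace A" "subspace B" "subspace D"
    and "a \<in> A" "a' \<in> A" "b \<in> B" "b' \<in> B" "d \<in> D" "d' \<in> D" "a + b + d = a' + b' + d'"
  shows "a = a' \<and> b = b' \<and> d = d'"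
proof -
  have "(a - a') + (b - b') + (d - d') = 0" using assms(11) by (simp add: algebra_simps)
  moreover have "a - a' \<in> A" "b - b' \<in> B" "d - d' \<in> D" using assms by (auto intro: subspace_diff)
  ultimately have "a - a' = 0 \<and> b - b' = 0 \<and> d - d' = 0"
    using assms(1) unfolding direct_sum3_def by blast
  then show ?thesis by simp
qed

text \<open>A basis \<open>B\<close> of \<open>Z\<close> extends to a basis \<open>C\<close> of
  \<open>S\<close>, and the complement is spanned by the added vectors. A common element has
  coordinates supported both in \<open>B\<close> and in \<open>C - B\<close>, hence is 0.\<close>

lemma subspace_complement_exists:
  fixes Z S :: "'v::real_vector set"
  assumes "subspace Z" "subspace S" "Z \<subseteq> S"
  shows "\<exists>V. subspace V \<and> V \<subseteq> S \<and> Z \<inter> V = {0} \<and> (\<forall>x\<in>S. \<exists>z\<in>Z. \<exists>v\<in>V. x = z + v)"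
proof -
  obtain B where B: "B \<subseteq> Z" "independent B" "span B = Z"
    using maximal_independent_subset[of Z] assms(1) by (metis span_minimal span_eq_iff subset_antisym)
  obtain C where C: "B \<subseteq> C" "C \<subseteq> S" "independent C" "S \<subseteq> span C"
    using maximal_independent_subset_extend[of B S] B assms by blast
  define V where "V = span (C - B)"
  have VS: "V \<subseteq> S" unfolding V_def using C assms(2) by (intro span_minimal) auto
  have "Z \<inter> V = {0}"
  proof -
    have "x = 0" if "x \<in> Z" "x \<in> V" for x
    proof -
      have "representation C x = representation B x"
        using representation_extend[OF C(3) _ C(1)] B(3) that(1) by blast
      moreover have "representation C x = representation (C - B) x"
        using representation_extend[OF C(3), of x "C - B"] that(2) V_def by blast
      ultimately have "representation C x b = 0" for b
        using representation_ne_zero[of B x b] representation_ne_zero[of "C - B" x b] by force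
      moreover have "x \<in> span C" using that(1) B(3) span_mono[OF C(1)] by auto
      ultimately show "x = 0"
        using sum_nonzero_representation_eq[OF C(3), of x] by simp
    qed
    moreover have "0 \<in> Z" "0 \<in> V" using assms(1) by (auto simp: subspace_0 V_def span_zero)
    ultimately show ?thesis by blast
  qed
  moreover have "\<exists>z\<in>Z. \<exists>v\<in>V. x = z + v" if "x \<in> S" for x
  proof -
    have "x \<in> span (B \<union> (C - B))" using that C(1,4) by (simp add: Un_absorb1 subset_iff)
    then show ?thesis unfolding span_Un V_def using B(3) by auto
  qed
  ultimately show ?thesis using VS by (intro exI[of _ V]) (auto simp: V_def)
qed

text \<open>The adjoint as a relation: the definite description in \<open>boundary_adjoint\<close>
  can be evaluated only after existence and uniqueness are known.\<close>

definition is_adjoint ::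
    "(nat \<Rightarrow> 'v::real_vector set) \<Rightarrow> (nat \<Rightarrow> 'v \<Rightarrow> 'v) \<Rightarrow> (nat \<Rightarrow> 'v \<Rightarrow> 'v \<Rightarrow> real) \<Rightarrow> nat \<Rightarrow> 'v \<Rightarrow> 'v \<Rightarrow> bool"
  where "is_adjoint C d G k y z \<longleftrightarrow> z \<in> C k \<and> (\<forall>x \<in> C k. G k x z = G (k - 1) (d k x) y)"

lemma adjoint_unique:
  assumes "is_adjoint C d G k y z" "is_adjoint C d G k y z'" "subspace (C k)" "inner_product_on (C k) (G k)"
  shows "z = z'"
  using inner_product_on_eqI[OF assms(3,4), of z z'] assms(1,2) unfolding is_adjoint_def by auto

text \<open>The algebraic part, stated for an injective chain map. The maps are linear on the whole
  type and only their domains are restricted. The degree 0 axioms make up for the truncated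
  \<open>k - 1\<close>.\<close>

locale chain_embedding =
  fixes A B :: "nat \<Rightarrow> 'v::real_vector set" and dA dB i :: "nat \<Rightarrow> 'v \<Rightarrow> 'v"
  assumes subspace_A: "subspace (A k)" and subspace_B: "subspace (B k)"
    and linear_dA: "linear (dA k)" and linear_dB: "linear (dB k)" and linear_i: "linear (i k)"
    and dA_mem: "x \<in> A k \<Longrightarrow> dA k x \<in> A (k - 1)" and dB_mem: "x \<in> B k \<Longrightarrow> dB k x \<in> B (k - 1)"
    and dA_0: "dA 0 x = 0" and dB_0: "dB 0 x = 0"
    and dB_dB: "x \<in> B (Suc k) \<Longrightarrow> dB k (dB (Suc k) x) = 0"
    and i_mem: "x \<in> A k \<Longrightarrow> i k x \<in> B k"
    and i_inj: "x \<in> A k \<Longrightarrow> i k x = 0 \<Longrightarrow> x = 0"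
    and i_chain_map: "x \<in> A k \<Longrightarrow> dB k (i k x) = i (k - 1) (dA k x)"
begin

abbreviation decomposition :: "(nat \<Rightarrow> 'v set) \<Rightarrow> bool" where
  "decomposition V \<equiv> (\<forall>k. subspace (V k) \<and> V k \<subseteq> B k) \<and>
     (\<forall>k. direct_sum3 (B k) (i k ` A k) (V k) (dB (k + 1) ` V (k + 1)))"

abbreviation metric_extension ::
    "(nat \<Rightarrow> 'v set) \<Rightarrow> (nat \<Rightarrow> 'v \<Rightarrow> 'v \<Rightarrow> real) \<Rightarrow> (nat \<Rightarrow> 'v \<Rightarrow> 'v \<Rightarrow> real) \<Rightarrow>
     (nat \<Rightarrow> 'v \<Rightarrow> 'v \<Rightarrow> real) \<Rightarrow> bool" where
  "metric_extension V g h g' \<equiv> (\<forall>k. inner_product_on (B k) (g' k)) \<and>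
     (\<forall>k. let I = i k ` A k; W = dB (k + 1) ` V (k + 1) in
        (\<forall>x\<in>I. \<forall>y\<in>W. g' k x y = 0) \<and>
        (\<forall>x\<in>I. \<forall>y\<in>V k. g' k x y = 0) \<and>
        (\<forall>x\<in>W. \<forall>y\<in>V k. g' k x y = 0) \<and>
        (\<forall>x\<in>W. \<forall>y\<in>W. g' k x y = g k x y) \<and>
        (\<forall>x\<in>V k. \<forall>y\<in>V k. g' k x y = g k x y) \<and>
        (\<forall>a\<in>A k. \<forall>b\<in>A k. g' k (i k a) (i k b) = h k a b))"

lemma subspace_image_A: "subspace (i k ` A k)"
  by (rule linear_subspace_image[OF linear_i subspace_A])

text \<open>The hypothesis says that the quotient by the image of \<open>i\<close> is acyclic. On a
  complement \<open>V\<close> of the relative cycles \<open>Z\<close> the boundary is injective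
  modulo the image of \<open>i\<close>, and by acyclicity \<open>dB\<close> maps
  \<open>V (Suc k)\<close> onto the relative cycles of degree \<open>k\<close> modulo that
  image.\<close>

lemma decomposition_exists:
  assumes acyclic: "\<And>k x. x \<in> B k \<Longrightarrow> dB k x \<in> i (k - 1) ` A (k - 1) \<Longrightarrow>
    \<exists>a\<in>A k. \<exists>y\<in>B (Suc k). x = i k a + dB (Suc k) y"
  shows "\<exists>V. decomposition V"
proof -
  define Z where "Z k = {x \<in> B k. dB k x \<in> i (k - 1) ` A (k - 1)}" for k
  have Z: "subspace (Z k)" for k
  proof -
    have "Z k = B k \<inter> dB k -` (i (k - 1) ` A (k - 1))" by (auto simp: Z_def)
    then show ?thesis
      by (simp add: subspace_inter subspace_B linear_subspace_vimage[OF linear_dB subspace_image_A])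
  qed
  have ZB: "Z k \<subseteq> B k" for k by (auto simp: Z_def)
  have "\<forall>k. \<exists>V. subspace V \<and> V \<subseteq> B k \<and> Z k \<inter> V = {0} \<and>
      (\<forall>x\<in>B k. \<exists>z\<in>Z k. \<exists>v\<in>V. x = z + v)"
    using subspace_complement_exists[OF Z subspace_B ZB] by blast
  then obtain V where V: "\<And>k. subspace (V k)" "\<And>k. V k \<subseteq> B k" "\<And>k. Z k \<inter> V k = {0}"
    "\<And>k x. x \<in> B k \<Longrightarrow> \<exists>z\<in>Z k. \<exists>v\<in>V k. x = z + v"
    by metis
  have iZ: "i k a \<in> Z k" if "a \<in> A k" for k a
    using i_mem[OF that] imageI[OF dA_mem[OF that], of "i (k - 1)"] by (simp add: Z_def i_chain_map[OF that])
  have dZ: "dB (Suc k) y \<in> Z k" if "y \<in> B (Suc k)" for k y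
    using that dB_mem[of y "Suc k"] subspace_0[OF subspace_image_A[of "k - 1"]]
    by (auto simp: Z_def dB_dB)
  have "direct_sum3 (B k) (i k ` A k) (V k) (dB (k + 1) ` V (k + 1))" for k
    unfolding direct_sum3_def
  proof (intro conjI ballI impI)
    show "B k = {a + b + d |a b d. a \<in> i k ` A k \<and> b \<in> V k \<and> d \<in> dB (k + 1) ` V (k + 1)}"
      (is "_ = ?R")
    proof (intro equalityI subsetI)
      fix x assume "x \<in> B k"
      then obtain z v where zv: "z \<in> Z k" "v \<in> V k" "x = z + v" using V(4) by blast
      then obtain a y where ay: "a \<in> A k" "y \<in> B (Suc k)" "z = i k a + dB (Suc k) y"
        using acyclic[of z k] by (auto simp: Z_def)
      \<comment> \<open>The bounding chain \<open>y\<close> need not lie in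
        \<open>V (Suc k)\<close>. Its relative cycle part has boundary in the image of
        \<open>i\<close>, which is absorbed into \<open>a\<close>.\<close>
      obtain z' v' where zv': "z' \<in> Z (Suc k)" "v' \<in> V (Suc k)" "y = z' + v'"
        using V(4)[OF ay(2)] by blast
      then obtain a' where a': "a' \<in> A k" "dB (Suc k) z' = i k a'" by (auto simp: Z_def)
      have "x = i k (a + a') + v + dB (k + 1) v'"
        using zv(3) ay(3) zv'(3) a'(2) by (simp add: linear_add[OF linear_dB] linear_add[OF linear_i])
      moreover have "a + a' \<in> A k" using ay(1) a'(1) by (simp add: subspace_add subspace_A)
      ultimately show "x \<in> ?R" using zv(2) zv'(2) by auto
    next
      fix x assume "x \<in> ?R"
      then obtain a v v' where "x = i k a + v + dB (k + 1) v'" "a \<in> A k" "v \<in> V k" "v' \<in> V (k + 1)"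
        by blast
      moreover have "dB (k + 1) v' \<in> B k" using dB_mem[of v' "k + 1"] V(2)[of "k + 1"] calculation by auto
      ultimately show "x \<in> B k"
        using i_mem V(2)[of k] by (auto intro!: subspace_add subspace_B)
    qed
  next
    fix x v w assume *: "x \<in> i k ` A k" "v \<in> V k" "w \<in> dB (k + 1) ` V (k + 1)" "x + v + w = 0"
    then obtain a v' where av: "a \<in> A k" "x = i k a" "v' \<in> V (Suc k)" "w = dB (Suc k) v'" by auto
    have v'B: "v' \<in> B (Suc k)" using av(3) V(2) by blast
    \<comment> \<open>Both \<open>x\<close> and \<open>w\<close> are relative cycles, so
      \<open>v\<close> is one too and vanishes. Then \<open>w = - x\<close> lies in the image of
      \<open>i\<close>, which makes \<open>v'\<close> a relative cycle as well.\<close>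
    have "x + w \<in> Z k" using iZ[OF av(1)] dZ[OF v'B] av by (simp add: subspace_add[OF Z])
    moreover have "v = - (x + w)" using *(4) by (simp add: eq_neg_iff_add_eq_0 algebra_simps)
    ultimately have "v \<in> Z k" by (simp only: subspace_neg[OF Z])
    then have "v = 0" using V(3)[of k] *(2) by blast
    then have "w = i k (- a)" using *(4) av
      by (simp add: linear_neg[OF linear_i] eq_neg_iff_add_eq_0 add.commute)
    then have "v' \<in> Z (Suc k)" using v'B av(1,4) by (auto simp: Z_def intro!: imageI subspace_neg subspace_A)
    then have "v' = 0" using V(3)[of "Suc k"] av(3) by blast
    then have "w = 0" using av(4) by (simp add: linear_0[OF linear_dB])
    then show "x = 0" "v = 0" "w = 0" using \<open>v = 0\<close> *(4) by auto
  qed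
  then show ?thesis using V by blast
qed

section \<open>The inner product of a decomposition and its adjoints\<close>

context
  fixes V g h
  assumes V: "decomposition V"
    and g: "\<And>k. inner_product_on (B k) (g k)" and h: "\<And>k. inner_product_on (A k) (h k)"
begin

lemma subspace_V: "subspace (V k)" and V_subset: "V k \<subseteq> B k"
  using V by auto

lemma subspace_dV: "subspace (dB (k + 1) ` V (k + 1))"
  by (rule linear_subspace_image[OF linear_dB subspace_V])

lemma dV_subset: "dB (k + 1) ` V (k + 1) \<subseteq> B k"
  using dB_mem[of _ "k + 1"] V_subset[of "k + 1"] by auto

lemma direct_sum: "direct_sum3 (B k) (i k ` A k) (V k) (dB (k + 1) ` V (k + 1))"
  by (rule conjunct2[OF V, THEN spec])

lemma decompose:
  assumes "x \<in> B k"
  obtains a v w where "a \<in> A k" "v \<in> V k" "w \<in> dB (k + 1) ` V (k + 1)" "x = i k a + v + w"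
proof -
  have "x \<in> {a + b + d | a b d. a \<in> i k ` A k \<and> b \<in> V k \<and> d \<in> dB (k + 1) ` V (k + 1)}"
    using direct_sum assms by (simp only: direct_sum3_def)
  then show thesis using that by auto
qed

lemma decompose_unique:
  assumes "a \<in> A k" "v \<in> V k" "w \<in> dB (k + 1) ` V (k + 1)"
    and "a' \<in> A k" "v' \<in> V k" "w' \<in> dB (k + 1) ` V (k + 1)"
    and "i k a + v + w = i k a' + v' + w'"
  shows "a = a'" "v = v'" "w = w'"
proof -
  have "i k a = i k a' \<and> v = v' \<and> w = w'"
    by (rule direct_sum3_unique[OF _ subspace_image_A subspace_V subspace_dV
          imageI[OF assms(1)] imageI[OF assms(4)] assms(2,5,3,6,7)]) (rule direct_sum)
  moreover have "a = a'" if "i k a = i k a'"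
    using that i_inj[of "a - a'" k] assms(1,4)
    by (simp add: linear_diff[OF linear_i] subspace_diff[OF subspace_A])
  ultimately show "a = a'" "v = v'" "w = w'" by auto
qed

text \<open>By bilinearity and symmetry the nine blocks of the inner product reduce to the six
  prescribed ones. Uniqueness and the computation of adjoints both rest on this formula.\<close>

lemma metric_extension_formula:
  assumes g': "metric_extension V g h g'"
    and m: "a \<in> A k" "v \<in> V k" "w \<in> dB (k + 1) ` V (k + 1)"
      "a' \<in> A k" "v' \<in> V k" "w' \<in> dB (k + 1) ` V (k + 1)"
  shows "g' k (i k a + v + w) (i k a' + v' + w') = h k a a' + g k v v' + g k w w'"
proof -
  have ip: "inner_product_on (B k) (g' k)" using g' by blast
  have B: "i k a \<in> B k" "i k a' \<in> B k" "v \<in> B k" "v' \<in> B k" "w \<in> B k" "w' \<in> B k"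
    using m V_subset[of k] dV_subset[of k] i_mem by blast+
  have B2: "i k a + v \<in> B k" "i k a' + v' \<in> B k" "i k a' + v' + w' \<in> B k"
    using B by (auto intro: subspace_add subspace_B)
  have s: "g' k v (i k a') = g' k (i k a') v" "g' k v w' = g' k w' v" "g' k w (i k a') = g' k (i k a') w"
    using inner_product_on_sym[OF ip] B by simp_all
  have "\<forall>x\<in>i k ` A k. \<forall>y\<in>dB (k + 1) ` V (k + 1). g' k x y = 0"
    "\<forall>x\<in>i k ` A k. \<forall>y\<in>V k. g' k x y = 0"
    "\<forall>x\<in>dB (k + 1) ` V (k + 1). \<forall>y\<in>V k. g' k x y = 0"
    "\<forall>x\<in>dB (k + 1) ` V (k + 1). \<forall>y\<in>dB (k + 1) ` V (k + 1). g' k x y = g k x y"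
    "\<forall>x\<in>V k. \<forall>y\<in>V k. g' k x y = g k x y"
    "\<forall>a\<in>A k. \<forall>b\<in>A k. g' k (i k a) (i k b) = h k a b"
    using g' unfolding Let_def by presburger+
  note ax = this[rule_format]
  have o: "g' k (i k a) v' = 0" "g' k (i k a) w' = 0" "g' k v (i k a') = 0" "g' k v w' = 0"
    "g' k w (i k a') = 0" "g' k w v' = 0" "g' k (i k a) (i k a') = h k a a'"
    "g' k v v' = g k v v'" "g' k w w' = g k w w'"
    unfolding s
    by (rule ax(2)[OF imageI[OF m(1)] m(5)] ax(1)[OF imageI[OF m(1)] m(6)] ax(2)[OF imageI[OF m(4)] m(2)]
        ax(3)[OF m(6) m(2)] ax(1)[OF imageI[OF m(4)] m(3)] ax(3)[OF m(3) m(5)] ax(6)[OF m(1,4)]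
        ax(5)[OF m(2,5)] ax(4)[OF m(3,6)])+
  show ?thesis
    using o by (simp add: inner_product_on_add_left[OF ip] inner_product_on_add_right[OF subspace_B ip] B B2)
qed

lemma metric_extension_unique:
  assumes "metric_extension V g h g'" "metric_extension V g h g''" "x \<in> B k" "y \<in> B k"
  shows "g'' k x y = g' k x y"
proof -
  obtain a v w where x: "a \<in> A k" "v \<in> V k" "w \<in> dB (k + 1) ` V (k + 1)" "x = i k a + v + w"
    using decompose[OF assms(3)] .
  obtain a' v' w' where y: "a' \<in> A k" "v' \<in> V k" "w' \<in> dB (k + 1) ` V (k + 1)" "y = i k a' + v' + w'"
    using decompose[OF assms(4)] .
  show ?thesis unfolding x(4) y(4)
    by (simp only: metric_extension_formula[OF assms(1) x(1-3) y(1-3)]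
        metric_extension_formula[OF assms(2) x(1-3) y(1-3)])
qed

text \<open>The projections onto the three summands are linear because decompositions are unique,
  and \<open>g'\<close> is the sum of the inner products of the components. It is positive because a
  nonzero vector has a nonzero component.\<close>

lemma metric_extension_exists: "\<exists>g'. metric_extension V g h g'"
proof -
  have "\<forall>k x. \<exists>a v w. x \<in> B k \<longrightarrow>
      a \<in> A k \<and> v \<in> V k \<and> w \<in> dB (k + 1) ` V (k + 1) \<and> x = i k a + v + w"
    using decompose by metis
  then obtain pa pv pw where p: "\<And>k x. x \<in> B k \<Longrightarrow> pa k x \<in> A k \<and> pv k x \<in> V k \<and>
      pw k x \<in> dB (k + 1) ` V (k + 1) \<and> x = i k (pa k x) + pv k x + pw k x"
    by metis
  define g' where "g' k x y = h k (pa k x) (pa k y) + g k (pv k x) (pv k y) + g k (pw k x) (pw k y)"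
    for k x y
  have pe: "pa k (i k a + v + w) = a" "pv k (i k a + v + w) = v" "pw k (i k a + v + w) = w"
    if "a \<in> A k" "v \<in> V k" "w \<in> dB (k + 1) ` V (k + 1)" for k a v w
  proof -
    have "i k a + v + w \<in> B k"
      using that V_subset[of k] dV_subset[of k] i_mem by (blast intro: subspace_add subspace_B)
    from p[OF this] show "pa k (i k a + v + w) = a" "pv k (i k a + v + w) = v" "pw k (i k a + v + w) = w"
      using decompose_unique[OF _ _ _ that] by metis+
  qed
  have z: "0 \<in> A k" "0 \<in> V k" "0 \<in> dB (k + 1) ` V (k + 1)" for k
    using subspace_0 subspace_A subspace_V subspace_dV by blast+
  have pI: "pa k (i k a) = a" "pv k (i k a) = 0" "pw k (i k a) = 0" if "a \<in> A k" for k a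
    using pe[OF that z(2,3)] by simp_all
  have pV: "pa k v = 0" "pv k v = v" "pw k v = 0" if "v \<in> V k" for k v
    using pe[OF z(1) that z(3)] by (simp_all add: linear_0[OF linear_i])
  have pW: "pa k w = 0" "pv k w = 0" "pw k w = w" if "w \<in> dB (k + 1) ` V (k + 1)" for k w
    using pe[OF z(1,2) that] by (simp_all add: linear_0[OF linear_i])
  have padd: "pa k (x + y) = pa k x + pa k y" "pv k (x + y) = pv k x + pv k y"
      "pw k (x + y) = pw k x + pw k y" if "x \<in> B k" "y \<in> B k" for k x y
  proof -
    have "x + y = (i k (pa k x) + pv k x + pw k x) + (i k (pa k y) + pv k y + pw k y)"
      by (rule arg_cong2[where f = "(+)"]) (use p that in blast)+
    then have "x + y = i k (pa k x + pa k y) + (pv k x + pv k y) + (pw k x + pw k y)"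
      by (simp only: linear_add[OF linear_i] ac_simps)
    then show "pa k (x + y) = pa k x + pa k y" "pv k (x + y) = pv k x + pv k y"
      "pw k (x + y) = pw k x + pw k y"
      using pe[of "pa k x + pa k y" k "pv k x + pv k y" "pw k x + pw k y"] p[OF that(1)] p[OF that(2)]
      by (simp_all add: subspace_add subspace_A subspace_V subspace_dV[simplified])
  qed
  have pscale: "pa k (r *\<^sub>R x) = r *\<^sub>R pa k x" "pv k (r *\<^sub>R x) = r *\<^sub>R pv k x"
      "pw k (r *\<^sub>R x) = r *\<^sub>R pw k x" if "x \<in> B k" for k x r
  proof -
    have "r *\<^sub>R x = i k (r *\<^sub>R pa k x) + r *\<^sub>R pv k x + r *\<^sub>R pw k x"
      by (subst p[OF that, THEN conjunct2, THEN conjunct2, THEN conjunct2])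
        (simp add: linear_scale[OF linear_i] scaleR_right_distrib)
    then show "pa k (r *\<^sub>R x) = r *\<^sub>R pa k x" "pv k (r *\<^sub>R x) = r *\<^sub>R pv k x"
      "pw k (r *\<^sub>R x) = r *\<^sub>R pw k x"
      using pe[of "r *\<^sub>R pa k x" k "r *\<^sub>R pv k x" "r *\<^sub>R pw k x"] p[OF that]
      by (simp_all add: subspace_scale subspace_A subspace_V subspace_dV[simplified])
  qed
  have mem: "pa k x \<in> A k" "pv k x \<in> B k" "pw k x \<in> B k" if "x \<in> B k" for k x
    using p[OF that] V_subset[of k] dV_subset[of k] by auto
  have "inner_product_on (B k) (g' k)" for k
    unfolding inner_product_on_def
  proof (intro conjI ballI allI impI)
    fix x y assume xy: "x \<in> B k" "y \<in> B k"
    show "g' k x y = g' k y x"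
      unfolding g'_def using inner_product_on_sym[OF h] inner_product_on_sym[OF g] mem xy by metis
    show "g' k (r *\<^sub>R x) y = r * g' k x y" for r
      unfolding g'_def by (simp add: pscale xy mem inner_product_on_scale_left[OF h]
          inner_product_on_scale_left[OF g] algebra_simps)
    show "g' k (x + y) z = g' k x z + g' k y z" if "z \<in> B k" for z
      unfolding g'_def by (simp add: padd xy that mem inner_product_on_add_left[OF h]
          inner_product_on_add_left[OF g])
  next
    fix x assume x: "x \<in> B k" "x \<noteq> 0"
    have "h k (pa k x) (pa k x) \<ge> 0" "g k (pv k x) (pv k x) \<ge> 0" "g k (pw k x) (pw k x) \<ge> 0"
      using inner_product_on_pos[OF h[of k], of "pa k x"] inner_product_on_pos[OF g[of k], of "pv k x"]
        inner_product_on_pos[OF g[of k], of "pw k x"] mem[OF x(1)]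
        inner_product_on_zero_left[OF subspace_A h[of k], of 0] subspace_0[OF subspace_A[of k]]
        inner_product_on_zero_left[OF subspace_B g[of k], of 0] subspace_0[OF subspace_B[of k]]
      by fastforce+
    moreover have "h k (pa k x) (pa k x) > 0 \<or> g k (pv k x) (pv k x) > 0 \<or> g k (pw k x) (pw k x) > 0"
    proof (rule ccontr)
      assume "\<not> ?thesis"
      then have "pa k x = 0" "pv k x = 0" "pw k x = 0"
        using inner_product_on_pos[OF h[of k], of "pa k x"] inner_product_on_pos[OF g[of k], of "pv k x"]
        inner_product_on_pos[OF g[of k], of "pw k x"] mem[OF x(1)] by blast+
      then show False using p[OF x(1)] x(2) by (simp add: linear_0[OF linear_i])
    qed
    ultimately show "g' k x x > 0" unfolding g'_def by linarith
  qed
  moreover have g0: "g k 0 x = 0" "g k x 0 = 0" if "x \<in> B k" for k x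
    using inner_product_on_zero_left[OF subspace_B g that] inner_product_on_zero_right[OF subspace_B g that] .
  moreover have h0: "h k 0 x = 0" "h k x 0 = 0" if "x \<in> A k" for k x
    using inner_product_on_zero_left[OF subspace_A h that] inner_product_on_zero_right[OF subspace_A h that] .
  have VB: "x \<in> B k" if "x \<in> V k" for x k using that V_subset by blast
  have WB: "x \<in> B k" if "x \<in> dB (k + 1) ` V (k + 1)" for x k using that dV_subset by blast
  have pI': "pv k x = 0" "pw k x = 0" and IA: "pa k x \<in> A k" if "x \<in> i k ` A k" for k x
    using that pI by auto
  have zB: "0 \<in> B k" for k by (rule subspace_0[OF subspace_B])
  have "\<forall>k. let I = i k ` A k; W = dB (k + 1) ` V (k + 1) in
        (\<forall>x\<in>I. \<forall>y\<in>W. g' k x y = 0) \<and>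
        (\<forall>x\<in>I. \<forall>y\<in>V k. g' k x y = 0) \<and>
        (\<forall>x\<in>W. \<forall>y\<in>V k. g' k x y = 0) \<and>
        (\<forall>x\<in>W. \<forall>y\<in>W. g' k x y = g k x y) \<and>
        (\<forall>x\<in>V k. \<forall>y\<in>V k. g' k x y = g k x y) \<and>
        (\<forall>a\<in>A k. \<forall>b\<in>A k. g' k (i k a) (i k b) = h k a b)"
    unfolding Let_def g'_def
    by (intro allI conjI ballI; simp only: pI' pI pV pW g0 h0 z zB VB WB IA add_0 add_0_right)
  ultimately show ?thesis by (intro exI[of _ g']) blast
qed

lemma adjoint_exists:
  assumes "finite E" "A k = span E" "y \<in> A (k - 1)"
  shows "\<exists>z. is_adjoint A dA h k y z"
proof -
  have "\<exists>z\<in>span E. \<forall>x\<in>span E. h k x z = h (k - 1) (dA k x) y"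
  proof (rule riesz_representation_span[OF assms(1)])
    show "inner_product_on (span E) (h k)" using h assms(2) by metis
    fix x assume x: "x \<in> span E"
    then have dx: "dA k x \<in> A (k - 1)" using assms(2) dA_mem by blast
    show "h (k - 1) (dA k (r *\<^sub>R x)) y = r * h (k - 1) (dA k x) y" for r
      by (simp only: linear_scale[OF linear_dA] inner_product_on_scale_left[OF h dx assms(3)])
    fix x' assume x': "x' \<in> span E"
    then have dx': "dA k x' \<in> A (k - 1)" using assms(2) dA_mem by blast
    show "h (k - 1) (dA k (x + x')) y = h (k - 1) (dA k x) y + h (k - 1) (dA k x') y"
      by (simp only: linear_add[OF linear_dA] inner_product_on_add_left[OF h dx dx' assms(3)])
  qed
  then show ?thesis by (auto simp: is_adjoint_def assms(2))
qed

text \<open>The boundary respects the decomposition: it maps \<open>i k a\<close> to the image of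
  \<open>i\<close>, \<open>v\<close> into the third summand, which is orthogonal to that image, and
  \<open>w\<close> to 0. Pairing with an element of the image therefore sees only \<open>a\<close>,
  where \<open>g'\<close> is \<open>h\<close>.\<close>

lemma adjoint_image:
  assumes g': "metric_extension V g h g'" and y: "y \<in> A (k - 1)" and z: "is_adjoint A dA h k y z"
  shows "is_adjoint B dB g' k (i (k - 1) y) (i k z)"
  unfolding is_adjoint_def
proof (intro conjI ballI)
  have zA: "z \<in> A k" and zeq: "\<And>x. x \<in> A k \<Longrightarrow> h k x z = h (k - 1) (dA k x) y"
    using z by (auto simp: is_adjoint_def)
  show "i k z \<in> B k" using zA by (rule i_mem)
  fix x assume "x \<in> B k"
  then obtain a v w where x: "a \<in> A k" "v \<in> V k" "w \<in> dB (k + 1) ` V (k + 1)" "x = i k a + v + w"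
    by (rule decompose)
  have z0: "0 \<in> A k" "0 \<in> V k" "0 \<in> dB (k + 1) ` V (k + 1)" for k
    using subspace_0 subspace_A subspace_V subspace_dV by blast+
  have g0: "g k x 0 = 0" if "x \<in> B k" for k x
    using inner_product_on_zero_right[OF subspace_B g that] .
  have VB: "v \<in> B k" "w \<in> B k" using x V_subset dV_subset by blast+
  have "g' k x (i k z) = h k a z"
    using metric_extension_formula[OF g' x(1-3) zA z0(2,3)] g0 VB by (simp add: x(4))
  also have "\<dots> = h (k - 1) (dA k a) y" by (rule zeq[OF x(1)])
  also have "\<dots> = g' (k - 1) (dB k x) (i (k - 1) y)"
  proof -
    have dw: "dB k w = 0" using x(3) V_subset[of "Suc k"] by (auto intro: dB_dB)
    have dx: "dB k x = i (k - 1) (dA k a) + 0 + dB k v"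
      by (simp add: x(4) linear_add[OF linear_dB] dw i_chain_map[OF x(1)])
    \<comment> \<open>For \<open>k = 0\<close> the right-hand side has degree 1, and membership
      holds because \<open>dB 0 v = 0\<close>.\<close>
    have dv: "dB k v \<in> dB (k - 1 + 1) ` V (k - 1 + 1)"
    proof (cases "k = 0")
      case True
      then show ?thesis using z0(3)[of 0] dB_0 by simp
    next
      case False
      then show ?thesis using x(2) by auto
    qed
    show ?thesis unfolding dx
      using metric_extension_formula[OF g' dA_mem[OF x(1)] z0(2) dv y z0(2) z0(3)] g0
        dB_mem[OF VB(1)] subspace_0[OF subspace_B] by simp
  qed
  finally show "g' k x (i k z) = g' (k - 1) (dB k x) (i (k - 1) y)" .
qed

end

end

section \<open>Alternating functions on lists\<close>

text \<open>Not tied to a complex or a degree, so that chains of \<open>N\<close> and of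
  \<open>M\<close> are treated alike; the support is a separate condition.\<close>

definition alternating :: "('a list \<Rightarrow> real) \<Rightarrow> bool" where
  "alternating c \<longleftrightarrow>
     (\<forall>xs p. p permutes {..<length xs} \<longrightarrow> c (permute_list p xs) = of_int (sign p) * c xs)"

definition omit :: "nat \<Rightarrow> 'a list \<Rightarrow> 'a list" where
  "omit i xs = take i xs @ drop (Suc i) xs"

lemma length_omit: "i < length xs \<Longrightarrow> length (omit i xs) = length xs - 1"
  by (auto simp: omit_def)

lemma nth_omit: "i < length xs \<Longrightarrow> j < length xs - 1 \<Longrightarrow> omit i xs ! j = xs ! insert_index i j"
  by (auto simp: omit_def nth_append insert_index_def min_def)

lemma set_omit_subset: "set (omit i xs) \<subseteq> set xs"
  by (auto simp: omit_def dest: in_set_takeD in_set_dropD)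

lemma set_omit_distinct: "distinct xs \<Longrightarrow> i < length xs \<Longrightarrow> set (omit i xs) = set xs - {xs ! i}"
proof -
  assume "distinct xs" and i: "i < length xs"
  then have "distinct (take i xs @ xs ! i # drop (Suc i) xs)" by (simp add: id_take_nth_drop[symmetric])
  then have "set (take i xs @ xs ! i # drop (Suc i) xs) - {xs ! i} = set (omit i xs)"
    by (auto simp: omit_def)
  then show ?thesis using i by (simp add: id_take_nth_drop[symmetric])
qed

lemma distinct_omit: "distinct xs \<Longrightarrow> distinct (omit i xs)"
  unfolding omit_def
  by (simp add: set_take_disj_set_drop_if_distinct)

lemma insert_eq_omit:
  assumes "i < length xs"
  shows "xs = take i (omit i xs) @ xs ! i # drop i (omit i xs)"
  using assms id_take_nth_drop[of i xs] by (simp add: omit_def min_def)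

lemma omit_insert: "i \<le> length ys \<Longrightarrow> omit i (take i ys @ v # drop i ys) = ys"
  by (simp add: omit_def)

lemma map_omit: "map f (omit i xs) = omit i (map f xs)"
  by (simp add: omit_def take_map drop_map)

lemma boundary_simplex_omit:
  "boundary_simplex xs = (\<Sum>i<length xs. (-1) ^ i *\<^sub>R oriented_simplex (omit i xs))"
  by (simp add: boundary_simplex_def omit_def)

lemma sum_fun_apply: "(\<Sum>x\<in>A. f x) y = (\<Sum>x\<in>A. f x y)"
  by (induction A rule: infinite_finite_induct) auto

lemma scaleR_fun_apply: "(r *\<^sub>R f) x = r *\<^sub>R f x"
  by (simp add: scaleR_fun_def)

lemma finite_permutes: "finite {p. p permutes {..<n::nat}}"
  by (simp add: finite_permutations)

lemma alternating_0: "alternating 0"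
  by (simp add: alternating_def)

lemma alternating_add: "alternating c \<Longrightarrow> alternating d \<Longrightarrow> alternating (c + d)"
  by (simp add: alternating_def algebra_simps)

lemma alternating_scale: "alternating c \<Longrightarrow> alternating (r *\<^sub>R c)"
  by (simp add: alternating_def scaleR_fun_apply)

lemma alternating_sum: "(\<And>x. x \<in> A \<Longrightarrow> alternating (f x)) \<Longrightarrow> alternating (\<Sum>x\<in>A. f x)"
  by (induction A rule: infinite_finite_induct) (auto simp: alternating_0 intro: alternating_add)

lemma permute_list_inv:
  assumes "p permutes {..<length xs}"
  shows "permute_list p (permute_list (inv_into UNIV p) xs) = xs" "permute_list (inv_into UNIV p) (permute_list p xs) = xs"
  using permute_list_compose[OF assms, of "inv_into UNIV p"] permutes_inv_o[OF assms]
    permute_list_compose[OF permutes_inv[OF assms], of p] by auto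

lemma sign_sq: "of_int (sign p) * (of_int (sign p) :: real) = 1"
  by (auto simp: sign_def)

lemma alternating_swap:
  assumes "alternating c"
  shows "c (a @ x # y # b) = - c (a @ y # x # b)"
proof -
  let ?p = "Transposition.transpose (length a) (Suc (length a))"
  let ?xs = "a @ y # x # b"
  have p: "?p permutes {..<length ?xs}" by (rule permutes_swap_id) auto
  have "permute_list ?p ?xs = a @ x # y # b"
  proof (rule nth_equalityI)
    fix i assume "i < length (permute_list ?p ?xs)"
    then have i: "i < length ?xs" by simp
    show "permute_list ?p ?xs ! i = (a @ x # y # b) ! i"
      using i by (auto simp: permute_list_nth[OF p] Transposition.transpose_def nth_append nth_Cons'
          split: if_splits)
  qed simp
  then show ?thesis using assms p unfolding alternating_def
    by (metis mult_minus1 n_not_Suc_n of_int_1 of_int_minus sign_swap_id)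
qed

lemma alternating_insert:
  assumes "alternating c"
  shows "c (a @ v # b) = (-1) ^ length a * c (v # a @ b)"
proof (induction a arbitrary: b rule: rev_induct)
  case (snoc x a)
  have "c ((a @ [x]) @ v # b) = - c (a @ v # x # b)"
    using alternating_swap[OF assms, of a x v b] by simp
  then show ?case using snoc[of "x # b"] by simp
qed simp

text \<open>Two equal entries are moved to the front, where swapping them shows that the value is
  its own negative.\<close>

lemma alternating_not_distinct:
  assumes "alternating c" "\<not> distinct xs"
  shows "c xs = 0"
proof -
  obtain a b d y where xs: "xs = a @ [y] @ b @ [y] @ d" using not_distinct_decomp[OF assms(2)] by blast
  have "c xs = (-1) ^ length a * c (y # a @ b @ y # d)"
    using alternating_insert[OF assms(1), of a y "b @ [y] @ d"] xs by simp
  also have "c (y # a @ b @ y # d) = - ((-1) ^ (length a + length b) * c (y # y # a @ b @ d))"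
    using alternating_insert[OF assms(1), of "y # a @ b" y d] by simp
  also have "c (y # y # a @ b @ d) = 0"
    using alternating_swap[OF assms(1), of "[]" y y] by simp
  finally show ?thesis by simp
qed

section \<open>Oriented simplices as determinants\<close>

definition incidence :: "'a list \<Rightarrow> 'a list \<Rightarrow> real mat" where
  "incidence xs ys = Matrix.mat (length xs) (length xs) (\<lambda>(i, j). if ys ! i = xs ! j then 1 else 0)"

lemma incidence_carrier: "incidence xs ys \<in> carrier_mat (length xs) (length xs)"
  by (simp add: incidence_def)

text \<open>In the Leibniz formula the product belonging to \<open>p\<close> is 1 if
  \<open>permute_list p xs = ys\<close> and 0 otherwise. Alternation in \<open>ys\<close> thus
  becomes the rule for permuted rows, and the boundary becomes a Laplace expansion, also for lists
  with repetitions.\<close>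

lemma oriented_simplex_det:
  "oriented_simplex xs ys =
     (if length ys = length xs then Determinant.det (incidence xs ys) else 0)"
proof (cases "length ys = length xs")
  case True
  let ?n = "length xs"
  have *: "(\<Prod>i = 0..<?n. incidence xs ys $$ (i, p i)) = (if permute_list p xs = ys then 1 else 0)"
    if p: "p permutes {..<?n}" for p
  proof -
    have pn: "p i < ?n" if "i < ?n" for i using permutes_in_image[OF p] that by auto
    have "(\<Prod>i = 0..<?n. incidence xs ys $$ (i, p i)) = (\<Prod>i = 0..<?n. if ys ! i = xs ! p i then 1 else 0)"
      by (rule prod.cong) (auto simp: incidence_def pn)
    also have "\<dots> = (if \<forall>i<?n. ys ! i = xs ! p i then 1 else 0)"
    proof (cases "\<forall>i<?n. ys ! i = xs ! p i")
      case True
      then show ?thesis by (auto intro!: prod.neutral)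
    next
      case False
      then obtain i where "i < ?n" "ys ! i \<noteq> xs ! p i" by blast
      then have "(\<Prod>i = 0..<?n. if ys ! i = xs ! p i then 1 else 0) = (0::real)"
        by (intro prod_zero) (auto intro!: bexI[of _ i])
      then show ?thesis using False by simp
    qed
    also have "(\<forall>i<?n. ys ! i = xs ! p i) \<longleftrightarrow> permute_list p xs = ys"
      using True by (auto simp: permute_list_nth[OF p] list_eq_iff_nth_eq)
    finally show ?thesis .
  qed
  have "Determinant.det (incidence xs ys) =
      (\<Sum>p | p permutes {..<?n}. of_int (sign p) * (if permute_list p xs = ys then 1 else 0))"
    unfolding det_def'[OF incidence_carrier] lessThan_atLeast0[symmetric]
    using * by (intro sum.cong) (auto simp: atLeast0LessThan)
  also have "\<dots> = oriented_simplex xs ys"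
    unfolding oriented_simplex_def
    by (rule sum.mono_neutral_cong_right) (auto simp: finite_permutes split: if_splits)
  finally show ?thesis using True by simp
next
  case False
  then have none: "{p. p permutes {..<length xs} \<and> permute_list p xs = ys} = {}" by auto
  show ?thesis using False unfolding oriented_simplex_def none by simp
qed

lemma alternating_oriented_simplex: "alternating (oriented_simplex xs)"
  unfolding alternating_def
proof (intro allI impI)
  fix ys :: "'a list" and p assume p: "p permutes {..<length ys}"
  show "oriented_simplex xs (permute_list p ys) = of_int (sign p) * oriented_simplex xs ys"
  proof (cases "length ys = length xs")
    case True
    have pn: "p i < length xs" if "i < length xs" for i
      using permutes_in_image[OF p] that True by auto
    have "incidence xs (permute_list p ys) =
        Matrix.mat (length xs) (length xs) (\<lambda>(i, j). incidence xs ys $$ (p i, j))"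
      by (rule eq_matI) (auto simp: incidence_def permute_list_nth[OF p] True pn)
    then show ?thesis
      using det_permute_rows[OF incidence_carrier, of p xs ys] p True
      by (simp add: oriented_simplex_det atLeast0LessThan)
  qed (simp add: oriented_simplex_det)
qed

lemma oriented_simplex_not_distinct: "\<not> distinct xs \<Longrightarrow> oriented_simplex xs = 0"
proof
  fix ys assume nd: "\<not> distinct xs"
  show "oriented_simplex xs ys = 0 ys"
  proof (cases "\<exists>p. p permutes {..<length xs} \<and> permute_list p xs = ys")
    case True
    then have "\<not> distinct ys" using nd by auto
    then show ?thesis using alternating_not_distinct[OF alternating_oriented_simplex] by simp
  next
    case False
    then have none: "{p. p permutes {..<length xs} \<and> permute_list p xs = ys} = {}" by auto
    show ?thesis unfolding oriented_simplex_def none by simp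
  qed
qed

lemma oriented_simplex_nonzero:
  assumes "oriented_simplex xs ys \<noteq> 0"
  shows "mset ys = mset xs" "distinct xs"
proof -
  have "\<exists>p. p permutes {..<length xs} \<and> permute_list p xs = ys"
  proof (rule ccontr)
    assume "\<not> ?thesis"
    then have none: "{p. p permutes {..<length xs} \<and> permute_list p xs = ys} = {}" by auto
    show False using assms unfolding oriented_simplex_def none by simp
  qed
  then show "mset ys = mset xs" by auto
  show "distinct xs" using oriented_simplex_not_distinct[of xs] assms by force
qed

lemma oriented_simplex_self:
  assumes "distinct xs"
  shows "oriented_simplex xs xs = 1"
proof -
  have "incidence xs xs = 1\<^sub>m (length xs)"
    by (rule eq_matI) (auto simp: incidence_def nth_eq_iff_index_eq[OF assms])
  then show ?thesis by (simp add: oriented_simplex_det)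
qed

lemma oriented_simplex_permute_self:
  "distinct xs \<Longrightarrow> p permutes {..<length xs} \<Longrightarrow> oriented_simplex xs (permute_list p xs) = of_int (sign p)"
  using alternating_oriented_simplex[of xs] oriented_simplex_self[of xs] by (simp add: alternating_def)

lemma distinct_same_set_permute:
  assumes "distinct xs" "distinct ys" "set xs = set ys"
  obtains p where "p permutes {..<length xs}" "permute_list p xs = ys"
proof -
  have "mset ys = mset xs" using assms by (simp add: set_eq_iff_mset_eq_distinct)
  then show ?thesis using that by (rule mset_eq_permutation)
qed

text \<open>Lists of this length in \<open>set xs\<close> either repeat an entry, where
  \<open>c\<close> vanishes, or reorder \<open>xs\<close>. Hence one value determines
  \<open>c\<close>.\<close>

lemma alternating_eq_oriented_simplex:
  assumes c: "alternating c" and xs: "distinct xs"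
    and supp: "\<And>ys. c ys \<noteq> 0 \<Longrightarrow> length ys = length xs \<and> set ys \<subseteq> set xs"
  shows "c = c xs *\<^sub>R oriented_simplex xs"
proof
  fix ys
  show "c ys = (c xs *\<^sub>R oriented_simplex xs) ys"
  proof (cases "distinct ys \<and> set ys = set xs")
    case True
    then obtain p where p: "p permutes {..<length xs}" "permute_list p xs = ys"
      using distinct_same_set_permute xs by metis
    then show ?thesis using c oriented_simplex_permute_self[OF xs p(1)]
      by (auto simp: alternating_def scaleR_fun_apply)
  next
    case False
    have "c ys = 0"
    proof (rule ccontr)
      assume "c ys \<noteq> 0"
      then have "distinct ys" "length ys = length xs" "set ys \<subseteq> set xs"
        using alternating_not_distinct[OF c] supp by blast+
      moreover from this have "set ys = set xs"
        using xs by (metis card_subset_eq distinct_card finite_set)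
      ultimately show False using False by blast
    qed
    moreover have "oriented_simplex xs ys = 0"
      using False oriented_simplex_nonzero[of xs ys] by (metis mset_eq_imp_distinct_iff mset_eq_setD)
    ultimately show ?thesis by (simp add: scaleR_fun_apply)
  qed
qed

text \<open>At \<open>ys\<close> each of the \<open>n!\<close> permutations contributes one ordering
  \<open>xs\<close>; the sign in \<open>oriented_simplex xs\<close> and the sign relating
  \<open>c xs\<close> to \<open>c ys\<close> cancel.\<close>

lemma sum_oriented_simplex:
  assumes c: "alternating c" and S: "finite S" and supp: "\<And>xs. c xs \<noteq> 0 \<Longrightarrow> xs \<in> S"
    and len: "\<And>xs. xs \<in> S \<Longrightarrow> length xs = n"
  shows "(\<Sum>xs\<in>S. c xs *\<^sub>R oriented_simplex xs) = fact n *\<^sub>R c"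
proof
  fix ys
  let ?P = "{p. p permutes {..<n}}"
  show "(\<Sum>xs\<in>S. c xs *\<^sub>R oriented_simplex xs) ys = (fact n *\<^sub>R c) ys"
  proof (cases "length ys = n")
    case True
    have "(\<Sum>xs\<in>S. c xs *\<^sub>R oriented_simplex xs) ys =
        (\<Sum>xs\<in>S. \<Sum>p\<in>?P. if xs = permute_list (inv_into UNIV p) ys then of_int (sign p) * c xs else 0)"
      unfolding sum_fun_apply
    proof (rule sum.cong[OF refl])
      fix xs assume "xs \<in> S"
      then have n: "length xs = n" by (rule len)
      have iff: "permute_list p xs = ys \<longleftrightarrow> xs = permute_list (inv_into UNIV p) ys" if "p permutes {..<n}" for p
        using permute_list_inv[of p xs] permute_list_inv[of p ys] that n True by auto
      have "(c xs *\<^sub>R oriented_simplex xs) ys =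
          (\<Sum>p | p permutes {..<n} \<and> permute_list p xs = ys. of_int (sign p) * c xs)"
        by (simp add: scaleR_fun_apply oriented_simplex_def sum_distrib_left n mult.commute[of _ "c xs"])
      also have "\<dots> = (\<Sum>p\<in>?P. if xs = permute_list (inv_into UNIV p) ys then of_int (sign p) * c xs else 0)"
        by (rule sum.mono_neutral_cong_left) (use iff in \<open>auto simp: finite_permutes\<close>)
      finally show "(c xs *\<^sub>R oriented_simplex xs) ys = \<dots>" .
    qed
    also have "\<dots> = (\<Sum>p\<in>?P. \<Sum>xs\<in>S. if xs = permute_list (inv_into UNIV p) ys then of_int (sign p) * c xs else 0)"
      by (rule sum.swap)
    also have "\<dots> = (\<Sum>p\<in>?P. c ys)"
    proof (rule sum.cong[OF refl])
      fix p assume "p \<in> ?P"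
      then have p: "p permutes {..<length ys}" using True by simp
      have "(\<Sum>xs\<in>S. if xs = permute_list (inv_into UNIV p) ys then of_int (sign p) * c xs else 0) =
          of_int (sign p) * c (permute_list (inv_into UNIV p) ys)"
        using S supp by (auto simp: sum.delta)
      also have "\<dots> = c ys"
        using c permute_list_inv(1)[OF p] p unfolding alternating_def
        by (metis length_permute_list)
      finally show "(\<Sum>xs\<in>S. if xs = permute_list (inv_into UNIV p) ys then of_int (sign p) * c xs else 0) = c ys" .
    qed
    also have "\<dots> = (fact n *\<^sub>R c) ys"
      by (simp add: scaleR_fun_apply card_permutations)
    finally show ?thesis .
  next
    case False
    then have "c ys = 0" using supp len by blast
    moreover have "oriented_simplex xs ys = 0" if "xs \<in> S" for xs
      using len[OF that] False by (simp add: oriented_simplex_det)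
    ultimately show ?thesis by (simp add: sum_fun_apply scaleR_fun_apply)
  qed
qed

section \<open>The boundary of alternating functions\<close>

text \<open>
  The boundary formula for alternating functions. In contrast to \<open>boundary\<close> it is augmented: a
  \<open>0\<close>-chain is sent to the sum of its coefficients, placed at \<open>[]\<close>.
\<close>

definition alt_boundary :: "'a set \<Rightarrow> ('a list \<Rightarrow> real) \<Rightarrow> 'a list \<Rightarrow> real" where
  "alt_boundary X c = (\<lambda>ys. \<Sum>v\<in>X. c (v # ys))"

lemma linear_alt_boundary: "linear (alt_boundary X)"
  by (rule linearI) (auto simp: alt_boundary_def fun_eq_iff sum.distrib scaleR_fun_apply sum_distrib_left)

lemmas alt_boundary_linear = linear_sum[OF linear_alt_boundary] linear_scale[OF linear_alt_boundary]

text \<open>Exchanging the two inserted vertices changes the sign of each term but not the double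
  sum.\<close>

lemma alt_boundary_alt_boundary:
  assumes "alternating c"
  shows "alt_boundary X (alt_boundary X c) = 0"
proof
  fix ys
  have "(\<Sum>v\<in>X. \<Sum>w\<in>X. c (w # v # ys)) = (\<Sum>v\<in>X. \<Sum>w\<in>X. - c (v # w # ys))"
    using alternating_swap[OF assms, of "[]"] by (metis (no_types, lifting) append_Nil sum.cong)
  also have "\<dots> = - (\<Sum>v\<in>X. \<Sum>w\<in>X. c (w # v # ys))"
    by (subst sum.swap) (simp add: sum_negf)
  finally show "alt_boundary X (alt_boundary X c) ys = 0 ys" by (simp add: alt_boundary_def)
qed

text \<open>Laplace expansion of the incidence matrix along its first row. That row has a 1 where
  \<open>xs ! j = v\<close>, and deleting column \<open>j\<close> leaves the incidence matrix of
  \<open>omit j xs\<close>; summing over \<open>v\<close> selects each \<open>j\<close>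
  once.\<close>

lemma alt_boundary_oriented_simplex:
  assumes X: "finite X" "set xs \<subseteq> X"
  shows "alt_boundary X (oriented_simplex xs) = boundary_simplex xs"
proof
  fix ys
  show "alt_boundary X (oriented_simplex xs) ys = boundary_simplex xs ys"
  proof (cases "Suc (length ys) = length xs")
    case True
    let ?n = "length xs"
    have n: "0 < ?n" using True by linarith
    have del: "mat_delete (incidence xs (v # ys)) 0 j = incidence (omit j xs) ys" if j: "j < ?n" for v j
      using j True by (intro eq_matI)
        (auto simp: mat_delete_def incidence_def length_omit nth_omit insert_index_def)
    have e0: "incidence xs (v # ys) $$ (0, j) = (if v = xs ! j then 1 else 0)" if "j < ?n" for v j
      using that n by (simp add: incidence_def)
    have "alt_boundary X (oriented_simplex xs) ys =
        (\<Sum>v\<in>X. \<Sum>j<?n. (if v = xs ! j then 1 else 0) * ((-1) ^ j * oriented_simplex (omit j xs) ys))"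
      unfolding alt_boundary_def
    proof (rule sum.cong[OF refl])
      fix v assume "v \<in> X"
      have "oriented_simplex xs (v # ys) = Determinant.det (incidence xs (v # ys))"
        using True by (simp add: oriented_simplex_det)
      also have "\<dots> = (\<Sum>j<?n. incidence xs (v # ys) $$ (0, j) * cofactor (incidence xs (v # ys)) 0 j)"
        by (rule laplace_expansion_row[OF incidence_carrier n])
      also have "\<dots> = (\<Sum>j<?n. (if v = xs ! j then 1 else 0) * ((-1) ^ j * oriented_simplex (omit j xs) ys))"
        by (rule sum.cong[OF refl])
          (use True in \<open>auto simp: cofactor_def del e0 oriented_simplex_det length_omit\<close>)
      finally show "oriented_simplex xs (v # ys) = \<dots>" .
    qed
    also have "\<dots> = (\<Sum>j<?n. \<Sum>v\<in>X. (if v = xs ! j then 1 else 0) * ((-1) ^ j * oriented_simplex (omit j xs) ys))"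
      by (rule sum.swap)
    also have "\<dots> = (\<Sum>j<?n. (-1) ^ j * oriented_simplex (omit j xs) ys)"
    proof (rule sum.cong[OF refl])
      fix j assume "j \<in> {..<?n}"
      then have "xs ! j \<in> X" using X by auto
      then have "(\<Sum>v\<in>X. (if v = xs ! j then 1 else 0 :: real)) = 1" using X by simp
      then show "(\<Sum>v\<in>X. (if v = xs ! j then 1 else 0) * ((-1) ^ j * oriented_simplex (omit j xs) ys)) =
          (-1) ^ j * oriented_simplex (omit j xs) ys"
        by (simp only: sum_distrib_right[symmetric] mult_1_left)
    qed
    also have "\<dots> = boundary_simplex xs ys"
      by (simp add: boundary_simplex_omit sum_fun_apply scaleR_fun_apply)
    finally show ?thesis .
  next
    case False
    then show ?thesis
      by (auto simp: alt_boundary_def oriented_simplex_det boundary_simplex_omit sum_fun_apply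
          scaleR_fun_apply length_omit intro!: sum.neutral)
  qed
qed

text \<open>Expansion in oriented simplices avoids extending a permutation of \<open>ys\<close> to
  one of \<open>v # ys\<close>.\<close>

lemma alternating_alt_boundary:
  assumes c: "alternating c" and S: "finite S" and supp: "\<And>xs. c xs \<noteq> 0 \<Longrightarrow> xs \<in> S"
    and len: "\<And>xs. xs \<in> S \<Longrightarrow> length xs = n" and X: "finite X" "\<And>xs. xs \<in> S \<Longrightarrow> set xs \<subseteq> X"
  shows "alternating (alt_boundary X c)"
proof -
  have "fact n *\<^sub>R alt_boundary X c = alt_boundary X (\<Sum>xs\<in>S. c xs *\<^sub>R oriented_simplex xs)"
    by (simp add: sum_oriented_simplex[OF c S supp len] linear_scale[OF linear_alt_boundary])
  also have "\<dots> = (\<Sum>xs\<in>S. c xs *\<^sub>R boundary_simplex xs)"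
    by (simp add: alt_boundary_linear
        alt_boundary_oriented_simplex X)
  finally have eq: "fact n *\<^sub>R alt_boundary X c = (\<Sum>xs\<in>S. c xs *\<^sub>R boundary_simplex xs)" .
  have "alt_boundary X c = (1 / fact n) *\<^sub>R (fact n *\<^sub>R alt_boundary X c)" by simp
  then show ?thesis
    unfolding eq boundary_simplex_omit
    by (simp add: alternating_scale alternating_sum alternating_oriented_simplex)
qed

section \<open>Ordered chains\<close>

text \<open>
  With these rules, a premise that equates two chains would be rewritten to \<open>\<lambda>\<close>-abstracted form.
\<close>

declare minus_apply [simp del] uminus_apply [simp del] plus_fun_apply [simp del] zero_fun_apply [simp del]

definition list_chain :: "'a list \<Rightarrow> 'a list \<Rightarrow> real" where
  "list_chain xs = (\<lambda>ys. if ys = xs then 1 else 0)"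

text \<open>Linear on all functions, since \<open>construct\<close> extends from the independent
  family of the \<open>list_chain xs\<close> to the whole space. On functions outside the span the
  value is unspecified, which is why identities are stated on \<open>ordered_chains\<close>.\<close>

definition chain_extend :: "('a list \<Rightarrow> 'b list \<Rightarrow> real) \<Rightarrow> ('a list \<Rightarrow> real) \<Rightarrow> 'b list \<Rightarrow> real" where
  "chain_extend \<phi> = Real_Vector_Spaces.construct (range list_chain) (\<phi> \<circ> inv_into UNIV list_chain)"

text \<open>The augmented boundary of ordered chains: \<open>[x]\<close> is sent to
  \<open>[]\<close>. Lists with repetitions are generators like all others.\<close>

definition ord_boundary :: "('a list \<Rightarrow> real) \<Rightarrow> 'a list \<Rightarrow> real" where
  "ord_boundary = chain_extend (\<lambda>xs. \<Sum>i<length xs. (-1) ^ i *\<^sub>R list_chain (omit i xs))"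

definition antisym :: "('a list \<Rightarrow> real) \<Rightarrow> 'a list \<Rightarrow> real" where
  "antisym = chain_extend oriented_simplex"

definition push :: "('a \<Rightarrow> 'b) \<Rightarrow> ('a list \<Rightarrow> real) \<Rightarrow> 'b list \<Rightarrow> real" where
  "push f = chain_extend (\<lambda>xs. list_chain (map f xs))"

definition cone :: "'a \<Rightarrow> ('a list \<Rightarrow> real) \<Rightarrow> 'a list \<Rightarrow> real" where
  "cone v = chain_extend (\<lambda>xs. list_chain (v # xs))"

lemma inj_list_chain: "inj list_chain"
  by (rule injI) (metis list_chain_def zero_neq_one)

lemma list_chain_expansion:
  assumes "finite S" "\<And>xs. c xs \<noteq> 0 \<Longrightarrow> xs \<in> S"
  shows "c = (\<Sum>xs\<in>S. c xs *\<^sub>R list_chain xs)"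
proof
  fix ys
  have "(\<Sum>xs\<in>S. c xs *\<^sub>R list_chain xs) ys = (\<Sum>xs\<in>S. if xs = ys then c xs else 0)"
    by (auto simp: sum_fun_apply scaleR_fun_apply list_chain_def intro!: sum.cong)
  also have "\<dots> = c ys" using assms by (auto simp: sum.delta)
  finally show "c ys = (\<Sum>xs\<in>S. c xs *\<^sub>R list_chain xs) ys" by simp
qed

lemma independent_list_chain: "independent (range list_chain)"
  unfolding real_vector.independent_explicit_module
proof (intro allI impI)
  fix t :: "('a list \<Rightarrow> real) set" and u v
  assume t: "finite t" "t \<subseteq> range list_chain" and 0: "(\<Sum>w\<in>t. u w *\<^sub>R w) = 0" and v: "v \<in> t"
  obtain xs where xs: "v = list_chain xs" using v t by auto
  have "u w * w xs = (if w = v then u v else 0)" if "w \<in> t" for w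
  proof -
    obtain ys where "w = list_chain ys" using \<open>w \<in> t\<close> t by auto
    then show ?thesis using xs inj_eq[OF inj_list_chain, of ys xs]
      by (auto simp: list_chain_def[of ys])
  qed
  then have "(\<Sum>w\<in>t. u w *\<^sub>R w) xs = u v"
    using t(1) v by (simp add: sum_fun_apply scaleR_fun_apply)
  then show "u v = 0" using 0 by (simp add: zero_fun_apply)
qed

lemma linear_chain_extend: "linear (chain_extend \<phi>)"
  unfolding chain_extend_def by (rule linear_construct[OF independent_list_chain])

lemma chain_extend_list_chain: "chain_extend \<phi> (list_chain xs) = \<phi> xs"
  unfolding chain_extend_def
  by (subst construct_basis[OF independent_list_chain]) (auto simp: inv_f_f[OF inj_list_chain])

lemmas linear_ord_boundary = linear_chain_extend[of "\<lambda>xs. \<Sum>i<length xs. (-1) ^ i *\<^sub>R list_chain (omit i xs)",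
    folded ord_boundary_def]
lemmas linear_antisym = linear_chain_extend[of oriented_simplex, folded antisym_def]
lemmas linear_push = linear_chain_extend[of "\<lambda>xs. list_chain (map f xs)" for f, folded push_def]
lemmas linear_cone = linear_chain_extend[of "\<lambda>xs. list_chain (v # xs)" for v, folded cone_def]

lemmas ord_boundary_linear = linear_sum[OF linear_ord_boundary] linear_scale[OF linear_ord_boundary]
lemmas antisym_linear = linear_sum[OF linear_antisym] linear_scale[OF linear_antisym]
lemmas push_linear = linear_sum[OF linear_push] linear_scale[OF linear_push]
lemmas cone_linear = linear_sum[OF linear_cone] linear_scale[OF linear_cone]

lemma ord_boundary_list_chain:
  "ord_boundary (list_chain xs) = (\<Sum>i<length xs. (-1) ^ i *\<^sub>R list_chain (omit i xs))"
  unfolding ord_boundary_def by (rule chain_extend_list_chain)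

lemma antisym_list_chain: "antisym (list_chain xs) = oriented_simplex xs"
  unfolding antisym_def by (rule chain_extend_list_chain)

lemma push_list_chain: "push f (list_chain xs) = list_chain (map f xs)"
  unfolding push_def by (rule chain_extend_list_chain)

lemma cone_list_chain: "cone v (list_chain xs) = list_chain (v # xs)"
  unfolding cone_def by (rule chain_extend_list_chain)

text \<open>Supports of chains are expressed as membership in a span; by this rule an operator is
  shown to keep chains small, or inside a simplex, by looking at generators only.\<close>

lemma linear_image_span_subset:
  assumes "linear f" "\<And>x. x \<in> S \<Longrightarrow> f x \<in> span T" "c \<in> span S"
  shows "f c \<in> span T"
proof -
  have "f c \<in> f ` span S" using assms(3) by blast
  also have "\<dots> = span (f ` S)" by (rule linear_span_image[OF assms(1), symmetric])
  also have "\<dots> \<subseteq> span T" by (rule span_minimal) (use assms(2) in auto)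
  finally show ?thesis .
qed

abbreviation "ordered_chains \<equiv> span (range list_chain)"

lemma chain_extend_ordered:
  assumes "\<And>xs. \<phi> xs \<in> ordered_chains" "c \<in> ordered_chains"
  shows "chain_extend \<phi> c \<in> ordered_chains"
  by (rule linear_image_span_subset[OF linear_chain_extend _ assms(2)])
    (auto simp: chain_extend_list_chain assms(1))

lemma list_chain_ordered: "list_chain xs \<in> ordered_chains"
  by (simp add: span_base)

lemma ord_boundary_ordered: "c \<in> ordered_chains \<Longrightarrow> ord_boundary c \<in> ordered_chains"
  unfolding ord_boundary_def
  by (rule chain_extend_ordered) (intro span_sum span_scale list_chain_ordered)

lemma cone_ordered: "c \<in> ordered_chains \<Longrightarrow> cone v c \<in> ordered_chains"
  unfolding cone_def by (rule chain_extend_ordered) (rule list_chain_ordered)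

lemma push_ordered: "c \<in> ordered_chains \<Longrightarrow> push f c \<in> ordered_chains"
  unfolding push_def by (rule chain_extend_ordered) (rule list_chain_ordered)

lemma ordered_chain_eqI:
  assumes "linear F" "linear G" "\<And>xs. F (list_chain xs) = G (list_chain xs)" "c \<in> ordered_chains"
  shows "F c = G c"
  by (rule linear_eq_on_span[OF assms(1,2) _ assms(4)]) (use assms(3) in auto)

text \<open>The first face drops the apex, and the others are cones with the sign shifted by one. By
  the augmentation this includes \<open>xs = []\<close>.\<close>

lemma ord_boundary_cone_list_chain:
  "ord_boundary (cone v (list_chain xs)) = list_chain xs - cone v (ord_boundary (list_chain xs))"
proof -
  have "ord_boundary (cone v (list_chain xs)) =
      list_chain xs + (\<Sum>i<length xs. (-1) ^ Suc i *\<^sub>R list_chain (v # omit i xs))"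
    unfolding cone_list_chain ord_boundary_list_chain length_Cons
    by (subst sum.lessThan_Suc_shift) (simp add: omit_def)
  also have "(\<Sum>i<length xs. (-1) ^ Suc i *\<^sub>R list_chain (v # omit i xs)) =
      - cone v (ord_boundary (list_chain xs))"
    by (simp add: ord_boundary_list_chain cone_linear
        cone_list_chain sum_negf)
  finally show ?thesis by simp
qed

lemma ord_boundary_cone:
  assumes "c \<in> ordered_chains"
  shows "ord_boundary (cone v c) = c - cone v (ord_boundary c)"
  by (rule ordered_chain_eqI[of "\<lambda>c. ord_boundary (cone v c)" "\<lambda>c. c - cone v (ord_boundary c)"])
    (simp_all add: ord_boundary_cone_list_chain assms linear_compose[unfolded o_def]
      linear_compose_sub linear_id[unfolded id_def] linear_cone linear_ord_boundary)

lemma ord_boundary_Nil: "ord_boundary (list_chain []) = 0"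
  by (simp add: ord_boundary_list_chain)

text \<open>Every list is an iterated cone. Applying the cone formula twice leaves the cone over the
  double boundary of a shorter list, which is 0 by induction.\<close>

lemma ord_boundary_ord_boundary:
  assumes "c \<in> ordered_chains"
  shows "ord_boundary (ord_boundary c) = 0"
proof -
  have "ord_boundary (ord_boundary (list_chain xs)) = 0" for xs :: "'a list"
  proof (induction xs)
    case (Cons v xs)
    have "ord_boundary (ord_boundary (cone v (list_chain xs))) = 0"
      using Cons ord_boundary_ordered[OF list_chain_ordered[of xs]]
      by (simp add: ord_boundary_cone_list_chain linear_diff[OF linear_ord_boundary]
          ord_boundary_cone linear_0[OF linear_cone])
    then show ?case by (simp add: cone_list_chain)
  qed (simp add: ord_boundary_Nil linear_0[OF linear_ord_boundary])
  then show ?thesis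
    using ordered_chain_eqI[of "\<lambda>c. ord_boundary (ord_boundary c)" "\<lambda>_. 0", OF _ _ _ assms]
    by (simp add: linear_compose[unfolded o_def] linear_ord_boundary linear_zero)
qed

lemma ord_boundary_push:
  assumes "c \<in> ordered_chains"
  shows "ord_boundary (push f c) = push f (ord_boundary c)"
  by (rule ordered_chain_eqI[of "\<lambda>c. ord_boundary (push f c)" "\<lambda>c. push f (ord_boundary c)"])
    (simp_all add: assms linear_compose[unfolded o_def] linear_push linear_ord_boundary
      push_list_chain ord_boundary_list_chain push_linear map_omit)

text \<open>\<open>antisym\<close> is a chain map from ordered to alternating chains. The entries
  must lie in \<open>X\<close> because \<open>alt_boundary X\<close> sums over vertices of
  \<open>X\<close> only.\<close>

lemma alt_boundary_antisym:
  assumes X: "finite X" and c: "c \<in> span (list_chain ` {xs. set xs \<subseteq> X})"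
  shows "alt_boundary X (antisym c) = antisym (ord_boundary c)"
proof (rule linear_eq_on_span[of "\<lambda>c. alt_boundary X (antisym c)" "\<lambda>c. antisym (ord_boundary c)",
      OF _ _ _ c])
  show "linear (\<lambda>c. alt_boundary X (antisym c))" "linear (\<lambda>c. antisym (ord_boundary c))"
    by (simp_all add: linear_compose[unfolded o_def] linear_antisym linear_ord_boundary linear_alt_boundary)
  fix b assume "b \<in> list_chain ` {xs. set xs \<subseteq> X}"
  then show "alt_boundary X (antisym b) = antisym (ord_boundary b)"
    by (auto simp: antisym_list_chain alt_boundary_oriented_simplex[OF X] boundary_simplex_omit
        ord_boundary_list_chain antisym_linear)
qed

text \<open>
  The faces \<open>i = 0, \<dots>, n - 1\<close> of an alternating chain contribute equally, whence the factor \<open>n\<close>.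
\<close>

lemma ord_boundary_alternating:
  assumes c: "alternating c" and S: "finite S" and supp: "\<And>xs. c xs \<noteq> 0 \<Longrightarrow> xs \<in> S"
    and len: "\<And>xs. xs \<in> S \<Longrightarrow> length xs = n" and X: "finite X" "\<And>xs. xs \<in> S \<Longrightarrow> set xs \<subseteq> X"
  shows "ord_boundary c = real n *\<^sub>R alt_boundary X c"
proof
  fix ys :: "'a list"
  let ?ins = "\<lambda>i v. take i ys @ v # drop i ys"
  have "ord_boundary c ys = (\<Sum>xs\<in>S. c xs *\<^sub>R (\<Sum>i<length xs. (-1) ^ i *\<^sub>R list_chain (omit i xs))) ys"
    by (subst list_chain_expansion[of S c, OF S supp], assumption)
      (simp add: ord_boundary_linear ord_boundary_list_chain)
  also have "\<dots> = (\<Sum>xs\<in>S. \<Sum>i<n. if omit i xs = ys then (-1) ^ i * c xs else 0)"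
    by (simp add: sum_fun_apply scaleR_fun_apply list_chain_def len sum_distrib_left)
      (intro sum.cong; auto)
  also have "\<dots> = (\<Sum>i<n. \<Sum>xs\<in>S. if omit i xs = ys then (-1) ^ i * c xs else 0)"
    by (rule sum.swap)
  also have "\<dots> = (\<Sum>i<n. alt_boundary X c ys)"
  proof (rule sum.cong[OF refl])
    fix i assume "i \<in> {..<n}"
    then have i: "i < n" by simp
    show "(\<Sum>xs\<in>S. if omit i xs = ys then (-1) ^ i * c xs else 0) = alt_boundary X c ys"
    proof (cases "length ys = n - 1")
      case True
      then have il: "i \<le> length ys" using i by simp
      have "(\<Sum>xs\<in>S. if omit i xs = ys then (-1) ^ i * c xs else 0) =
          (\<Sum>xs | xs \<in> S \<and> omit i xs = ys. (-1) ^ i * c xs)"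
        using S by (simp add: sum.inter_filter)
      also have "\<dots> = (\<Sum>xs\<in>?ins i ` X. (-1) ^ i * c xs)"
      proof (rule sum.mono_neutral_left)
        show "finite (?ins i ` X)" using X by simp
        show "{xs \<in> S. omit i xs = ys} \<subseteq> ?ins i ` X"
        proof
          fix xs assume "xs \<in> {xs \<in> S. omit i xs = ys}"
          then have xs: "xs \<in> S" "omit i xs = ys" "i < length xs" using len i by auto
          then have "xs = ?ins i (xs ! i)" using insert_eq_omit[of i xs] by simp
          moreover have "xs ! i \<in> X" using X(2)[OF xs(1)] xs(3) by auto
          ultimately show "xs \<in> ?ins i ` X" by blast
        qed
        show "\<forall>xs\<in>?ins i ` X - {xs \<in> S. omit i xs = ys}. (-1) ^ i * c xs = 0"
          using supp omit_insert[OF il] by auto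
      qed
      also have "\<dots> = (\<Sum>v\<in>X. (-1) ^ i * c (?ins i v))"
        by (subst sum.reindex) (auto intro!: inj_onI)
      also have "\<dots> = (\<Sum>v\<in>X. c (v # ys))"
      proof (rule sum.cong[OF refl])
        fix v
        have "c (?ins i v) = (-1) ^ i * c (v # ys)"
          using alternating_insert[OF c, of "take i ys" v "drop i ys"] il by (simp add: min_def)
        then show "(-1) ^ i * c (?ins i v) = c (v # ys)"
          by (simp add: power_add[symmetric] mult.assoc[symmetric] power_mult_distrib[symmetric])
      qed
      finally show ?thesis by (simp add: alt_boundary_def)
    next
      case False
      have "omit i xs \<noteq> ys" if "xs \<in> S" for xs
        using len[OF that] i False length_omit[of i xs] by auto
      moreover have "c (v # ys) = 0" for v using supp[of "v # ys"] len[of "v # ys"] False by force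
      ultimately show ?thesis by (auto simp: alt_boundary_def intro!: sum.neutral)
    qed
  qed
  also have "\<dots> = (real n *\<^sub>R alt_boundary X c) ys" by (simp add: scaleR_fun_apply)
  finally show "ord_boundary c ys = (real n *\<^sub>R alt_boundary X c) ys" .
qed

section \<open>Barycentric subdivision\<close>

definition barycentre :: "'a::real_vector list \<Rightarrow> 'a" where
  "barycentre xs = (1 / real (length xs)) *\<^sub>R (\<Sum>i<length xs. xs ! i)"

text \<open>The cone from the barycentre over the subdivided boundary. The entries are arbitrary
  points, so degenerate simplices are subdivided by the same formula.\<close>

function sd_list :: "'a::real_vector list \<Rightarrow> 'a list \<Rightarrow> real" where
  "sd_list xs = (if xs = [] then list_chain []
     else cone (barycentre xs) (\<Sum>i<length xs. (-1) ^ i *\<^sub>R sd_list (omit i xs)))"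
  by auto
termination
  by (relation "Wellfounded.measure length") (auto simp: length_omit)

declare sd_list.simps [simp del]

definition sd :: "('a::real_vector list \<Rightarrow> real) \<Rightarrow> 'a list \<Rightarrow> real" where
  "sd = chain_extend sd_list"

lemmas linear_sd = linear_chain_extend[of sd_list, folded sd_def]

lemmas sd_linear = linear_sum[OF linear_sd] linear_scale[OF linear_sd]

lemma sd_list_chain: "sd (list_chain xs) = sd_list xs"
  unfolding sd_def by (rule chain_extend_list_chain)

lemma sd_ord_boundary_list_chain:
  "sd (ord_boundary (list_chain xs)) = (\<Sum>i<length xs. (-1) ^ i *\<^sub>R sd_list (omit i xs))"
  by (simp add: ord_boundary_list_chain sd_linear sd_list_chain)

lemma sd_list_ordered: "sd_list xs \<in> ordered_chains"
proof (induction xs rule: length_induct)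
  case (1 xs)
  show ?case
  proof (cases "xs = []")
    case False
    then show ?thesis
      by (subst sd_list.simps) (auto intro!: cone_ordered span_sum span_scale span_neg 1[rule_format] simp: length_omit)
  qed (simp add: sd_list.simps list_chain_ordered)
qed

lemma sd_ordered: "c \<in> ordered_chains \<Longrightarrow> sd c \<in> ordered_chains"
  unfolding sd_def by (rule chain_extend_ordered) (rule sd_list_ordered)

text \<open>By induction on the faces the subdivided boundary is a cycle, and the boundary of a cone
  over a cycle is that cycle.\<close>

lemma ord_boundary_sd_list: "ord_boundary (sd_list xs) = sd (ord_boundary (list_chain xs))"
proof (induction xs rule: length_induct)
  case (1 xs)
  show ?case
  proof (cases "xs = []")
    case True
    then show ?thesis by (simp add: sd_list.simps ord_boundary_Nil linear_0[OF linear_sd])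
  next
    case False
    let ?s = "sd (ord_boundary (list_chain xs))"
    have s: "?s \<in> ordered_chains" by (intro sd_ordered ord_boundary_ordered list_chain_ordered)
    have "ord_boundary ?s = (\<Sum>i<length xs. (-1) ^ i *\<^sub>R ord_boundary (sd_list (omit i xs)))"
      by (simp add: sd_ord_boundary_list_chain ord_boundary_linear)
    also have "\<dots> = (\<Sum>i<length xs. (-1) ^ i *\<^sub>R sd (ord_boundary (list_chain (omit i xs))))"
      using 1 by (intro sum.cong) (auto simp: length_omit)
    also have "\<dots> = sd (ord_boundary (ord_boundary (list_chain xs)))"
      by (subst (2) ord_boundary_list_chain)
        (simp add: sd_linear ord_boundary_linear)
    also have "\<dots> = 0" by (simp add: ord_boundary_ord_boundary list_chain_ordered linear_0[OF linear_sd])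
    finally have 0: "ord_boundary ?s = 0" .
    have "sd_list xs = cone (barycentre xs) ?s"
      using False by (subst sd_list.simps) (simp add: sd_ord_boundary_list_chain)
    then show ?thesis using ord_boundary_cone[OF s] 0 by (simp add: linear_0[OF linear_cone])
  qed
qed

lemma ord_boundary_sd:
  assumes "c \<in> ordered_chains"
  shows "ord_boundary (sd c) = sd (ord_boundary c)"
  by (rule ordered_chain_eqI[of "\<lambda>c. ord_boundary (sd c)" "\<lambda>c. sd (ord_boundary c)"])
    (simp_all add: assms linear_compose[unfolded o_def] linear_sd linear_ord_boundary
      sd_list_chain ord_boundary_sd_list)

section \<open>The mesh of iterated barycentric subdivisions\<close>

definition small_lists :: "nat \<Rightarrow> 'a::metric_space set \<Rightarrow> real \<Rightarrow> 'a list set" where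
  "small_lists n C D = {xs. length xs = n \<and> set xs \<subseteq> C \<and> (\<forall>p\<in>set xs. \<forall>q\<in>set xs. dist p q \<le> D)}"

text \<open>Seen from a vertex, the barycentre is the mean of \<open>n\<close> differences of which
  one is 0, whence the factor \<open>(n - 1) / n\<close>. The bound passes to the hull because balls
  are convex.\<close>

lemma dist_barycentre:
  fixes xs :: "'a::real_normed_vector list"
  assumes D: "\<And>p q. p \<in> set xs \<Longrightarrow> q \<in> set xs \<Longrightarrow> dist p q \<le> D" and n: "xs \<noteq> []"
    and p: "p \<in> convex hull (set xs)"
  shows "dist (barycentre xs) p \<le> (real (length xs) - 1) / real (length xs) * D"
proof -
  let ?n = "length xs" let ?r = "(real ?n - 1) / real ?n * D"
  have n0: "0 < ?n" using n by simp
  have "set xs \<subseteq> cball (barycentre xs) ?r"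
  proof
    fix x assume "x \<in> set xs"
    then obtain j where j: "j < ?n" "x = xs ! j" by (auto simp: in_set_conv_nth)
    have "barycentre xs - x = (1 / real ?n) *\<^sub>R (\<Sum>i<?n. xs ! i - x)"
      using n0 by (simp add: barycentre_def sum_subtractf scaleR_right_diff_distrib)
        (simp add: scaleR_scaleR[symmetric] sum_constant_scaleR)
    also have "(\<Sum>i<?n. xs ! i - x) = (\<Sum>i\<in>{..<?n} - {j}. xs ! i - x)"
      using j by (simp add: sum.remove[of "{..<?n}" j])
    finally have "norm (barycentre xs - x) = (1 / real ?n) * norm (\<Sum>i\<in>{..<?n} - {j}. xs ! i - x)"
      by simp
    also have "norm (\<Sum>i\<in>{..<?n} - {j}. xs ! i - x) \<le> of_nat (card ({..<?n} - {j})) * D"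
      by (rule sum_norm_bound) (use D j in \<open>auto simp: dist_norm[symmetric]\<close>)
    also have "of_nat (card ({..<?n} - {j})) = real ?n - 1"
      using j n0 by (simp add: of_nat_diff)
    finally show "x \<in> cball (barycentre xs) ?r"
      using n0 by (simp add: dist_norm divide_right_mono)
  qed
  then have "convex hull (set xs) \<subseteq> cball (barycentre xs) ?r"
    by (rule hull_minimal) simp
  then show ?thesis using p by auto
qed

lemma barycentre_in_convex_hull:
  assumes "xs \<noteq> []"
  shows "barycentre xs \<in> convex hull (set xs)"
proof -
  have "(\<Sum>i<length xs. (1 / real (length xs)) *\<^sub>R xs ! i) \<in> convex hull (set xs)"
    by (rule convex_sum) (use assms in \<open>auto simp: hull_inc\<close>)
  then show ?thesis by (simp add: barycentre_def scaleR_sum_right)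
qed

text \<open>\<open>(n - 1) / n\<close> increases with \<open>n\<close>, so the factor of an upper
  bound \<open>m\<close> for the length serves all faces at once and stays the same under
  iteration.\<close>

lemma sd_list_small:
  fixes xs :: "'a::real_normed_vector list"
  assumes "length xs \<le> m" "\<And>p q. p \<in> set xs \<Longrightarrow> q \<in> set xs \<Longrightarrow> dist p q \<le> D"
  shows "sd_list xs \<in> span (list_chain ` small_lists (length xs) (convex hull (set xs)) ((real m - 1) / real m * D))"
  using assms
proof (induction xs rule: length_induct)
  case (1 xs)
  let ?C = "convex hull (set xs)" and ?r = "(real m - 1) / real m * D"
  show ?case
  proof (cases "xs = []")
    case True
    then show ?thesis by (simp add: sd_list.simps small_lists_def span_base)
  next
    case False
    let ?n = "length xs"
    have n0: "0 < ?n" using False by simp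
    \<comment> \<open>A nonempty list forces \<open>0 \<le> D\<close>; for negative \<open>D\<close>
      a larger factor would give a smaller bound.\<close>
    have "dist (hd xs) (hd xs) \<le> D" using False by (intro 1(3)) auto
    then have D0: "0 \<le> D" by simp
    have "(real ?n - 1) / real ?n \<le> (real m - 1) / real m"
      using n0 1(2) less_le_trans[OF n0 1(2)] by (simp add: field_simps)
    then have rr: "(real ?n - 1) / real ?n * D \<le> ?r" using D0 by (rule mult_right_mono)
    have r0: "0 \<le> ?r" using D0 less_le_trans[OF n0 1(2)] by simp
    have b: "dist (barycentre xs) p \<le> ?r" if "p \<in> ?C" for p
      using dist_barycentre[OF 1(3) False that] rr by linarith
    have bC: "barycentre xs \<in> ?C" by (rule barycentre_in_convex_hull[OF False])
    have "(\<Sum>i<?n. (-1) ^ i *\<^sub>R sd_list (omit i xs)) \<in> span (list_chain ` small_lists (?n - 1) ?C ?r)"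
    proof (intro span_sum span_scale)
      fix i assume "i \<in> {..<?n}"
      then have i: "i < ?n" by simp
      have "sd_list (omit i xs) \<in> span (list_chain ` small_lists (length (omit i xs)) (convex hull (set (omit i xs))) ?r)"
      proof (rule 1(1)[rule_format])
        show "length (omit i xs) < length xs" "length (omit i xs) \<le> m"
          using i 1(2) by (simp_all add: length_omit)
        show "dist p q \<le> D" if "p \<in> set (omit i xs)" "q \<in> set (omit i xs)" for p q
          using that set_omit_subset[of i xs] by (intro 1(3)) auto
      qed
      also have "\<dots> \<subseteq> span (list_chain ` small_lists (?n - 1) ?C ?r)"
        using i hull_mono[OF set_omit_subset[of i xs], of convex]
        by (intro span_mono image_mono) (auto simp: small_lists_def length_omit)
      finally show "sd_list (omit i xs) \<in> span (list_chain ` small_lists (?n - 1) ?C ?r)" .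
    qed
    then have "cone (barycentre xs) (\<Sum>i<?n. (-1) ^ i *\<^sub>R sd_list (omit i xs)) \<in> span (list_chain ` small_lists ?n ?C ?r)"
    proof (rule linear_image_span_subset[OF linear_cone, rotated])
      fix e assume "e \<in> list_chain ` small_lists (?n - 1) ?C ?r"
      then obtain ys where ys: "e = list_chain ys" "ys \<in> small_lists (?n - 1) ?C ?r" by blast
      have "barycentre xs # ys \<in> small_lists ?n ?C ?r"
        using ys(2) n0 b bC r0 by (auto simp: small_lists_def dist_commute)
      then show "cone (barycentre xs) e \<in> span (list_chain ` small_lists ?n ?C ?r)"
        unfolding ys(1) cone_list_chain by (intro span_base imageI)
    qed
    then show ?thesis using False by (subst sd_list.simps) simp
  qed
qed

lemma sd_small:
  fixes C :: "'a::real_normed_vector set"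
  assumes "convex C" "n \<le> m" "c \<in> span (list_chain ` small_lists n C D)"
  shows "sd c \<in> span (list_chain ` small_lists n C ((real m - 1) / real m * D))"
proof (rule linear_image_span_subset[OF linear_sd _ assms(3)])
  fix e assume "e \<in> list_chain ` small_lists n C D"
  then obtain xs where xs: "e = list_chain xs" "length xs = n" "set xs \<subseteq> C"
    "\<And>p q. p \<in> set xs \<Longrightarrow> q \<in> set xs \<Longrightarrow> dist p q \<le> D" by (auto simp: small_lists_def)
  have "convex hull (set xs) \<subseteq> C" using xs(3) assms(1) by (rule hull_minimal)
  then have "small_lists n (convex hull (set xs)) d \<subseteq> small_lists n C d" for d
    by (auto simp: small_lists_def)
  then show "sd e \<in> span (list_chain ` small_lists n C ((real m - 1) / real m * D))"
    using sd_list_small[of xs m D] xs assms(2) unfolding xs(1) sd_list_chain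
    by (meson image_mono span_mono subsetD)
qed

lemma sd_iterate_small:
  fixes C :: "'a::real_normed_vector set"
  assumes "convex C" "n \<le> m" "c \<in> span (list_chain ` small_lists n C D)"
  shows "(sd ^^ j) c \<in> span (list_chain ` small_lists n C (((real m - 1) / real m) ^ j * D))"
proof (induction j)
  case (Suc j)
  show ?case using sd_small[OF assms(1,2) Suc] by (simp add: mult.assoc)
qed (simp add: assms(3))

lemma linear_sd_iterate: "linear (sd ^^ j)"
  by (induction j) (auto simp: linear_id[unfolded id_def] o_def intro: linear_compose[OF _ linear_sd, unfolded o_def])

lemma sd_iterate_ordered: "c \<in> ordered_chains \<Longrightarrow> (sd ^^ j) c \<in> ordered_chains"
  by (induction j) (auto intro: sd_ordered)

lemma ord_boundary_sd_iterate:
  "c \<in> ordered_chains \<Longrightarrow> ord_boundary ((sd ^^ j) c) = (sd ^^ j) (ord_boundary c)"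
  by (induction j) (auto simp: ord_boundary_sd sd_iterate_ordered)

section \<open>The prism operator\<close>

text \<open>In closed form the alternating sum of the lists
  \<open>x0, ..., xi, f xi, ..., f xn\<close>. The recursion by cones lets the cone formula compute
  its boundary. There is no product with an interval: the pieces are spanned by the points and their
  images.\<close>

primrec prism_list :: "('a \<Rightarrow> 'a) \<Rightarrow> 'a list \<Rightarrow> 'a list \<Rightarrow> real" where
  "prism_list f [] = 0"
| "prism_list f (x # xs) = cone x (list_chain (f x # map f xs)) - cone x (prism_list f xs)"

definition prism :: "('a \<Rightarrow> 'a) \<Rightarrow> ('a list \<Rightarrow> real) \<Rightarrow> 'a list \<Rightarrow> real" where
  "prism f = chain_extend (prism_list f)"

lemmas linear_prism = linear_chain_extend[of "prism_list f" for f, folded prism_def]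

lemma prism_list_chain: "prism f (list_chain xs) = prism_list f xs"
  unfolding prism_def by (rule chain_extend_list_chain)

lemma prism_list_mem:
  "prism_list f xs \<in> span (list_chain ` {ys. length ys = Suc (length xs) \<and> set ys \<subseteq> set xs \<union> f ` set xs})"
proof (induction xs)
  case (Cons x xs)
  let ?T = "list_chain ` {ys. length ys = Suc (length (x # xs)) \<and> set ys \<subseteq> set (x # xs) \<union> f ` set (x # xs)}"
  have "cone x (prism_list f xs) \<in> span ?T"
  proof (rule linear_image_span_subset[OF linear_cone _ Cons])
    fix e assume "e \<in> list_chain ` {ys. length ys = Suc (length xs) \<and> set ys \<subseteq> set xs \<union> f ` set xs}"
    then show "cone x e \<in> span ?T" by (fastforce simp: cone_list_chain intro!: span_base imageI)
  qed
  moreover have "cone x (list_chain (f x # map f xs)) \<in> span ?T"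
    unfolding cone_list_chain by (intro span_base imageI) auto
  ultimately show ?case by (simp add: span_diff)
qed (simp add: span_zero)

lemma prism_list_ordered: "prism_list f xs \<in> ordered_chains"
  using prism_list_mem[of f xs] span_mono[of _ "range list_chain"] by blast

lemma prism_ordered: "c \<in> ordered_chains \<Longrightarrow> prism f c \<in> ordered_chains"
  unfolding prism_def by (rule chain_extend_ordered) (rule prism_list_ordered)

lemma prism_cone:
  assumes "c \<in> ordered_chains"
  shows "prism f (cone x c) = cone x (push f (cone x c)) - cone x (prism f c)"
  by (rule ordered_chain_eqI[of "\<lambda>c. prism f (cone x c)"
        "\<lambda>c. cone x (push f (cone x c)) - cone x (prism f c)"])
    (simp_all add: assms linear_compose[OF linear_cone linear_prism, unfolded o_def]
      linear_compose[OF linear_prism linear_cone, unfolded o_def]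
      linear_compose[OF linear_compose[OF linear_cone linear_push] linear_cone, unfolded o_def]
      linear_compose_sub cone_list_chain prism_list_chain push_list_chain)

text \<open>The prism is a homotopy from the identity to \<open>push f\<close>. Both sides for
  \<open>x # xs\<close> are expanded by the cone formula, and the induction hypothesis replaces the
  boundary of the shorter prism.\<close>

lemma ord_boundary_prism_list_chain:
  "ord_boundary (prism f (list_chain xs)) =
     push f (list_chain xs) - list_chain xs - prism f (ord_boundary (list_chain xs))"
proof (induction xs)
  case (Cons x xs)
  let ?e = "list_chain xs"
  have o: "?e \<in> ordered_chains" "ord_boundary ?e \<in> ordered_chains" "cone x ?e \<in> ordered_chains"
    "push f (cone x ?e) \<in> ordered_chains" "prism f ?e \<in> ordered_chains"
    by (intro list_chain_ordered ord_boundary_ordered cone_ordered push_ordered prism_ordered)+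
  have p: "push f (ord_boundary (cone x ?e)) = push f ?e - push f (cone x (ord_boundary ?e))"
    by (simp add: ord_boundary_cone[OF o(1)] linear_diff[OF linear_push])
  have "ord_boundary (prism f (cone x ?e)) = push f (cone x ?e) - cone x (push f ?e)
      + cone x (push f (cone x (ord_boundary ?e))) - prism f ?e + cone x (ord_boundary (prism f ?e))"
    unfolding prism_cone[OF o(1)] linear_diff[OF linear_ord_boundary] ord_boundary_cone[OF o(4)]
      ord_boundary_cone[OF o(5)] ord_boundary_push[OF o(3)] p linear_diff[OF linear_cone]
    by (simp add: algebra_simps)
  also have "\<dots> = push f (cone x ?e) - cone x ?e - prism f (ord_boundary (cone x ?e))"
    unfolding Cons ord_boundary_cone[OF o(1)] linear_diff[OF linear_prism] prism_cone[OF o(2)]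
      linear_diff[OF linear_cone]
    by (simp add: algebra_simps)
  finally show ?case by (simp add: cone_list_chain)
qed (simp add: prism_list_chain ord_boundary_Nil linear_0[OF linear_ord_boundary] push_list_chain
    linear_0[OF linear_prism])

lemma ord_boundary_prism:
  assumes "c \<in> ordered_chains"
  shows "ord_boundary (prism f c) = push f c - c - prism f (ord_boundary c)"
  by (rule ordered_chain_eqI[of "\<lambda>c. ord_boundary (prism f c)"
        "\<lambda>c. push f c - c - prism f (ord_boundary c)"])
    (simp_all add: assms linear_compose[unfolded o_def] linear_compose_sub linear_prism linear_push
      linear_ord_boundary linear_id[unfolded id_def] ord_boundary_prism_list_chain)

section \<open>Simplicial chains\<close>

definition vertices :: "'a set set \<Rightarrow> 'a set" where
  "vertices K = {v. {v} \<in> K}"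

lemma simplicial_complex_finite: "simplicial_complex K \<Longrightarrow> finite K"
  by (simp add: simplicial_complex_def)

lemma simplicial_complex_face: "simplicial_complex K \<Longrightarrow> S \<in> K \<Longrightarrow> F face_of S \<Longrightarrow> F \<in> K"
  unfolding simplicial_complex_def by blast

lemma simplicial_complex_Int:
  "simplicial_complex K \<Longrightarrow> S \<in> K \<Longrightarrow> T \<in> K \<Longrightarrow> S \<inter> T face_of S"
  unfolding simplicial_complex_def by blast

lemma simplicial_complex_simplex:
  assumes "simplicial_complex K" "S \<in> K"
  obtains C where "\<not> affine_dependent C" "S = convex hull C" "finite C"
proof -
  obtain n where "n simplex S" using assms unfolding simplicial_complex_def by blast
  then show ?thesis using that aff_independent_finite unfolding simplex_def by blast
qed

lemma simplicial_complex_subface: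
  assumes "simplicial_complex K" "\<not> affine_dependent S" "convex hull S \<in> K" "T \<subseteq> S"
  shows "convex hull T \<in> K"
  using simplicial_complex_face[OF assms(1,3)] face_of_convex_hull_affine_independent[OF assms(2)] assms(4)
  by blast

lemma finite_vertices: "simplicial_complex K \<Longrightarrow> finite (vertices K)"
proof -
  assume "simplicial_complex K"
  then have "finite ((\<lambda>v. {v}) ` vertices K)"
    by (rule finite_subset[OF _ simplicial_complex_finite, rotated]) (auto simp: vertices_def)
  then show ?thesis by (rule finite_imageD) (auto simp: inj_on_def)
qed

lemma simplex_subset_vertices:
  assumes "simplicial_complex K" "\<not> affine_dependent S" "convex hull S \<in> K"
  shows "S \<subseteq> vertices K"
  using simplicial_complex_subface[OF assms, of "{v}" for v] by (auto simp: vertices_def)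

text \<open>Two simplices of a complex meet in a common face, so \<open>{v}\<close> is a face of the
  hull, and faces of a simplex are hulls of subsets of its vertices.\<close>

lemma vertex_in_simplex:
  assumes K: "simplicial_complex K" and S: "\<not> affine_dependent S" "convex hull S \<in> K"
    and v: "v \<in> vertices K" "v \<in> convex hull S"
  shows "v \<in> S"
proof -
  have "convex hull S \<inter> {v} face_of convex hull S"
    using simplicial_complex_Int[OF K S(2)] v(1) by (simp add: vertices_def)
  then have "{v} face_of convex hull S" using v(2) by (simp add: Int_absorb1)
  then obtain c where c: "c \<subseteq> S" "{v} = convex hull c"
    using face_of_convex_hull_affine_independent[OF S(1)] by blast
  moreover have "c \<noteq> {}" using c(2) by auto
  ultimately show ?thesis using hull_subset[of c convex] by auto
qed

section \<open>Ordered simplices and the spaces of chains\<close>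

lemma ordered_simplices_iff:
  "xs \<in> ordered_simplices K k \<longleftrightarrow>
     length xs = k + 1 \<and> distinct xs \<and> \<not> affine_dependent (set xs) \<and> convex hull (set xs) \<in> K"
  by (simp add: ordered_simplices_def)

lemma length_ordered_simplices: "xs \<in> ordered_simplices K k \<Longrightarrow> length xs = Suc k"
  by (simp add: ordered_simplices_iff)

lemma distinct_ordered_simplices: "xs \<in> ordered_simplices K k \<Longrightarrow> distinct xs"
  by (simp add: ordered_simplices_iff)

lemma ordered_simplices_sublist:
  assumes "simplicial_complex K" "xs \<in> ordered_simplices K k" "distinct ys" "set ys \<subseteq> set xs"
    "length ys = Suc j"
  shows "ys \<in> ordered_simplices K j"
  using assms simplicial_complex_subface[OF assms(1)] affine_dependent_subset[of "set ys" "set xs"]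
  unfolding ordered_simplices_iff by auto

lemma ordered_simplices_permute:
  "p permutes {..<length xs} \<Longrightarrow> permute_list p xs \<in> ordered_simplices K k \<longleftrightarrow> xs \<in> ordered_simplices K k"
  by (simp add: ordered_simplices_iff)

lemma ordered_simplices_vertices:
  "simplicial_complex K \<Longrightarrow> xs \<in> ordered_simplices K k \<Longrightarrow> set xs \<subseteq> vertices K"
  by (rule simplex_subset_vertices) (auto simp: ordered_simplices_iff)

lemma finite_ordered_simplices:
  assumes "simplicial_complex K"
  shows "finite (ordered_simplices K k)"
proof (rule finite_subset)
  show "ordered_simplices K k \<subseteq> {xs. set xs \<subseteq> vertices K \<and> length xs = k + 1}"
    using ordered_simplices_vertices[OF assms] length_ordered_simplices by fastforce
qed (rule finite_lists_length_eq[OF finite_vertices[OF assms]])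

text \<open>Reordering does not leave the ordered simplices, so alternation can be demanded at all
  lists and separated from the condition on the support.\<close>

lemma simplicial_chains_iff:
  "c \<in> simplicial_chains K k \<longleftrightarrow> alternating c \<and> (\<forall>xs. c xs \<noteq> 0 \<longrightarrow> xs \<in> ordered_simplices K k)"
proof
  assume c: "c \<in> simplicial_chains K k"
  have "c (permute_list p xs) = of_int (sign p) * c xs" if "p permutes {..<length xs}" for xs p
    using c that ordered_simplices_permute[OF that, of K k]
    unfolding simplicial_chains_def by (cases "xs \<in> ordered_simplices K k") auto
  then show "alternating c \<and> (\<forall>xs. c xs \<noteq> 0 \<longrightarrow> xs \<in> ordered_simplices K k)"
    using c by (auto simp: alternating_def simplicial_chains_def)
qed (auto simp: alternating_def simplicial_chains_def)

lemma simplicial_chainsD: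
  assumes "c \<in> simplicial_chains K k"
  shows "alternating c" "c xs \<noteq> 0 \<Longrightarrow> xs \<in> ordered_simplices K k"
  using assms by (auto simp: simplicial_chains_iff)

lemma subspace_simplicial_chains: "subspace (simplicial_chains K k)"
proof (rule subspaceI)
  show "0 \<in> simplicial_chains K k"
    by (simp add: simplicial_chains_iff alternating_0 zero_fun_apply)
  fix c assume c: "c \<in> simplicial_chains K k"
  show "r *\<^sub>R c \<in> simplicial_chains K k" for r
    using c by (simp add: simplicial_chains_iff alternating_scale scaleR_fun_apply)
  fix d assume d: "d \<in> simplicial_chains K k"
  show "c + d \<in> simplicial_chains K k"
    unfolding simplicial_chains_iff
  proof (intro conjI allI impI)
    show "alternating (c + d)" using c d by (simp add: simplicial_chains_iff alternating_add)
    fix xs assume "(c + d) xs \<noteq> 0"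
    then have "c xs \<noteq> 0 \<or> d xs \<noteq> 0" by (auto simp: plus_fun_apply)
    then show "xs \<in> ordered_simplices K k" using c d unfolding simplicial_chains_iff by blast
  qed
qed

lemma oriented_simplex_mem:
  assumes "xs \<in> ordered_simplices K k"
  shows "oriented_simplex xs \<in> simplicial_chains K k"
  unfolding simplicial_chains_iff
proof (intro conjI allI impI alternating_oriented_simplex)
  fix ys assume "oriented_simplex xs ys \<noteq> 0"
  then have "mset ys = mset xs" by (rule oriented_simplex_nonzero)
  then show "ys \<in> ordered_simplices K k"
    using assms mset_eq_setD[of ys xs] mset_eq_length[of ys xs] mset_eq_imp_distinct_iff[of ys xs]
    by (simp add: ordered_simplices_iff)
qed

lemma sum_oriented_simplices:
  assumes "simplicial_complex K" "c \<in> simplicial_chains K k"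
  shows "(\<Sum>xs\<in>ordered_simplices K k. c xs *\<^sub>R oriented_simplex xs) = fact (Suc k) *\<^sub>R c"
  by (rule sum_oriented_simplex[OF simplicial_chainsD(1)[OF assms(2)] finite_ordered_simplices[OF assms(1)]])
    (use simplicial_chainsD(2)[OF assms(2)] in \<open>auto simp: ordered_simplices_iff\<close>)

lemma simplicial_chain_expansion:
  assumes "simplicial_complex K" "c \<in> simplicial_chains K k"
  shows "c = (\<Sum>xs\<in>ordered_simplices K k. (c xs / fact (k + 1)) *\<^sub>R oriented_simplex xs)"
proof -
  have "c = (1 / fact (Suc k)) *\<^sub>R (fact (Suc k) *\<^sub>R c)" by (simp del: fact_Suc)
  also have "\<dots> = (\<Sum>xs\<in>ordered_simplices K k. (c xs / fact (k + 1)) *\<^sub>R oriented_simplex xs)"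
    unfolding sum_oriented_simplices[OF assms, symmetric] by (simp add: scaleR_sum_right)
  finally show ?thesis .
qed

lemma simplicial_chains_span:
  assumes "simplicial_complex K"
  shows "simplicial_chains K k = span (oriented_simplex ` ordered_simplices K k)"
proof
  show "simplicial_chains K k \<subseteq> span (oriented_simplex ` ordered_simplices K k)"
  proof
    fix c assume "c \<in> simplicial_chains K k"
    then show "c \<in> span (oriented_simplex ` ordered_simplices K k)"
      by (subst simplicial_chain_expansion[OF assms], assumption) (intro span_sum span_scale span_base imageI)
  qed
  show "span (oriented_simplex ` ordered_simplices K k) \<subseteq> simplicial_chains K k"
    by (rule span_minimal[OF _ subspace_simplicial_chains]) (auto intro: oriented_simplex_mem)
qed

lemma linear_linear_extension: "linear (linear_extension K k \<phi>)"
  by (rule linearI)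
    (simp_all add: linear_extension_def plus_fun_apply scaleR_fun_apply add_divide_distrib
      scaleR_left_distrib sum.distrib scaleR_sum_right)

text \<open>At each of the \<open>(k + 1)!\<close> orderings the sign of
  \<open>oriented_simplex\<close> cancels that of \<open>\<phi>\<close>, so every ordering
  contributes the same multiple of \<open>\<phi> xs\<close>.\<close>

lemma linear_extension_oriented_simplex:
  assumes K: "simplicial_complex K" and xs: "xs \<in> ordered_simplices K k"
    and \<phi>: "\<And>p. p permutes {..<length xs} \<Longrightarrow> \<phi> (permute_list p xs) = of_int (sign p) *\<^sub>R \<phi> xs"
  shows "linear_extension K k \<phi> (oriented_simplex xs) = \<phi> xs"
proof -
  let ?P = "{p. p permutes {..<length xs}}"
  have dx: "distinct xs" and lx: "length xs = Suc k" using xs by (auto simp: ordered_simplices_iff)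
  have inj: "inj_on (\<lambda>p. permute_list p xs) ?P"
  proof (rule inj_onI, rule ext)
    fix p q i assume p: "p \<in> ?P" and q: "q \<in> ?P" and eq: "permute_list p xs = permute_list q xs"
    show "p i = q i"
    proof (cases "i < length xs")
      case True
      have "xs ! p i = xs ! q i" using eq True p q permute_list_nth by (metis mem_Collect_eq)
      moreover have "p i < length xs" "q i < length xs"
        using True p q permutes_in_image[of p "{..<length xs}" i] permutes_in_image[of q "{..<length xs}" i] by auto
      ultimately show ?thesis using dx by (simp add: nth_eq_iff_index_eq)
    next
      case False
      then show ?thesis using p q by (simp add: permutes_not_in)
    qed
  qed
  have "linear_extension K k \<phi> (oriented_simplex xs) =
      (\<Sum>ys\<in>(\<lambda>p. permute_list p xs) ` ?P. (oriented_simplex xs ys / fact (k + 1)) *\<^sub>R \<phi> ys)"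
    unfolding linear_extension_def
  proof (rule sum.mono_neutral_right[OF finite_ordered_simplices[OF K]])
    show "(\<lambda>p. permute_list p xs) ` ?P \<subseteq> ordered_simplices K k"
      using xs ordered_simplices_permute by blast
    show "\<forall>ys\<in>ordered_simplices K k - (\<lambda>p. permute_list p xs) ` ?P.
        (oriented_simplex xs ys / fact (k + 1)) *\<^sub>R \<phi> ys = 0"
    proof
      fix ys assume ys: "ys \<in> ordered_simplices K k - (\<lambda>p. permute_list p xs) ` ?P"
      have "oriented_simplex xs ys = 0"
      proof (rule ccontr)
        assume "oriented_simplex xs ys \<noteq> 0"
        then have "mset ys = mset xs" by (rule oriented_simplex_nonzero)
        then obtain p where "p permutes {..<length xs}" "permute_list p xs = ys" by (rule mset_eq_permutation)
        then show False using ys by blast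
      qed
      then show "(oriented_simplex xs ys / fact (k + 1)) *\<^sub>R \<phi> ys = 0" by simp
    qed
  qed
  also have "\<dots> = (\<Sum>p\<in>?P. (oriented_simplex xs (permute_list p xs) / fact (k + 1)) *\<^sub>R \<phi> (permute_list p xs))"
    by (simp add: sum.reindex[OF inj])
  also have "\<dots> = (\<Sum>p\<in>?P. (1 / fact (k + 1)) *\<^sub>R \<phi> xs)"
    by (rule sum.cong[OF refl]) (auto simp: oriented_simplex_permute_self[OF dx] \<phi> sign_sq)
  also have "\<dots> = real (card ?P) *\<^sub>R (1 / fact (k + 1)) *\<^sub>R \<phi> xs" by (rule sum_constant_scaleR)
  also have "\<dots> = \<phi> xs" by (simp add: card_permutations lx del: fact_Suc)
  finally show ?thesis .
qed

text \<open>\<open>X\<close> may be larger than the vertex set of \<open>K\<close>: with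
  \<open>X\<close> the vertices of \<open>M\<close>, one operator \<open>alt_boundary X\<close>
  computes the boundaries of both \<open>N\<close> and \<open>M\<close>.\<close>

context
  fixes K :: "'a::euclidean_space set set" and X :: "'a set"
  assumes K: "simplicial_complex K" and X: "finite X" "vertices K \<subseteq> X"
begin

lemma boundary_eq_alt_boundary:
  assumes "k \<noteq> 0" "c \<in> simplicial_chains K k"
  shows "boundary K k c = alt_boundary X c"
proof -
  have "boundary K k c = (\<Sum>xs\<in>ordered_simplices K k. (c xs / fact (k + 1)) *\<^sub>R boundary_simplex xs)"
    using assms(1) by (simp add: boundary_def linear_extension_def)
  also have "\<dots> = (\<Sum>xs\<in>ordered_simplices K k. (c xs / fact (k + 1)) *\<^sub>R alt_boundary X (oriented_simplex xs))"
    by (intro sum.cong refl)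
      (simp add: alt_boundary_oriented_simplex[OF X(1) subset_trans[OF ordered_simplices_vertices[OF K] X(2)]])
  also have "\<dots> = alt_boundary X (\<Sum>xs\<in>ordered_simplices K k. (c xs / fact (k + 1)) *\<^sub>R oriented_simplex xs)"
    by (simp add: alt_boundary_linear)
  also have "\<dots> = alt_boundary X c" using simplicial_chain_expansion[OF K assms(2)] by simp
  finally show ?thesis .
qed

lemma alternating_alt_boundary_chain:
  assumes "c \<in> simplicial_chains K k"
  shows "alternating (alt_boundary X c)"
  by (rule alternating_alt_boundary[OF simplicial_chainsD(1)[OF assms] finite_ordered_simplices[OF K]
        simplicial_chainsD(2)[OF assms] length_ordered_simplices X(1)])
    (use ordered_simplices_vertices[OF K] X(2) in auto)

lemma alt_boundary_mem:
  assumes "c \<in> simplicial_chains K (Suc k)"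
  shows "alt_boundary X c \<in> simplicial_chains K k"
  unfolding simplicial_chains_iff
proof (intro conjI allI impI alternating_alt_boundary_chain[OF assms])
  fix ys assume "alt_boundary X c ys \<noteq> 0"
  then obtain v where "c (v # ys) \<noteq> 0" unfolding alt_boundary_def by (meson sum.neutral)
  then have "v # ys \<in> ordered_simplices K (Suc k)" by (rule simplicial_chainsD(2)[OF assms])
  then show "ys \<in> ordered_simplices K k"
    by (rule ordered_simplices_sublist[OF K]) (use \<open>v # ys \<in> _\<close> in \<open>auto simp: ordered_simplices_iff\<close>)
qed

end

lemma boundary_mem:
  assumes "simplicial_complex K" "c \<in> simplicial_chains K k"
  shows "boundary K k c \<in> simplicial_chains K (k - 1)"
proof (cases k)
  case 0
  then show ?thesis by (simp add: boundary_def subspace_0[OF subspace_simplicial_chains])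
next
  case (Suc j)
  then show ?thesis
    using alt_boundary_mem[OF assms(1) finite_vertices[OF assms(1)] subset_refl, of c j] assms
    by (simp add: boundary_eq_alt_boundary[OF assms(1) finite_vertices[OF assms(1)] subset_refl])
qed

lemma boundary_boundary:
  assumes "simplicial_complex K" "c \<in> simplicial_chains K (Suc k)"
  shows "boundary K k (boundary K (Suc k) c) = 0"
proof (cases "k = 0")
  case False
  note b = boundary_eq_alt_boundary[OF assms(1) finite_vertices[OF assms(1)] subset_refl]
  show ?thesis
    using False assms boundary_mem[OF assms] simplicial_chainsD(1)[OF assms(2)]
    by (simp add: b alt_boundary_alt_boundary)
qed (simp add: boundary_def)

lemma linear_boundary: "linear (boundary K k)"
  unfolding boundary_def by (simp add: linear_linear_extension linear_zero)

section \<open>Barycentric coordinates and orientations\<close>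

definition bcoord :: "'a::real_vector set \<Rightarrow> 'a \<Rightarrow> 'a \<Rightarrow> real" where
  "bcoord S y = (SOME u. (\<forall>v. v \<notin> S \<longrightarrow> u v = 0) \<and> sum u S = 1 \<and> (\<Sum>v\<in>S. u v *\<^sub>R v) = y)"

lemma bcoord_props:
  fixes S :: "'a::euclidean_space set"
  assumes "finite S" "y \<in> affine hull S"
  shows "v \<notin> S \<Longrightarrow> bcoord S y v = 0" "sum (bcoord S y) S = 1" "(\<Sum>v\<in>S. bcoord S y v *\<^sub>R v) = y"
proof -
  obtain u where u: "sum u S = 1" "(\<Sum>v\<in>S. u v *\<^sub>R v) = y"
    using assms(2) unfolding affine_hull_finite[OF assms(1)] by auto
  have "\<exists>u. (\<forall>v. v \<notin> S \<longrightarrow> u v = 0) \<and> sum u S = 1 \<and> (\<Sum>v\<in>S. u v *\<^sub>R v) = y"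
    by (rule exI[of _ "\<lambda>v. if v \<in> S then u v else 0"])
      (use u in \<open>auto simp: if_distrib[of "\<lambda>r. r *\<^sub>R _"] cong: sum.cong if_cong\<close>)
  from someI_ex[OF this, folded bcoord_def]
  show "v \<notin> S \<Longrightarrow> bcoord S y v = 0" "sum (bcoord S y) S = 1" "(\<Sum>v\<in>S. bcoord S y v *\<^sub>R v) = y"
    by auto
qed

lemma bcoord_unique:
  fixes S :: "'a::euclidean_space set"
  assumes "\<not> affine_dependent S" "sum u S = 1" "(\<Sum>v\<in>S. u v *\<^sub>R v) = y" "v \<in> S"
  shows "bcoord S y v = u v"
proof -
  have fin: "finite S" by (rule aff_independent_finite[OF assms(1)])
  have y: "y \<in> affine hull S" unfolding affine_hull_finite[OF fin] using assms by auto
  have "sum (\<lambda>v. bcoord S y v - u v) S = 0" "(\<Sum>v\<in>S. (bcoord S y v - u v) *\<^sub>R v) = 0"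
    using bcoord_props[OF fin y] assms by (simp_all add: sum_subtractf scaleR_left_diff_distrib)
  then have "\<forall>v\<in>S. bcoord S y v - u v = 0"
    using assms(1) unfolding affine_dependent_explicit_finite[OF fin] by blast
  then show ?thesis using assms(4) by simp
qed

lemma bcoord_vertex:
  fixes S :: "'a::euclidean_space set"
  assumes "\<not> affine_dependent S" "v \<in> S" "w \<in> S"
  shows "bcoord S v w = (if w = v then 1 else 0)"
  by (rule bcoord_unique[OF assms(1)])
    (use assms aff_independent_finite[OF assms(1)] in \<open>auto simp: if_distrib[of "\<lambda>r. r *\<^sub>R _"] cong: if_cong\<close>)

lemma bcoord_affine:
  fixes S :: "'a::euclidean_space set"
  assumes S: "\<not> affine_dependent S" and T: "finite T" "\<And>w. w \<in> T \<Longrightarrow> w \<in> affine hull S" "sum a T = 1"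
    and v: "v \<in> S"
  shows "bcoord S (\<Sum>w\<in>T. a w *\<^sub>R w) v = (\<Sum>w\<in>T. a w * bcoord S w v)"
proof (rule bcoord_unique[OF S _ _ v])
  have fin: "finite S" by (rule aff_independent_finite[OF S])
  have "(\<Sum>v\<in>S. \<Sum>w\<in>T. a w * bcoord S w v) = (\<Sum>w\<in>T. a w * (\<Sum>v\<in>S. bcoord S w v))"
    by (subst sum.swap) (simp add: sum_distrib_left)
  also have "\<dots> = (\<Sum>w\<in>T. a w * 1)"
    by (intro sum.cong refl) (simp add: bcoord_props(2)[OF fin T(2)])
  finally show "(\<Sum>v\<in>S. \<Sum>w\<in>T. a w * bcoord S w v) = 1" using T(3) by simp
  have "(\<Sum>v\<in>S. (\<Sum>w\<in>T. a w * bcoord S w v) *\<^sub>R v) = (\<Sum>w\<in>T. a w *\<^sub>R (\<Sum>v\<in>S. bcoord S w v *\<^sub>R v))"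
    by (simp add: scaleR_sum_left scaleR_sum_right) (rule sum.swap)
  also have "\<dots> = (\<Sum>w\<in>T. a w *\<^sub>R w)"
    by (intro sum.cong refl) (simp add: bcoord_props(3)[OF fin T(2)])
  finally show "(\<Sum>v\<in>S. (\<Sum>w\<in>T. a w * bcoord S w v) *\<^sub>R v) = (\<Sum>w\<in>T. a w *\<^sub>R w)" .
qed

lemma bcoord_subset:
  fixes S :: "'a::euclidean_space set"
  assumes S: "\<not> affine_dependent S" and T: "T \<subseteq> S" "y \<in> affine hull T" and v: "v \<in> S"
  shows "bcoord S y v = bcoord T y v"
proof (rule bcoord_unique[OF S _ _ v])
  have fin: "finite S" "finite T"
    using aff_independent_finite[OF S] finite_subset[OF T(1)] by auto
  show "sum (bcoord T y) S = 1"
    using bcoord_props[OF fin(2) T(2)] sum.mono_neutral_right[OF fin(1) T(1), of "bcoord T y"] by auto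
  show "(\<Sum>v\<in>S. bcoord T y v *\<^sub>R v) = y"
    using bcoord_props[OF fin(2) T(2)] sum.mono_neutral_right[OF fin(1) T(1), of "\<lambda>v. bcoord T y v *\<^sub>R v"] by auto
qed

lemma bcoord_nonneg:
  fixes S :: "'a::euclidean_space set"
  assumes S: "\<not> affine_dependent S" and y: "y \<in> convex hull S"
  shows "0 \<le> bcoord S y v"
proof -
  have fin: "finite S" by (rule aff_independent_finite[OF S])
  obtain u where u: "\<forall>x\<in>S. 0 \<le> u x" "sum u S = 1" "(\<Sum>x\<in>S. u x *\<^sub>R x) = y"
    using y unfolding convex_hull_finite[OF fin] by auto
  have "y \<in> affine hull S" using y convex_hull_subset_affine_hull by blast
  then show ?thesis
    using bcoord_unique[OF S u(2,3)] u(1) bcoord_props(1)[OF fin] by (cases "v \<in> S") auto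
qed

lemma convex_hull_bcoordI:
  fixes S :: "'a::euclidean_space set"
  assumes fin: "finite S" and y: "y \<in> affine hull S" and T: "T \<subseteq> S" "\<And>v. v \<in> S - T \<Longrightarrow> bcoord S y v = 0"
    and pos: "\<And>v. v \<in> T \<Longrightarrow> 0 \<le> bcoord S y v"
  shows "y \<in> convex hull T"
proof -
  have finT: "finite T" by (rule finite_subset[OF T(1) fin])
  have "sum (bcoord S y) T = 1"
    using bcoord_props(2)[OF fin y] sum.mono_neutral_right[OF fin T(1), of "bcoord S y"] T(2) by auto
  moreover have "(\<Sum>v\<in>T. bcoord S y v *\<^sub>R v) = y"
    using bcoord_props(3)[OF fin y] sum.mono_neutral_right[OF fin T(1), of "\<lambda>v. bcoord S y v *\<^sub>R v"] T(2) by auto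
  ultimately show ?thesis unfolding convex_hull_finite[OF finT] using pos by auto
qed

definition bcoord_mat :: "'a::euclidean_space list \<Rightarrow> 'a list \<Rightarrow> real mat" where
  "bcoord_mat xs ys = Matrix.mat (length xs) (length xs) (\<lambda>(i, j). bcoord (set xs) (ys ! i) (xs ! j))"

text \<open>The determinant of \<open>compatibly_oriented\<close> as a real number and not only its
  sign: as such it is affine in the first entry of \<open>ys\<close>, and so measures on which side
  of a hyperplane a point lies.\<close>

definition orientation :: "'a::euclidean_space list \<Rightarrow> 'a list \<Rightarrow> real" where
  "orientation xs ys = Determinant.det (bcoord_mat xs ys)"

lemma bcoord_mat_carrier: "bcoord_mat xs ys \<in> carrier_mat (length xs) (length xs)"
  by (simp add: bcoord_mat_def)

lemma sum_nth_distinct: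
  "distinct xs \<Longrightarrow> (\<Sum>j<length xs. f (xs ! j)) = sum f (set xs)"
  by (rule sum.reindex_bij_betw) (rule bij_betw_nth; auto)

text \<open>Affine independence makes barycentric coordinates unique, so the only matrix that can
  witness compatibility is \<open>bcoord_mat xs ys\<close>.\<close>

lemma compatibly_oriented_iff:
  assumes xs: "\<not> affine_dependent (set xs)" "distinct xs"
  shows "compatibly_oriented xs ys \<longleftrightarrow>
     length ys = length xs \<and> set ys \<subseteq> affine hull (set xs) \<and> orientation xs ys > 0"
proof
  let ?n = "length xs"
  assume "compatibly_oriented xs ys"
  then obtain A where len: "length ys = ?n" and A: "A \<in> carrier_mat ?n ?n" "Determinant.det A > 0"
    and row: "\<And>i. i < ?n \<Longrightarrow> (\<Sum>j<?n. A $$ (i, j)) = 1 \<and> ys ! i = (\<Sum>j<?n. A $$ (i, j) *\<^sub>R xs ! j)"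
    unfolding compatibly_oriented_def by blast
  define ind where "ind v = inv_into {..<?n} (nth xs) v" for v
  have ind: "ind (xs ! j) = j" if "j < ?n" for j
    using that xs(2) unfolding ind_def by (intro inv_into_f_f) (auto intro!: inj_on_nth)
  have s1: "sum (\<lambda>v. A $$ (i, ind v)) (set xs) = 1" if "i < ?n" for i
    using row[OF that] by (simp add: sum_nth_distinct[OF xs(2), symmetric] ind)
  have s2: "(\<Sum>v\<in>set xs. A $$ (i, ind v) *\<^sub>R v) = ys ! i" if "i < ?n" for i
    using row[OF that] by (simp add: sum_nth_distinct[OF xs(2), symmetric] ind)
  have "bcoord_mat xs ys = A"
    using A(1) by (intro eq_matI) (auto simp: bcoord_mat_def bcoord_unique[OF xs(1) s1 s2] ind)
  moreover have "ys ! i \<in> affine hull (set xs)" if "i < ?n" for i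
    using s1[OF that] s2[OF that] unfolding affine_hull_finite[OF finite_set] by blast
  ultimately show "length ys = ?n \<and> set ys \<subseteq> affine hull (set xs) \<and> orientation xs ys > 0"
    using A(2) len by (auto simp: orientation_def in_set_conv_nth)
next
  let ?n = "length xs"
  assume *: "length ys = ?n \<and> set ys \<subseteq> affine hull (set xs) \<and> orientation xs ys > 0"
  have "ys ! i \<in> affine hull (set xs)" if "i < ?n" for i using * that by (metis nth_mem subsetD)
  then show "compatibly_oriented xs ys"
    unfolding compatibly_oriented_def using *
    by (intro conjI bexI[OF _ bcoord_mat_carrier[of xs ys]])
      (auto simp: orientation_def bcoord_mat_def sum_nth_distinct[OF xs(2)] bcoord_props
        sum_nth_distinct[OF xs(2), of "\<lambda>v. bcoord (set xs) y v *\<^sub>R v" for y])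
qed

lemma orientation_permute_right:
  assumes "p permutes {..<length ys}" "length ys = length xs"
  shows "orientation xs (permute_list p ys) = of_int (sign p) * orientation xs ys"
proof -
  have pn: "p i < length xs" if "i < length xs" for i
    using permutes_in_image[OF assms(1)] that assms(2) by auto
  have "bcoord_mat xs (permute_list p ys) =
      Matrix.mat (length xs) (length xs) (\<lambda>(i, j). bcoord_mat xs ys $$ (p i, j))"
    by (rule eq_matI) (auto simp: bcoord_mat_def permute_list_nth[OF assms(1)] assms(2) pn)
  then show ?thesis
    using det_permute_rows[OF bcoord_mat_carrier, of p xs ys] assms
    by (simp add: orientation_def atLeast0LessThan)
qed

lemma orientation_permute_left:
  assumes p: "p permutes {..<length xs}"
  shows "orientation (permute_list p xs) ys = of_int (sign p) * orientation xs ys"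
proof -
  let ?n = "length xs" and ?B = "(bcoord_mat xs ys)\<^sup>T"
  have B: "?B \<in> carrier_mat ?n ?n" by (simp add: bcoord_mat_def)
  have pn: "p i < ?n" if "i < ?n" for i using permutes_in_image[OF p] that by auto
  have "(bcoord_mat (permute_list p xs) ys)\<^sup>T = Matrix.mat ?n ?n (\<lambda>(i, j). ?B $$ (p i, j))"
    by (rule eq_matI) (auto simp: bcoord_mat_def permute_list_nth[OF p] pn p)
  then have "Determinant.det ((bcoord_mat (permute_list p xs) ys)\<^sup>T) = of_int (sign p) * Determinant.det ?B"
    using det_permute_rows[OF B, of p] p by (simp add: atLeast0LessThan)
  then show ?thesis
    by (simp add: orientation_def det_transpose[OF bcoord_mat_carrier])
qed

text \<open>Change of barycentric coordinates is matrix multiplication. The order of the factors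
  comes from the coordinates being rows.\<close>

lemma orientation_trans:
  assumes xs: "\<not> affine_dependent (set xs)" "distinct xs" and ys: "\<not> affine_dependent (set ys)" "distinct ys"
    and len: "length ys = length xs" "length zs = length xs"
    and sub: "set ys \<subseteq> affine hull (set xs)" "set zs \<subseteq> affine hull (set ys)"
  shows "orientation xs zs = orientation ys zs * orientation xs ys"
proof -
  let ?n = "length xs"
  have "bcoord_mat xs zs = bcoord_mat ys zs * bcoord_mat xs ys"
  proof (rule eq_matI)
    fix i j assume "i < dim_row (bcoord_mat ys zs * bcoord_mat xs ys)" "j < dim_col (bcoord_mat ys zs * bcoord_mat xs ys)"
    then have ij: "i < ?n" "j < ?n" by (auto simp: bcoord_mat_def len)
    have z: "zs ! i \<in> affine hull (set ys)" using sub(2) ij len by auto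
    have "(bcoord_mat ys zs * bcoord_mat xs ys) $$ (i, j) =
        (\<Sum>l<?n. bcoord (set ys) (zs ! i) (ys ! l) * bcoord (set xs) (ys ! l) (xs ! j))"
      using ij by (simp add: bcoord_mat_def len scalar_prod_def atLeast0LessThan)
    also have "\<dots> = (\<Sum>w\<in>set ys. bcoord (set ys) (zs ! i) w * bcoord (set xs) w (xs ! j))"
      using sum_nth_distinct[OF ys(2), of "\<lambda>w. bcoord (set ys) (zs ! i) w * bcoord (set xs) w (xs ! j)"] len by simp
    also have "\<dots> = bcoord (set xs) (\<Sum>w\<in>set ys. bcoord (set ys) (zs ! i) w *\<^sub>R w) (xs ! j)"
      by (rule bcoord_affine[symmetric, OF xs(1)]) (use sub(1) bcoord_props(2)[OF _ z] ij in auto)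
    also have "\<dots> = bcoord_mat xs zs $$ (i, j)"
      using ij by (simp add: bcoord_props(3)[OF finite_set z] bcoord_mat_def)
    finally show "bcoord_mat xs zs $$ (i, j) = (bcoord_mat ys zs * bcoord_mat xs ys) $$ (i, j)" by simp
  qed (auto simp: bcoord_mat_def len)
  then show ?thesis
    unfolding orientation_def
    using Determinant.det_mult[of "bcoord_mat ys zs" ?n "bcoord_mat xs ys"] bcoord_mat_carrier len by metis
qed

lemma orientation_self:
  assumes "\<not> affine_dependent (set xs)" "distinct xs"
  shows "orientation xs xs = 1"
proof -
  have "bcoord_mat xs xs = 1\<^sub>m (length xs)"
    by (rule eq_matI) (auto simp: bcoord_mat_def bcoord_vertex[OF assms(1)] nth_eq_iff_index_eq[OF assms(2)])
  then show ?thesis by (simp add: orientation_def)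
qed

lemma affine_hull_eq_of_length:
  fixes xs ys :: "'a::euclidean_space list"
  assumes xs: "\<not> affine_dependent (set xs)" "distinct xs" and ys: "\<not> affine_dependent (set ys)" "distinct ys"
    and len: "length ys = length xs" and sub: "set ys \<subseteq> affine hull (set xs)"
  shows "affine hull (set ys) = affine hull (set xs)"
proof (cases "xs = []")
  case True
  then show ?thesis using len by simp
next
  case False
  have "aff_dim (set ys) = aff_dim (set xs)"
    using aff_dim_affine_independent[OF xs(1)] aff_dim_affine_independent[OF ys(1)] len
    by (simp add: distinct_card xs ys)
  then show ?thesis
    using False len sub by (intro affine_dim_equal) (auto simp: hull_minimal)
qed

text \<open>Equal length forces equal affine hulls, so coordinates can be changed back and the two
  determinants have product 1.\<close>

lemma orientation_nonzero:
  assumes xs: "\<not> affine_dependent (set xs)" "distinct xs" and ys: "\<not> affine_dependent (set ys)" "distinct ys"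
    and len: "length ys = length xs" and sub: "set ys \<subseteq> affine hull (set xs)"
  shows "orientation xs ys \<noteq> 0"
proof -
  have "set xs \<subseteq> affine hull (set ys)"
    unfolding affine_hull_eq_of_length[OF assms] by (rule hull_subset)
  then have "orientation xs xs = orientation ys xs * orientation xs ys"
    using orientation_trans[OF xs ys len refl sub] by simp
  then show ?thesis using orientation_self[OF xs] by auto
qed

section \<open>The orientation as a function of the first vertex\<close>

definition orientation_minor :: "'a::euclidean_space list \<Rightarrow> nat \<Rightarrow> 'a list \<Rightarrow> real" where
  "orientation_minor xs j ys = Determinant.det (Matrix.mat (length xs - 1) (length xs - 1)
     (\<lambda>(i, l). bcoord (set xs) (ys ! i) (xs ! insert_index j l)))"

text \<open>Laplace expansion along the row of \<open>v\<close>. The minors do not involve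
  \<open>v\<close>, which exhibits the orientation as a combination of the coordinates of
  \<open>v\<close>.\<close>

lemma orientation_Cons:
  assumes "xs \<noteq> []" "length ys = length xs - 1"
  shows "orientation xs (v # ys) =
    (\<Sum>j<length xs. bcoord (set xs) v (xs ! j) * ((-1) ^ j * orientation_minor xs j ys))"
proof -
  let ?n = "length xs" and ?A = "bcoord_mat xs (v # ys)"
  have n: "0 < ?n" using assms by simp
  have "mat_delete ?A 0 j = Matrix.mat (?n - 1) (?n - 1) (\<lambda>(i, l). bcoord (set xs) (ys ! i) (xs ! insert_index j l))"
    if "j < ?n" for j
    using that assms by (intro eq_matI) (auto simp: mat_delete_def bcoord_mat_def insert_index_def)
  moreover have "orientation xs (v # ys) = (\<Sum>j<?n. ?A $$ (0, j) * cofactor ?A 0 j)"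
    unfolding orientation_def by (rule laplace_expansion_row[OF bcoord_mat_carrier n])
  moreover have "?A $$ (0, j) = bcoord (set xs) v (xs ! j)" if "j < ?n" for j
    using that n by (simp add: bcoord_mat_def)
  ultimately show ?thesis
    by (simp add: cofactor_def orientation_minor_def)
qed

lemma orientation_Cons_mem:
  assumes "v \<in> set ys" "length xs = Suc (length ys)"
  shows "orientation xs (v # ys) = 0"
proof -
  obtain i where i: "i < length ys" "ys ! i = v" using assms(1) by (auto simp: in_set_conv_nth)
  have "Matrix.row (bcoord_mat xs (v # ys)) 0 = Matrix.row (bcoord_mat xs (v # ys)) (Suc i)"
    using i assms(2) by (intro eq_vecI) (auto simp: bcoord_mat_def)
  then show ?thesis
    unfolding orientation_def using i assms(2)
    by (intro det_identical_rows[OF bcoord_mat_carrier, of 0 "Suc i"]) auto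
qed

lemma orientation_Cons_vertex:
  assumes "\<not> affine_dependent (set xs)" "distinct xs" "length ys = length xs - 1" "j < length xs"
  shows "orientation xs (xs ! j # ys) = (-1) ^ j * orientation_minor xs j ys"
proof -
  let ?t = "\<lambda>l. (-1) ^ l * orientation_minor xs l ys"
  have "xs \<noteq> []" using assms(4) by auto
  then have "orientation xs (xs ! j # ys) = (\<Sum>l<length xs. bcoord (set xs) (xs ! j) (xs ! l) * ?t l)"
    by (rule orientation_Cons[OF _ assms(3)])
  also have "\<dots> = (\<Sum>l<length xs. if l = j then ?t l else 0)"
    using assms by (intro sum.cong refl) (simp add: bcoord_vertex nth_eq_iff_index_eq)
  also have "\<dots> = ?t j" using assms(4) by (subst sum.delta) simp_all
  finally show ?thesis .
qed

lemma orientation_Cons_affine: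
  assumes xs: "\<not> affine_dependent (set xs)" "xs \<noteq> []" "length ys = length xs - 1"
    and T: "finite T" "\<And>w. w \<in> T \<Longrightarrow> w \<in> affine hull (set xs)" "sum a T = 1"
  shows "orientation xs ((\<Sum>w\<in>T. a w *\<^sub>R w) # ys) = (\<Sum>w\<in>T. a w * orientation xs (w # ys))"
proof -
  have "orientation xs ((\<Sum>w\<in>T. a w *\<^sub>R w) # ys) =
      (\<Sum>j<length xs. \<Sum>w\<in>T. a w * (bcoord (set xs) w (xs ! j) * ((-1) ^ j * orientation_minor xs j ys)))"
    unfolding orientation_Cons[OF xs(2,3)]
    by (intro sum.cong refl, subst bcoord_affine[OF xs(1) T])
      (auto simp: sum_distrib_right mult.assoc)
  also have "\<dots> = (\<Sum>w\<in>T. a w * orientation xs (w # ys))"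
    unfolding orientation_Cons[OF xs(2,3)] by (subst sum.swap) (simp add: sum_distrib_left)
  finally show ?thesis .
qed

text \<open>A point in the affine hull of a facet has the same coordinates with respect to the facet
  and to the whole simplex.\<close>

lemma orientation_minor_omit:
  assumes xs: "\<not> affine_dependent (set xs)" "distinct xs" and j: "j < length xs"
    and len: "length ys = length xs - 1" and sub: "set ys \<subseteq> affine hull (set (omit j xs))"
  shows "orientation_minor xs j ys = orientation (omit j xs) ys"
proof -
  have "Matrix.mat (length xs - 1) (length xs - 1) (\<lambda>(i, l). bcoord (set xs) (ys ! i) (xs ! insert_index j l))
      = bcoord_mat (omit j xs) ys"
  proof (rule eq_matI)
    fix i l assume "i < dim_row (bcoord_mat (omit j xs) ys)" "l < dim_col (bcoord_mat (omit j xs) ys)"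
    then have il: "i < length xs - 1" "l < length xs - 1" by (auto simp: bcoord_mat_def length_omit[OF j])
    have y: "ys ! i \<in> affine hull (set (omit j xs))" using sub il len by auto
    have "xs ! insert_index j l \<in> set xs"
      using nth_mem[of l "omit j xs"] set_omit_subset[of j xs] il
      by (auto simp: nth_omit[OF j] length_omit[OF j])
    then show "Matrix.mat (length xs - 1) (length xs - 1)
        (\<lambda>(i, l). bcoord (set xs) (ys ! i) (xs ! insert_index j l)) $$ (i, l) = bcoord_mat (omit j xs) ys $$ (i, l)"
      using il bcoord_subset[OF xs(1) set_omit_subset y] by (simp add: bcoord_mat_def nth_omit[OF j] length_omit[OF j])
  qed (auto simp: bcoord_mat_def length_omit[OF j])
  then show ?thesis by (simp add: orientation_minor_def orientation_def)
qed

section \<open>The subdivision of a simplex\<close>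

lemma simplex_hull_eq_imp_eq:
  assumes K: "simplicial_complex K" and S: "\<not> affine_dependent S" "convex hull S \<in> K"
    and T: "\<not> affine_dependent T" "convex hull T = convex hull S"
  shows "T = S"
proof -
  have sub: "T \<subseteq> S" if "\<not> affine_dependent S" "convex hull S \<in> K" "\<not> affine_dependent T"
    "convex hull T = convex hull S" for S T
  proof
    fix v assume "v \<in> T"
    then have "v \<in> vertices K" "v \<in> convex hull S"
      using simplex_subset_vertices[OF K that(3)] that(2,4) hull_subset[of T convex] by auto
    then show "v \<in> S" by (rule vertex_in_simplex[OF K that(1,2)])
  qed
  show ?thesis
  proof
    show "T \<subseteq> S" by (rule sub[OF S T])
    show "S \<subseteq> T" by (rule sub[OF T(1) _ S(1) T(2)[symmetric]]) (simp add: T(2) S(2))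
  qed
qed

text \<open>The coefficients of \<open>subdivide_simplex\<close>, with the sign of the determinant
  in place of a chosen compatible ordering.\<close>

definition subdivided_simplex :: "'a::euclidean_space set set \<Rightarrow> nat \<Rightarrow> 'a list \<Rightarrow> 'a chain" where
  "subdivided_simplex M k xs ys =
     (if ys \<in> ordered_simplices M k \<and> convex hull (set ys) \<subseteq> convex hull (set xs)
      then sgn (orientation xs ys) else 0)"

lemma subset_affine_hull_of_convex_hull:
  "convex hull T \<subseteq> convex hull S \<Longrightarrow> T \<subseteq> affine hull S"
  using hull_subset[of T convex] convex_hull_subset_affine_hull[of S] by blast

lemma sgn_sign: "sgn (of_int (sign p) * r) = of_int (sign p) * sgn (r::real)"
  by (auto simp: sign_def sgn_mult)

text \<open>Any ordering has nonzero orientation, and swapping its first two vertices corrects a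
  negative sign. A single point admits no swap, but there \<open>zs = xs\<close> has orientation
  1.\<close>

lemma compatible_ordering_exists:
  assumes xs: "\<not> affine_dependent (set xs)" "distinct xs" "length xs = Suc k"
    and \<tau>: "\<tau> \<in> M" "int k simplex \<tau>" "\<tau> \<subseteq> convex hull (set xs)"
  shows "\<exists>ys. ys \<in> ordered_simplices M k \<and> convex hull (set ys) = \<tau> \<and> compatibly_oriented xs ys"
proof -
  obtain C where C: "\<not> affine_dependent C" "int (card C) = int k + 1" "\<tau> = convex hull C"
    using \<tau>(2) unfolding simplex_def by blast
  obtain zs where zs: "distinct zs" "set zs = C"
    using finite_distinct_list[OF aff_independent_finite[OF C(1)]] by blast
  have len: "length zs = Suc k" using C(2) zs distinct_card[OF zs(1)] by simp
  have sub: "set zs \<subseteq> affine hull (set xs)"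
    using subset_affine_hull_of_convex_hull[of C "set xs"] \<tau>(3) C(3) zs(2) by simp
  have zo: "zs \<in> ordered_simplices M k"
    using zs C \<tau>(1) len by (simp add: ordered_simplices_iff)
  have nz: "orientation xs zs \<noteq> 0"
    by (rule orientation_nonzero[OF xs(1,2)]) (use C zs len xs sub in auto)
  show ?thesis
  proof (cases "orientation xs zs > 0")
    case True
    then show ?thesis
      using zo sub len xs(3) C(3) zs(2) by (auto simp: compatibly_oriented_iff[OF xs(1,2)])
  next
    case False
    show ?thesis
    proof (cases k)
      case 0
      obtain x where x: "xs = [x]" using xs(3) 0 by (auto simp: length_Suc_conv)
      obtain z where z: "zs = [z]" using len 0 by (auto simp: length_Suc_conv)
      have "zs = xs" using sub x z by simp
      then show ?thesis using False orientation_self[OF xs(1,2)] by simp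
    next
      case (Suc j)
      let ?p = "Transposition.transpose 0 (Suc 0)"
      have p: "?p permutes {..<length zs}" by (rule permutes_swap_id) (auto simp: len Suc)
      have "orientation xs (permute_list ?p zs) = - orientation xs zs"
        using orientation_permute_right[OF p, of xs] len xs(3) by (simp add: sign_swap_id)
      then show ?thesis
        using False nz zo sub len xs(3) C(3) zs(2) p ordered_simplices_permute[OF p, of M k]
        by (intro exI[of _ "permute_list ?p zs"]) (auto simp: compatibly_oriented_iff[OF xs(1,2)])
    qed
  qed
qed

lemma subdivide_simplex_eq:
  assumes M: "simplicial_complex M" and xs: "\<not> affine_dependent (set xs)" "distinct xs" "length xs = Suc k"
  shows "subdivide_simplex M k xs = subdivided_simplex M k xs"
proof
  fix ys
  let ?T = "{\<tau>. \<tau> \<in> M \<and> int k simplex \<tau> \<and> \<tau> \<subseteq> convex hull (set xs)}"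
  define r where "r \<tau> = (SOME ys. ys \<in> ordered_simplices M k \<and> convex hull (set ys) = \<tau> \<and> compatibly_oriented xs ys)" for \<tau>
  have r: "r \<tau> \<in> ordered_simplices M k" "convex hull (set (r \<tau>)) = \<tau>" "compatibly_oriented xs (r \<tau>)"
    if "\<tau> \<in> ?T" for \<tau>
    using someI_ex[OF compatible_ordering_exists[OF xs, of \<tau> M]] that unfolding r_def by auto
  have finT: "finite ?T" using simplicial_complex_finite[OF M] by simp
  have sum: "subdivide_simplex M k xs ys = (\<Sum>\<tau>\<in>?T. oriented_simplex (r \<tau>) ys)"
    by (simp add: subdivide_simplex_def sum_fun_apply r_def)
  have nz: "ys \<in> ordered_simplices M k \<and> convex hull (set ys) = \<tau>"
    if "\<tau> \<in> ?T" "oriented_simplex (r \<tau>) ys \<noteq> 0" for \<tau>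
  proof -
    have m: "mset ys = mset (r \<tau>)" by (rule oriented_simplex_nonzero(1)[OF that(2)])
    have "set ys = set (r \<tau>)" "length ys = length (r \<tau>)" "distinct ys = distinct (r \<tau>)"
      using mset_eq_setD[OF m] mset_eq_length[OF m] mset_eq_imp_distinct_iff[OF m] by auto
    then show ?thesis using r[OF that(1)] by (simp add: ordered_simplices_iff)
  qed
  show "subdivide_simplex M k xs ys = subdivided_simplex M k xs ys"
  proof (cases "ys \<in> ordered_simplices M k \<and> convex hull (set ys) \<subseteq> convex hull (set xs)")
    case True
    let ?t = "convex hull (set ys)"
    have ys: "\<not> affine_dependent (set ys)" "?t \<in> M" "distinct ys" "length ys = Suc k"
      using True by (auto simp: ordered_simplices_iff)
    have "int k simplex ?t"
      by (rule simplex_convex_hull) (use ys distinct_card[of ys] in auto)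
    then have t: "?t \<in> ?T" using True ys by simp
    note rt = r[OF t]
    \<comment> \<open>A simplex is determined by its vertices, so only the summand of the hull of
      \<open>ys\<close> is nonzero at \<open>ys\<close>.\<close>
    have "subdivide_simplex M k xs ys = (\<Sum>\<tau>\<in>{?t}. oriented_simplex (r \<tau>) ys)"
      unfolding sum by (rule sum.mono_neutral_right[OF finT]) (use t nz in auto)
    then have eq: "subdivide_simplex M k xs ys = oriented_simplex (r ?t) ys" by simp
    have "set ys = set (r ?t)"
      by (rule simplex_hull_eq_imp_eq[OF M]) (use rt ys in \<open>auto simp: ordered_simplices_iff\<close>)
    then obtain p where p: "p permutes {..<length (r ?t)}" "permute_list p (r ?t) = ys"
      using distinct_same_set_permute[of "r ?t" ys] ys(3) distinct_ordered_simplices[OF rt(1)] by metis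
    have pos: "orientation xs (r ?t) > 0" and "length (r ?t) = length xs"
      using rt(3) by (auto simp: compatibly_oriented_iff[OF xs(1,2)])
    then have "orientation xs ys = of_int (sign p) * orientation xs (r ?t)"
      using orientation_permute_right[OF p(1), of xs] p(2) by simp
    then have "sgn (orientation xs ys) = of_int (sign p)" using pos by (simp add: sgn_sign)
    then show ?thesis
      using eq True oriented_simplex_permute_self[OF distinct_ordered_simplices[OF rt(1)] p(1)] p(2)
      by (simp add: subdivided_simplex_def)
  next
    case False
    then have "oriented_simplex (r \<tau>) ys = 0" if "\<tau> \<in> ?T" for \<tau> using nz[OF that] that by blast
    then have "subdivide_simplex M k xs ys = 0" unfolding sum by (rule sum.neutral[OF ballI])
    moreover have "subdivided_simplex M k xs ys = 0"
      unfolding subdivided_simplex_def by (rule if_not_P[OF False])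
    ultimately show ?thesis by simp
  qed
qed

lemma subdivided_simplex_mem:
  assumes "length xs = Suc k"
  shows "subdivided_simplex M k xs \<in> simplicial_chains M k"
  unfolding simplicial_chains_iff
proof (intro conjI allI impI)
  show "alternating (subdivided_simplex M k xs)"
    unfolding alternating_def
  proof (intro allI impI)
    fix ys :: "'a list" and p assume p: "p permutes {..<length ys}"
    show "subdivided_simplex M k xs (permute_list p ys) = of_int (sign p) * subdivided_simplex M k xs ys"
      using p ordered_simplices_permute[OF p, of M k] orientation_permute_right[OF p, of xs] assms
      by (auto simp: subdivided_simplex_def sgn_sign length_ordered_simplices)
  qed
qed (simp add: subdivided_simplex_def split: if_splits)

lemma subdivided_simplex_permute:
  assumes p: "p permutes {..<length xs}"
  shows "subdivided_simplex M k (permute_list p xs) = of_int (sign p) *\<^sub>R subdivided_simplex M k xs"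
  using p orientation_permute_left[OF p]
  by (auto simp: subdivided_simplex_def fun_eq_iff scaleR_fun_apply sgn_sign)

lemma subdivision_map_oriented_simplex:
  assumes N: "simplicial_complex N" and M: "simplicial_complex M" and xs: "xs \<in> ordered_simplices N k"
  shows "subdivision_map N M k (oriented_simplex xs) = subdivided_simplex M k xs"
proof -
  have eq: "subdivide_simplex M k zs = subdivided_simplex M k zs" if "zs \<in> ordered_simplices N k" for zs
    by (rule subdivide_simplex_eq[OF M]) (use that in \<open>auto simp: ordered_simplices_iff\<close>)
  have "subdivision_map N M k (oriented_simplex xs) = subdivide_simplex M k xs"
    unfolding subdivision_map_def
  proof (rule linear_extension_oriented_simplex[OF N xs])
    fix p assume p: "p permutes {..<length xs}"
    show "subdivide_simplex M k (permute_list p xs) = of_int (sign p) *\<^sub>R subdivide_simplex M k xs"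
      using eq[of "permute_list p xs"] ordered_simplices_permute[OF p, of N k] eq[OF xs] xs
      by (simp add: subdivided_simplex_permute[OF p])
  qed
  then show ?thesis using eq[OF xs] by simp
qed

lemma linear_subdivision_map: "linear (subdivision_map N M k)"
  unfolding subdivision_map_def by (rule linear_linear_extension)

lemmas subdivision_map_linear = linear_sum[OF linear_subdivision_map] linear_scale[OF linear_subdivision_map]

lemma subdivision_map_mem:
  assumes "simplicial_complex N" "simplicial_complex M" "c \<in> simplicial_chains N k"
  shows "subdivision_map N M k c \<in> simplicial_chains M k"
proof -
  have "subdivision_map N M k c \<in> span (oriented_simplex ` ordered_simplices M k)"
  proof (rule linear_image_span_subset[OF linear_subdivision_map])
    show "c \<in> span (oriented_simplex ` ordered_simplices N k)"
      using assms(3) by (simp add: simplicial_chains_span[OF assms(1)])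
    fix e assume "e \<in> oriented_simplex ` ordered_simplices N k"
    then show "subdivision_map N M k e \<in> span (oriented_simplex ` ordered_simplices M k)"
      using subdivided_simplex_mem[OF length_ordered_simplices]
      by (auto simp: subdivision_map_oriented_simplex[OF assms(1,2)] simplicial_chains_span[OF assms(2), symmetric])
  qed
  then show ?thesis by (simp add: simplicial_chains_span[OF assms(2)])
qed

section \<open>Subdivision commutes with the boundary\<close>

text \<open>The definition puts a simplex \<open>\<tau>\<close> of \<open>M\<close> into some
  simplex of \<open>N\<close>, not necessarily into \<open>\<sigma>\<close>. But
  \<open>\<sigma>\<close> cuts that simplex in a face, hence cuts \<open>\<tau>\<close> in a face
  containing \<open>q\<close>, and a minimal \<open>\<tau>\<close> containing \<open>q\<close>
  equals this face.\<close>

lemma subdivision_carrier: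
  assumes "subdivision N M" "\<sigma> \<in> N" "q \<in> \<sigma>"
  obtains \<tau> where "\<tau> \<in> M" "q \<in> \<tau>" "\<tau> \<subseteq> \<sigma>"
proof -
  have N: "simplicial_complex N" and M: "simplicial_complex M" and U: "\<Union>M = \<Union>N"
    and sub: "\<forall>\<tau>\<in>M. \<exists>\<sigma>\<in>N. \<tau> \<subseteq> \<sigma>" using assms(1) by (auto simp: subdivision_def)
  let ?A = "{\<tau> \<in> M. q \<in> \<tau>}"
  have "finite ?A" "?A \<noteq> {}" using simplicial_complex_finite[OF M] assms(2,3) U by auto
  then obtain \<tau> where \<tau>: "\<tau> \<in> M" "q \<in> \<tau>" "\<And>\<rho>. \<rho> \<in> M \<Longrightarrow> q \<in> \<rho> \<Longrightarrow> \<rho> \<subseteq> \<tau> \<Longrightarrow> \<tau> = \<rho>"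
    using finite_has_minimal[of ?A] by auto
  obtain \<sigma>' where \<sigma>': "\<sigma>' \<in> N" "\<tau> \<subseteq> \<sigma>'" using sub \<tau>(1) by blast
  have "convex \<tau>" using simplicial_complex_simplex[OF M \<tau>(1)] convex_convex_hull by metis
  then have "(\<sigma>' \<inter> \<sigma>) \<inter> \<tau> face_of \<sigma>' \<inter> \<tau>"
    by (rule face_of_slice[OF simplicial_complex_Int[OF N \<sigma>'(1) assms(2)]])
  moreover have "\<sigma>' \<inter> \<tau> = \<tau>" "(\<sigma>' \<inter> \<sigma>) \<inter> \<tau> = \<sigma> \<inter> \<tau>" using \<sigma>'(2) by auto
  ultimately have "\<sigma> \<inter> \<tau> face_of \<tau>" by simp
  then have "\<sigma> \<inter> \<tau> \<in> M" by (rule simplicial_complex_face[OF M \<tau>(1)])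
  then have "\<tau> = \<sigma> \<inter> \<tau>" using \<tau>(2,3) assms(3) by blast
  then show ?thesis using that \<tau>(1,2) by blast
qed

text \<open>The common face contains a relative interior point of \<open>\<rho>\<close>, hence all
  of \<open>\<rho>\<close>.\<close>

lemma simplicial_complex_rel_interior_subset:
  assumes K: "simplicial_complex K" and "\<rho> \<in> K" "\<tau> \<in> K" "b \<in> rel_interior \<rho>" "b \<in> \<tau>"
  shows "\<rho> \<subseteq> \<tau>"
proof -
  have "\<rho> \<subseteq> \<rho> \<inter> \<tau>"
    by (rule subset_of_face_of[OF simplicial_complex_Int[OF K assms(2,3)] subset_refl])
      (use assms(4,5) rel_interior_subset in auto)
  then show ?thesis by blast
qed

lemma simplicial_complex_closed: "simplicial_complex K \<Longrightarrow> \<tau> \<in> K \<Longrightarrow> closed \<tau>"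
  unfolding simplicial_complex_def using closed_simplex by blast

text \<open>
  The height of \<open>v\<close> is an affine function of \<open>v\<close> that vanishes on the hyperplane of \<open>ys\<close>, so its sign
  tells on which side \<open>v\<close> lies, and it is the orientation of the coface \<open>v # ys\<close>. There is at most one
  coface on each side, and there is one as soon as the simplex \<open>xs\<close> extends to that side. Hence the
  two cofaces of an interior \<open>ys\<close> cancel, and in a facet of \<open>xs\<close> there is just one.
\<close>

locale facet_in_simplex =
  fixes N M :: "'a::euclidean_space set set" and j :: nat and xs ys :: "'a list"
  assumes subdiv: "subdivision N M" and xs_mem: "xs \<in> ordered_simplices N (Suc j)"
    and ys_mem: "ys \<in> ordered_simplices M j" and ys_sub: "convex hull (set ys) \<subseteq> convex hull (set xs)"
begin

definition height :: "'a \<Rightarrow> real" where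
  "height v = orientation xs (v # ys)"

text \<open>A relative interior point of the simplex \<open>ys\<close>. Moving from it towards one
  side, one enters the coface on that side.\<close>

definition centre :: 'a where
  "centre = (\<Sum>y\<in>set ys. (1 / real (Suc j)) *\<^sub>R y)"

lemma N: "simplicial_complex N" and M: "simplicial_complex M"
  using subdiv by (auto simp: subdivision_def)

lemma xs: "\<not> affine_dependent (set xs)" "distinct xs" "length xs = Suc (Suc j)" "xs \<noteq> []"
    "convex hull (set xs) \<in> N"
  and ys: "\<not> affine_dependent (set ys)" "distinct ys" "length ys = Suc j" "convex hull (set ys) \<in> M"
  using xs_mem ys_mem by (auto simp: ordered_simplices_iff)

lemma len: "length ys = length xs - 1"
  using xs ys by simp

lemma ys_affine: "set ys \<subseteq> affine hull (set xs)"
  by (rule subset_affine_hull_of_convex_hull[OF ys_sub])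

lemma height_affine:
  assumes "finite T" "\<And>w. w \<in> T \<Longrightarrow> w \<in> affine hull (set xs)" "sum a T = 1"
  shows "height (\<Sum>w\<in>T. a w *\<^sub>R w) = (\<Sum>w\<in>T. a w * height w)"
  unfolding height_def by (rule orientation_Cons_affine[OF xs(1,4) len assms])

lemma height_ys: "y \<in> set ys \<Longrightarrow> height y = 0"
  unfolding height_def by (rule orientation_Cons_mem) (use xs ys in auto)

lemma height_bcoord:
  assumes "finite T" "T \<subseteq> affine hull (set xs)" "q \<in> affine hull T"
  shows "height q = (\<Sum>w\<in>T. bcoord T q w * height w)"
proof -
  have "height (\<Sum>w\<in>T. bcoord T q w *\<^sub>R w) = (\<Sum>w\<in>T. bcoord T q w * height w)"
    by (rule height_affine) (use assms bcoord_props(2)[OF assms(1,3)] in auto)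
  then show ?thesis by (simp add: bcoord_props(3)[OF assms(1,3)])
qed

lemma height_ys_affine: "q \<in> affine hull (set ys) \<Longrightarrow> height q = 0"
  by (subst height_bcoord[OF finite_set ys_affine]) (auto simp: height_ys)

lemma sum_weights: "(\<Sum>y\<in>set ys. 1 / real (Suc j)) = 1"
  by (simp only: sum_constant distinct_card[OF ys(2)] ys(3)) simp

lemma centre_hull: "centre \<in> convex hull (set ys)"
  unfolding centre_def by (rule convex_sum[OF _ _ sum_weights]) (auto intro: hull_inc)

lemma centre_rel_interior: "centre \<in> rel_interior (convex hull (set ys))"
  unfolding rel_interior_convex_hull_explicit[OF ys(1)]
  by (rule CollectI, rule exI[of _ "\<lambda>_. 1 / real (Suc j)"], intro conjI sum_weights centre_def[symmetric]) simp

lemma centre_affine: "centre \<in> affine hull (set xs)"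
  using centre_hull ys_sub convex_hull_subset_affine_hull by blast

lemma height_centre: "height centre = 0"
  using height_ys_affine centre_hull convex_hull_subset_affine_hull by blast

lemma height_segment:
  assumes q: "q \<in> affine hull (set xs)"
  shows "height ((1 - t) *\<^sub>R centre + t *\<^sub>R q) = t * height q"
proof (cases "q = centre")
  case True
  then show ?thesis using height_centre by (simp add: scaleR_left_distrib[symmetric])
next
  case False
  let ?a = "\<lambda>w. if w = q then t else 1 - t"
  have "height (\<Sum>w\<in>{centre, q}. ?a w *\<^sub>R w) = (\<Sum>w\<in>{centre, q}. ?a w * height w)"
    by (rule height_affine) (use False q centre_affine in auto)
  then show ?thesis using False height_centre by auto
qed

text \<open>A point \<open>p\<close> slightly off the centre towards \<open>q\<close> lies only in
  simplices that contain the centre, and hence all of \<open>ys\<close>. In a simplex of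
  \<open>M\<close> containing \<open>p\<close> some vertex has the sign of the height of
  \<open>p\<close>; together with \<open>ys\<close> it spans the coface. \<open>s\<close> selects
  the side.\<close>

lemma coface_exists:
  assumes q: "q \<in> convex hull (set xs)" and pos: "0 < s * height q"
  shows "\<exists>v. v # ys \<in> ordered_simplices M (Suc j) \<and> convex hull (set (v # ys)) \<subseteq> convex hull (set xs)
    \<and> 0 < s * height v"
proof -
  let ?C = "\<Union>{\<tau> \<in> M. centre \<notin> \<tau>}"
  have "closed ?C"
    using simplicial_complex_finite[OF M] simplicial_complex_closed[OF M] by (intro closed_Union) auto
  then have "open (- ?C)" "centre \<in> - ?C" by auto
  then obtain e where e: "e > 0" "ball centre e \<subseteq> - ?C" by (meson open_contains_ball)
  \<comment> \<open>Keeps \<open>p\<close> on the segment and closer to the centre than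
    \<open>e\<close>; the summand 1 avoids division by 0 when \<open>q\<close> is the
    centre.\<close>
  define t where "t = min 1 (e / (2 * (1 + norm (q - centre))))"
  have n1: "0 < 1 + norm (q - centre)" by (smt (verit) norm_ge_zero)
  have t: "0 < t" "t \<le> 1" using e(1) n1 by (auto simp: t_def)
  define p where "p = (1 - t) *\<^sub>R centre + t *\<^sub>R q"
  have "t * norm (q - centre) < e"
  proof -
    have "t * norm (q - centre) \<le> e / (2 * (1 + norm (q - centre))) * norm (q - centre)"
      by (rule mult_right_mono) (auto simp: t_def)
    also have "\<dots> < e"
    proof -
      have "e * norm (q - centre) < e * (2 * (1 + norm (q - centre)))"
        using e(1) n1 by (intro mult_strict_left_mono) simp_all
      then show ?thesis using n1 by (simp add: field_simps)
    qed
    finally show ?thesis .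
  qed
  moreover have "dist centre p = t * norm (q - centre)"
  proof -
    have "centre - p = - (t *\<^sub>R (q - centre))" by (simp add: p_def algebra_simps)
    then show ?thesis using t by (simp add: dist_norm)
  qed
  ultimately have "p \<in> ball centre e" by simp
  then have pC: "p \<notin> ?C" using e(2) by blast
  have bx: "centre \<in> convex hull (set xs)" using centre_hull ys_sub by blast
  have px: "p \<in> convex hull (set xs)"
    unfolding p_def using t bx q by (intro convexD[OF convex_convex_hull]) auto
  then obtain \<tau> where \<tau>: "\<tau> \<in> M" "p \<in> \<tau>" "\<tau> \<subseteq> convex hull (set xs)"
    by (rule subdivision_carrier[OF subdiv xs(5)])
  have "centre \<in> \<tau>" using pC \<tau>(1,2) by blast
  then have ys\<tau>: "convex hull (set ys) \<subseteq> \<tau>"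
    by (rule simplicial_complex_rel_interior_subset[OF M ys(4) \<tau>(1) centre_rel_interior])
  obtain T where T: "\<not> affine_dependent T" "\<tau> = convex hull T" "finite T"
    by (rule simplicial_complex_simplex[OF M \<tau>(1)])
  have Txs: "T \<subseteq> affine hull (set xs)"
    using subset_affine_hull_of_convex_hull[of T "set xs"] \<tau>(3) T(2) by simp
  have qa: "q \<in> affine hull (set xs)" using q convex_hull_subset_affine_hull by blast
  have pT: "p \<in> convex hull T" using \<tau>(2) T(2) by simp
  have "0 < t * (s * height q)" using t(1) pos by simp
  also have "\<dots> = s * height p" using height_segment[OF qa] by (simp add: p_def)
  also have "\<dots> = (\<Sum>w\<in>T. bcoord T p w * (s * height w))"
    using height_bcoord[OF T(3) Txs, of p] pT convex_hull_subset_affine_hull[of T]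
    by (auto simp: sum_distrib_left mult.left_commute)
  finally obtain v where v: "v \<in> T" "0 < bcoord T p v * (s * height v)"
    by (meson not_le sum_nonpos)
  have vpos: "0 < s * height v"
    using v(2) bcoord_nonneg[OF T(1) pT, of v] by (simp add: zero_less_mult_iff)
  have ysT: "set ys \<subseteq> T"
  proof
    fix y assume y: "y \<in> set ys"
    show "y \<in> T"
    proof (rule vertex_in_simplex[OF M T(1)])
      show "convex hull T \<in> M" using \<tau>(1) T(2) by simp
      show "y \<in> vertices M" using y ordered_simplices_vertices[OF M ys_mem] by blast
      show "y \<in> convex hull T" using y ys\<tau> T(2) hull_subset[of "set ys" convex] by blast
    qed
  qed
  have vys: "v \<notin> set ys" using vpos height_ys[of v] by auto
  have sub: "set (v # ys) \<subseteq> T" using v(1) ysT by simp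
  have "v # ys \<in> ordered_simplices M (Suc j)"
    unfolding ordered_simplices_iff
    using vys ys(2,3) affine_dependent_subset[OF _ sub] T(1)
      simplicial_complex_subface[OF M T(1) _ sub] \<tau>(1) T(2) by auto
  moreover have "convex hull (set (v # ys)) \<subseteq> convex hull (set xs)"
    using hull_mono[OF sub, of convex] \<tau>(3) T(2) by blast
  ultimately show ?thesis using vpos by blast
qed

text \<open>Since \<open>v\<close> and \<open>w\<close> lie on the same side, \<open>w\<close> has a
  positive coordinate at \<open>v\<close>. A point near the centre towards \<open>w\<close> is then
  in the relative interior of the coface of \<open>v\<close> and also in that of \<open>w\<close>,
  so the first is contained in the second and \<open>v\<close> is one of its vertices.\<close>

lemma coface_unique:
  assumes v: "v # ys \<in> ordered_simplices M (Suc j)" "convex hull (set (v # ys)) \<subseteq> convex hull (set xs)"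
    "0 < s * height v"
    and w: "w # ys \<in> ordered_simplices M (Suc j)" "convex hull (set (w # ys)) \<subseteq> convex hull (set xs)"
    "0 < s * height w"
  shows "v = w"
proof -
  let ?Z = "set (v # ys)" and ?k = "real (Suc j)"
  have Z: "\<not> affine_dependent ?Z" "distinct (v # ys)" "length (v # ys) = length xs" "convex hull ?Z \<in> M"
    and W: "\<not> affine_dependent (set (w # ys))" "convex hull (set (w # ys)) \<in> M"
    using v(1) w(1) xs(3) by (auto simp: ordered_simplices_iff)
  have Zx: "?Z \<subseteq> affine hull (set xs)" by (rule subset_affine_hull_of_convex_hull[OF v(2)])
  have "affine hull ?Z = affine hull (set xs)"
    by (rule affine_hull_eq_of_length[OF xs(1,2) Z(1-3) Zx])
  moreover have "w \<in> affine hull (set xs)"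
    using subset_affine_hull_of_convex_hull[OF w(2)] by simp
  ultimately have wZ: "w \<in> affine hull ?Z" by simp
  let ?\<beta> = "bcoord ?Z w"
  have vys: "v \<notin> set ys" using Z(2) by simp
  have "height w = (\<Sum>z\<in>?Z. ?\<beta> z * height z)" by (rule height_bcoord[OF finite_set Zx wZ])
  also have "\<dots> = ?\<beta> v * height v" using vys height_ys by simp
  finally have "0 < ?\<beta> v * (s * height v)" using w(3) by (simp add: mult.left_commute)
  then have \<beta>v: "0 < ?\<beta> v" using v(3) by (simp add: zero_less_mult_iff)
  define B where "B = (\<Sum>y\<in>set ys. \<bar>?\<beta> y\<bar>)"
  have B0: "0 \<le> B" by (simp add: B_def sum_nonneg)
  \<comment> \<open>Small enough for \<open>t * B < (1 - t) / ?k\<close>: the weight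
    \<open>(1 - t) / ?k\<close> from the centre outweighs any negative coordinate of
    \<open>w\<close> in \<open>ys\<close>.\<close>
  define t where "t = 1 / (2 + ?k * B)"
  have kB: "0 \<le> ?k * B" using B0 by (intro mult_nonneg_nonneg) auto
  have t: "0 < t" "t < 1" "t * (1 + ?k * B) < 1" using kB by (auto simp: t_def field_simps)
  \<comment> \<open>The barycentric coordinates of \<open>p\<close> in the coface of
    \<open>v\<close>; all of them turn out to be positive.\<close>
  define u where "u z = (if z = v then 0 else (1 - t) / ?k) + t * ?\<beta> z" for z
  define p where "p = (1 - t) *\<^sub>R centre + t *\<^sub>R w"
  have sumu: "sum u ?Z = 1"
  proof -
    have "sum u ?Z = (\<Sum>z\<in>?Z. (if z = v then 0 else (1 - t) / ?k) + t * ?\<beta> z)"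
      by (rule sum.cong) (simp_all only: u_def)
    then have "sum u ?Z = (\<Sum>z\<in>?Z. if z = v then 0 else (1 - t) / ?k) + t * sum ?\<beta> ?Z"
      by (simp only: sum.distrib sum_distrib_left)
    also have "(\<Sum>z\<in>?Z. if z = v then 0 else (1 - t) / ?k) = (\<Sum>z\<in>set ys. if z = v then 0 else (1 - t) / ?k)"
      using vys by simp
    also have "\<dots> = (\<Sum>z\<in>set ys. (1 - t) * (1 / ?k))"
      by (rule sum.cong) (use vys in auto)
    also have "\<dots> = 1 - t" unfolding sum_distrib_left[symmetric] sum_weights by simp
    finally show ?thesis using bcoord_props(2)[OF finite_set wZ] by simp
  qed
  have sumup: "(\<Sum>z\<in>?Z. u z *\<^sub>R z) = p"
  proof -
    have "(\<Sum>z\<in>?Z. u z *\<^sub>R z) = (\<Sum>z\<in>?Z. (if z = v then 0 else (1 - t) / ?k) *\<^sub>R z) + t *\<^sub>R (\<Sum>z\<in>?Z. ?\<beta> z *\<^sub>R z)"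
      by (simp only: u_def scaleR_left_distrib sum.distrib scaleR_sum_right scaleR_scaleR)
    also have "(\<Sum>z\<in>?Z. (if z = v then 0 else (1 - t) / ?k) *\<^sub>R z) = (\<Sum>z\<in>set ys. (1 - t) *\<^sub>R (1 / ?k) *\<^sub>R z)"
      using vys by (auto intro!: sum.cong)
    finally show ?thesis
      unfolding bcoord_props(3)[OF finite_set wZ] by (simp only: p_def centre_def scaleR_sum_right)
  qed
  have upos: "0 < u z" if "z \<in> ?Z" for z
  proof (cases "z = v")
    case True
    then show ?thesis using \<beta>v t(1) by (simp add: u_def)
  next
    case False
    then have z: "z \<in> set ys" using that by simp
    have "\<bar>?\<beta> z\<bar> \<le> B" unfolding B_def by (rule member_le_sum) (use z in auto)
    then have "t * - ?\<beta> z \<le> t * B" using t(1) by (intro mult_left_mono) auto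
    moreover have "?k * (t * B) < 1 - t" using t(3) by (simp add: algebra_simps)
    then have "t * B < (1 - t) / ?k" by (simp add: field_simps)
    ultimately show ?thesis using False by (simp add: u_def)
  qed
  have pr: "p \<in> rel_interior (convex hull ?Z)"
    unfolding rel_interior_convex_hull_explicit[OF Z(1)] using upos sumu sumup by blast
  have "centre \<in> convex hull (set (w # ys))"
    using centre_hull hull_mono[of "set ys" "set (w # ys)" convex] by auto
  moreover have "w \<in> convex hull (set (w # ys))" by (rule hull_inc) simp
  ultimately have "p \<in> convex hull (set (w # ys))"
    unfolding p_def using t by (intro convexD[OF convex_convex_hull]) auto
  then have "convex hull ?Z \<subseteq> convex hull (set (w # ys))"
    by (rule simplicial_complex_rel_interior_subset[OF M Z(4) W(2) pr])
  moreover have "v \<in> convex hull ?Z" by (rule hull_inc) simp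
  ultimately have "v \<in> convex hull (set (w # ys))" by blast
  moreover have "v \<in> vertices M" using ordered_simplices_vertices[OF M v(1)] by simp
  ultimately have "v \<in> set (w # ys)" by (intro vertex_in_simplex[OF M W])
  then show ?thesis using vys by simp
qed

lemma height_sum: "q \<in> affine hull (set xs) \<Longrightarrow> height q = (\<Sum>x\<in>set xs. bcoord (set xs) q x * height x)"
  by (rule height_bcoord[OF finite_set hull_subset])

lemma signed_vertex_exists:
  assumes q: "q \<in> convex hull (set xs)" and "0 < s * height q"
  shows "\<exists>x\<in>set xs. 0 < s * height x"
proof (rule ccontr)
  assume "\<not> ?thesis"
  then have "\<And>x. x \<in> set xs \<Longrightarrow> s * height x \<le> 0" by (auto simp: not_less)
  then have "(\<Sum>x\<in>set xs. bcoord (set xs) q x * (s * height x)) \<le> 0"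
    using bcoord_nonneg[OF xs(1) q] by (intro sum_nonpos) (simp add: mult_nonneg_nonpos)
  also have "(\<Sum>x\<in>set xs. bcoord (set xs) q x * (s * height x)) = s * height q"
    using height_sum[of q] q convex_hull_subset_affine_hull[of "set xs"]
    by (auto simp: sum_distrib_left mult.left_commute)
  finally show False using assms(2) by simp
qed

lemma vertex_height_nonzero: "\<exists>x\<in>set xs. height x \<noteq> 0"
proof -
  have "\<not> set xs \<subseteq> affine hull (set ys)"
  proof
    assume "set xs \<subseteq> affine hull (set ys)"
    then have "aff_dim (set xs) \<le> aff_dim (set ys)"
      using aff_dim_subset aff_dim_affine_hull by metis
    then show False
      using aff_dim_affine_independent[OF xs(1)] aff_dim_affine_independent[OF ys(1)]
        distinct_card[OF xs(2)] distinct_card[OF ys(2)] xs(3) ys(3) by simp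
  qed
  then obtain x where x: "x \<in> set xs" "x \<notin> affine hull (set ys)" by blast
  have "x \<notin> set ys" using x(2) hull_inc[of x "set ys" affine] by blast
  moreover have "\<not> affine_dependent (set (x # ys))"
    using affine_independent_insert[OF ys(1) x(2)] by simp
  ultimately have "height x \<noteq> 0"
    unfolding height_def
    by (intro orientation_nonzero[OF xs(1,2)])
      (use xs(3) ys(2,3) ys_affine x(1) hull_subset[of "set xs" affine] in auto)
  then show ?thesis using x(1) by blast
qed

text \<open>A coface on one side needs a vertex of \<open>xs\<close> on that side, as heights in the
  hull are convex combinations of vertex heights; conversely such a vertex yields a coface.\<close>

lemma signed_cofaces_card:
  assumes X: "finite X" "vertices M \<subseteq> X"
  shows "card {v \<in> X. v # ys \<in> ordered_simplices M (Suc j) \<and>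
      convex hull (set (v # ys)) \<subseteq> convex hull (set xs) \<and> 0 < s * height v} =
    (if \<exists>x\<in>set xs. 0 < s * height x then 1 else 0)" (is "card ?A = _")
proof (cases "\<exists>x\<in>set xs. 0 < s * height x")
  case True
  then obtain x where "x \<in> set xs" "0 < s * height x" by blast
  then obtain v where v: "v # ys \<in> ordered_simplices M (Suc j)"
    "convex hull (set (v # ys)) \<subseteq> convex hull (set xs)" "0 < s * height v"
    using coface_exists[of x s] hull_inc[of x "set xs" convex] by blast
  moreover have "v \<in> X" using ordered_simplices_vertices[OF M v(1)] X(2) by auto
  ultimately have "?A = {v}" using coface_unique by blast
  then show ?thesis using True by simp
next
  case False
  have "0 < s * height v \<Longrightarrow> v \<in> convex hull (set xs) \<Longrightarrow> False" for v
    using signed_vertex_exists[of v s] False by blast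
  moreover have "v \<in> convex hull (set (v # ys))" for v by (rule hull_inc) simp
  ultimately have empty: "?A = {}" by blast
  show ?thesis unfolding empty if_not_P[OF False] by simp
qed

text \<open>The coefficient of the coface of \<open>v\<close> is the sign of its height, so the
  boundary counts positive cofaces minus negative ones.\<close>

lemma boundary_coefficient:
  assumes X: "finite X" "vertices M \<subseteq> X"
  shows "alt_boundary X (subdivided_simplex M (Suc j) xs) ys =
    (if \<exists>x\<in>set xs. 0 < height x then 1 else 0) - (if \<exists>x\<in>set xs. height x < 0 then 1 else 0)"
proof -
  let ?A = "\<lambda>s. {v \<in> X. v # ys \<in> ordered_simplices M (Suc j) \<and>
      convex hull (set (v # ys)) \<subseteq> convex hull (set xs) \<and> 0 < s * height v}"
  have "alt_boundary X (subdivided_simplex M (Suc j) xs) ys =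
      (\<Sum>v\<in>X. (if v \<in> ?A 1 then 1 else 0) - (if v \<in> ?A (-1) then 1 else 0))"
    unfolding alt_boundary_def subdivided_simplex_def height_def
    by (intro sum.cong refl) (auto simp: sgn_if)
  also have "\<dots> = real (card (?A 1)) - real (card (?A (-1)))"
    using X(1) by (simp add: sum_subtractf sum.If_cases Int_def conj_commute cong: conj_cong)
  finally show ?thesis unfolding signed_cofaces_card[OF X] by simp
qed

lemma omit_facet:
  assumes i: "i < length xs" and sub: "convex hull (set ys) \<subseteq> convex hull (set (omit i xs))"
  shows "height (xs ! i) = (-1) ^ i * orientation (omit i xs) ys"
    "l < length xs \<Longrightarrow> l \<noteq> i \<Longrightarrow> height (xs ! l) = 0"
proof -
  have a: "set ys \<subseteq> affine hull (set (omit i xs))" by (rule subset_affine_hull_of_convex_hull[OF sub])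
  show "height (xs ! i) = (-1) ^ i * orientation (omit i xs) ys"
    unfolding height_def orientation_Cons_vertex[OF xs(1,2) len i]
    by (simp add: orientation_minor_omit[OF xs(1,2) i len a])
  have o: "\<not> affine_dependent (set (omit i xs))" "distinct (omit i xs)"
    using affine_dependent_subset[OF _ set_omit_subset] xs(1,2) by (auto simp: distinct_omit)
  have "affine hull (set ys) = affine hull (set (omit i xs))"
    by (rule affine_hull_eq_of_length[OF o ys(1,2) _ a]) (simp add: length_omit[OF i] len)
  moreover assume "l < length xs" "l \<noteq> i"
  then have "xs ! l \<in> set (omit i xs)"
    using i xs(2) by (simp add: set_omit_distinct nth_eq_iff_index_eq)
  then have "xs ! l \<in> affine hull (set (omit i xs))" by (rule hull_inc)
  ultimately show "height (xs ! l) = 0" by (intro height_ys_affine) simp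
qed

text \<open>If \<open>ys\<close> lies in a facet, only the opposite vertex is off the hyperplane;
  this singles out the facet, and the sign of the vertex height is the signed coefficient there.
  Otherwise the hyperplane has vertices of \<open>xs\<close> on both sides and the two terms
  cancel.\<close>

lemma facet_coefficient:
  "(\<Sum>i<length xs. (-1) ^ i * subdivided_simplex M j (omit i xs) ys) =
    (if \<exists>x\<in>set xs. 0 < height x then 1 else 0) - (if \<exists>x\<in>set xs. height x < 0 then 1 else 0)"
proof (cases "\<exists>i<length xs. convex hull (set ys) \<subseteq> convex hull (set (omit i xs))")
  case True
  then obtain i where i: "i < length xs" "convex hull (set ys) \<subseteq> convex hull (set (omit i xs))" by blast
  note h = omit_facet[OF i]
  have hi: "height (xs ! i) \<noteq> 0"
    using vertex_height_nonzero h(2) by (metis in_set_conv_nth)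
  have "\<not> convex hull (set ys) \<subseteq> convex hull (set (omit l xs))" if "l < length xs" "l \<noteq> i" for l
    using omit_facet(2)[OF that(1) _ i(1)] that(2) hi by blast
  then have "(\<Sum>l<length xs. (-1) ^ l * subdivided_simplex M j (omit l xs) ys) =
      (\<Sum>l<length xs. if l = i then (-1) ^ i * sgn (orientation (omit i xs) ys) else 0)"
    using i ys_mem by (intro sum.cong) (auto simp: subdivided_simplex_def)
  also have "\<dots> = sgn (height (xs ! i))"
    using i(1) by (simp add: h(1) sgn_mult)
  also have "\<dots> = (if \<exists>x\<in>set xs. 0 < height x then 1 else 0) - (if \<exists>x\<in>set xs. height x < 0 then 1 else 0)"
  proof -
    have "(\<exists>x\<in>set xs. P (height x)) \<longleftrightarrow> P (height (xs ! i))" if "\<not> P 0" for P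
      using h(2) i(1) that by (metis in_set_conv_nth)
    from this[of "\<lambda>r. 0 < r"] this[of "\<lambda>r. r < 0"] show ?thesis using hi by (auto simp: sgn_if)
  qed
  finally show ?thesis .
next
  case False
  \<comment> \<open>The simplex \<open>ys\<close> is contained in no facet, so for each vertex
    \<open>x\<close> some entry of \<open>ys\<close> has a positive coordinate at \<open>x\<close>,
    and the mean of the entries has one too.\<close>
  have bpos: "0 < bcoord (set xs) centre x" if x: "x \<in> set xs" for x
  proof -
    obtain i where i: "i < length xs" "xs ! i = x" using x by (auto simp: in_set_conv_nth)
    then have "\<not> set ys \<subseteq> convex hull (set (omit i xs))"
      using False hull_minimal[of "set ys" "convex hull (set (omit i xs))" convex] by auto
    then obtain y where y: "y \<in> set ys" "y \<notin> convex hull (set (omit i xs))" by blast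
    have yx: "z \<in> convex hull (set xs)" if "z \<in> set ys" for z
      using that ys_sub hull_subset[of "set ys" convex] by blast
    have "bcoord (set xs) y x \<noteq> 0"
    proof
      assume 0: "bcoord (set xs) y x = 0"
      have "y \<in> convex hull (set (omit i xs))"
      proof (rule convex_hull_bcoordI[of "set xs"])
        show "y \<in> affine hull (set xs)" using y(1) ys_affine by blast
        show "bcoord (set xs) y v = 0" if "v \<in> set xs - set (omit i xs)" for v
          using that 0 set_omit_distinct[OF xs(2) i(1)] i(2) by auto
      qed (auto simp: set_omit_subset bcoord_nonneg[OF xs(1) yx[OF y(1)]])
      then show False using y(2) by blast
    qed
    then have ypos: "0 < bcoord (set xs) y x" using bcoord_nonneg[OF xs(1) yx[OF y(1)], of x] by simp
    have "bcoord (set xs) centre x = (\<Sum>z\<in>set ys. (1 / real (Suc j)) * bcoord (set xs) z x)"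
      unfolding centre_def by (rule bcoord_affine[OF xs(1)]) (use ys_affine sum_weights x in auto)
    also have "\<dots> > 0"
      by (rule sum_pos2[of _ y]) (use y ypos bcoord_nonneg[OF xs(1) yx] in auto)
    finally show ?thesis .
  qed
  \<comment> \<open>The centre has height 0, a combination of the vertex heights with positive
    weights. The heights do not all vanish, so both signs occur.\<close>
  have both: "\<exists>x\<in>set xs. 0 < s * height x" if s: "s \<noteq> 0" for s
  proof (rule ccontr)
    assume neg: "\<not> ?thesis"
    have "(\<Sum>x\<in>set xs. bcoord (set xs) centre x * (s * height x)) = s * height centre"
      using height_sum[OF centre_affine] by (simp add: sum_distrib_left mult.left_commute)
    then have "(\<Sum>x\<in>set xs. - (bcoord (set xs) centre x * (s * height x))) = 0"
      using height_centre by (simp add: sum_negf)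
    moreover have "0 \<le> - (bcoord (set xs) centre x * (s * height x))" if "x \<in> set xs" for x
      using bpos[OF that] neg that by (auto simp: mult_le_0_iff not_less)
    ultimately have "\<forall>x\<in>set xs. - (bcoord (set xs) centre x * (s * height x)) = 0"
      by (subst (asm) sum_nonneg_eq_0_iff) auto
    then have "\<forall>x\<in>set xs. height x = 0" using bpos s by fastforce
    then show False using vertex_height_nonzero by blast
  qed
  have "subdivided_simplex M j (omit i xs) ys = 0" if "i < length xs" for i
    using False that by (simp add: subdivided_simplex_def)
  then show ?thesis using both[of 1] both[of "-1"] by simp
qed

end

section \<open>Passage from simplices to chains\<close>

lemma alt_boundary_subdivided_simplex:
  assumes "subdivision N M" "xs \<in> ordered_simplices N (Suc j)" "finite X" "vertices M \<subseteq> X"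
  shows "alt_boundary X (subdivided_simplex M (Suc j) xs) =
    (\<Sum>i<length xs. (-1) ^ i *\<^sub>R subdivided_simplex M j (omit i xs))"
proof
  fix ys
  have M: "simplicial_complex M" using assms(1) by (simp add: subdivision_def)
  show "alt_boundary X (subdivided_simplex M (Suc j) xs) ys =
    (\<Sum>i<length xs. (-1) ^ i *\<^sub>R subdivided_simplex M j (omit i xs)) ys"
  proof (cases "ys \<in> ordered_simplices M j \<and> convex hull (set ys) \<subseteq> convex hull (set xs)")
    case True
    then interpret facet_in_simplex N M j xs ys using assms by unfold_locales auto
    show ?thesis
      by (simp add: boundary_coefficient[OF assms(3,4)] facet_coefficient sum_fun_apply scaleR_fun_apply)
  next
    case False
    have "subdivided_simplex M (Suc j) xs (v # ys) = 0" for v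
    proof (rule ccontr)
      assume "subdivided_simplex M (Suc j) xs (v # ys) \<noteq> 0"
      then have *: "v # ys \<in> ordered_simplices M (Suc j)" "convex hull (set (v # ys)) \<subseteq> convex hull (set xs)"
        by (auto simp: subdivided_simplex_def split: if_splits)
      have "ys \<in> ordered_simplices M j"
        by (rule ordered_simplices_sublist[OF M *(1)]) (use *(1) in \<open>auto simp: ordered_simplices_iff\<close>)
      moreover have "convex hull (set ys) \<subseteq> convex hull (set xs)"
        using *(2) hull_mono[of "set ys" "set (v # ys)" convex] by auto
      ultimately show False using False by blast
    qed
    moreover have "subdivided_simplex M j (omit i xs) ys = 0" for i
      using False hull_mono[OF set_omit_subset[of i xs], of convex] by (auto simp: subdivided_simplex_def)
    ultimately show ?thesis by (simp add: alt_boundary_def sum_fun_apply scaleR_fun_apply)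
  qed
qed

lemma vertices_subdivision:
  assumes "subdivision N M"
  shows "vertices N \<subseteq> vertices M"
proof
  fix x assume "x \<in> vertices N"
  then have "{x} \<in> N" by (simp add: vertices_def)
  then obtain \<tau> where "\<tau> \<in> M" "x \<in> \<tau>" "\<tau> \<subseteq> {x}" by (rule subdivision_carrier[OF assms _ singletonI])
  moreover from this have "\<tau> = {x}" by blast
  ultimately show "x \<in> vertices M" by (simp add: vertices_def)
qed

lemma subdivided_simplex_0:
  assumes "subdivision N M" "xs \<in> ordered_simplices N 0"
  shows "subdivided_simplex M 0 xs = oriented_simplex xs"
proof -
  obtain x where x: "xs = [x]" using length_ordered_simplices[OF assms(2)] by (auto simp: length_Suc_conv)
  have "{x} \<in> M"
    using vertices_subdivision[OF assms(1)] assms(2) x by (auto simp: vertices_def ordered_simplices_iff)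
  then have "subdivided_simplex M 0 xs xs = 1"
    by (simp add: subdivided_simplex_def x ordered_simplices_iff orientation_self)
  moreover have "subdivided_simplex M 0 xs = subdivided_simplex M 0 xs xs *\<^sub>R oriented_simplex xs"
  proof (rule alternating_eq_oriented_simplex)
    show "alternating (subdivided_simplex M 0 xs)"
      by (rule simplicial_chainsD(1)[OF subdivided_simplex_mem]) (simp add: x)
    fix ys assume "subdivided_simplex M 0 xs ys \<noteq> 0"
    then have ys: "ys \<in> ordered_simplices M 0" "convex hull (set ys) \<subseteq> {x}"
      by (auto simp: subdivided_simplex_def x split: if_splits)
    then show "length ys = length xs \<and> set ys \<subseteq> set xs"
      using hull_subset[of "set ys" convex] length_ordered_simplices[OF ys(1)] x by auto
  qed (simp add: x)
  ultimately show ?thesis by simp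
qed

lemma oriented_simplices_eqI:
  assumes "simplicial_complex K" "linear F" "linear G"
    "\<And>xs. xs \<in> ordered_simplices K k \<Longrightarrow> F (oriented_simplex xs) = G (oriented_simplex xs)"
    "c \<in> simplicial_chains K k"
  shows "F c = G c"
  by (rule linear_eq_on_span[OF assms(2,3), of "oriented_simplex ` ordered_simplices K k"])
    (use assms in \<open>auto simp: simplicial_chains_span\<close>)

text \<open>The second claim covers degree 0: a vertex of \<open>N\<close> is subdivided by itself,
  so the map is compatible with the augmentations too.\<close>

lemma subdivision_map_alt_boundary:
  assumes "subdivision N M" "finite X" "vertices M \<subseteq> X"
  shows "c \<in> simplicial_chains N (Suc k) \<Longrightarrow>
      alt_boundary X (subdivision_map N M (Suc k) c) = subdivision_map N M k (alt_boundary X c)"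
    and "c \<in> simplicial_chains N 0 \<Longrightarrow> subdivision_map N M 0 c = c"
proof -
  have N: "simplicial_complex N" and M: "simplicial_complex M" using assms(1) by (auto simp: subdivision_def)
  note lin = linear_subdivision_map linear_alt_boundary
  show "alt_boundary X (subdivision_map N M (Suc k) c) = subdivision_map N M k (alt_boundary X c)"
    if "c \<in> simplicial_chains N (Suc k)"
  proof (rule oriented_simplices_eqI[OF N _ _ _ that])
    show "linear (\<lambda>c. alt_boundary X (subdivision_map N M (Suc k) c))"
      "linear (\<lambda>c. subdivision_map N M k (alt_boundary X c))"
      by (simp_all add: linear_compose[unfolded o_def] lin)
    fix xs assume xs: "xs \<in> ordered_simplices N (Suc k)"
    have o: "omit i xs \<in> ordered_simplices N k" if "i < length xs" for i
      by (rule ordered_simplices_sublist[OF N xs])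
        (use xs that in \<open>auto simp: ordered_simplices_iff length_omit distinct_omit set_omit_subset\<close>)
    have sX: "set xs \<subseteq> X"
      using ordered_simplices_vertices[OF N xs] vertices_subdivision[OF assms(1)] assms(3) by blast
    have "subdivision_map N M k (alt_boundary X (oriented_simplex xs)) =
        (\<Sum>i<length xs. (-1) ^ i *\<^sub>R subdivision_map N M k (oriented_simplex (omit i xs)))"
      by (simp add: alt_boundary_oriented_simplex[OF assms(2) sX] boundary_simplex_omit
          subdivision_map_linear)
    also have "\<dots> = (\<Sum>i<length xs. (-1) ^ i *\<^sub>R subdivided_simplex M k (omit i xs))"
      using o by (intro sum.cong refl) (simp add: subdivision_map_oriented_simplex[OF N M])
    finally show "alt_boundary X (subdivision_map N M (Suc k) (oriented_simplex xs)) =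
        subdivision_map N M k (alt_boundary X (oriented_simplex xs))"
      by (simp add: subdivision_map_oriented_simplex[OF N M xs] alt_boundary_subdivided_simplex[OF assms(1) xs assms(2,3)])
  qed
  show "subdivision_map N M 0 c = c" if "c \<in> simplicial_chains N 0"
    by (rule oriented_simplices_eqI[OF N linear_subdivision_map linear_id[unfolded id_def] _ that])
      (simp add: subdivision_map_oriented_simplex[OF N M] subdivided_simplex_0[OF assms(1)])
qed

section \<open>Simplicial approximation\<close>

definition simplicial_approx :: "'a set set \<Rightarrow> ('a \<Rightarrow> 'a) \<Rightarrow> bool" where
  "simplicial_approx K f \<longleftrightarrow> (\<forall>x\<in>\<Union>K. f x \<in> vertices K \<and> (\<forall>\<tau>\<in>K. x \<in> \<tau> \<longrightarrow> f x \<in> \<tau>))"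

text \<open>Any vertex of the smallest simplex containing \<open>x\<close> will do; in other words,
  the open stars of the vertices cover the polyhedron.\<close>

lemma star_vertex_exists:
  assumes K: "simplicial_complex K" and x: "x \<in> \<Union>K"
  shows "\<exists>v\<in>vertices K. \<forall>\<tau>\<in>K. x \<in> \<tau> \<longrightarrow> v \<in> \<tau>"
proof -
  let ?A = "{\<tau> \<in> K. x \<in> \<tau>}"
  have "finite ?A" "?A \<noteq> {}" using simplicial_complex_finite[OF K] x by auto
  then obtain \<tau> where \<tau>: "\<tau> \<in> K" "x \<in> \<tau>" "\<And>\<rho>. \<rho> \<in> K \<Longrightarrow> x \<in> \<rho> \<Longrightarrow> \<rho> \<subseteq> \<tau> \<Longrightarrow> \<tau> = \<rho>"
    using finite_has_minimal[of ?A] by auto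
  obtain C where C: "\<not> affine_dependent C" "\<tau> = convex hull C"
    by (rule simplicial_complex_simplex[OF K \<tau>(1)])
  obtain v where v: "v \<in> C" using \<tau>(2) C(2) by fastforce
  have "v \<in> vertices K" using simplex_subset_vertices[OF K C(1)] \<tau>(1) C(2) v by blast
  moreover have "v \<in> \<rho>" if "\<rho> \<in> K" "x \<in> \<rho>" for \<rho>
  proof -
    have "\<tau> \<inter> \<rho> \<in> K"
      by (rule simplicial_complex_face[OF K \<tau>(1) simplicial_complex_Int[OF K \<tau>(1) that(1)]])
    then have "\<tau> = \<tau> \<inter> \<rho>" using \<tau>(2,3) that(2) by blast
    moreover have "v \<in> \<tau>" using v C(2) hull_inc by metis
    ultimately show ?thesis by blast
  qed
  ultimately show ?thesis by blast
qed

text \<open>\<open>\<delta>\<close> is a Lebesgue number of the cover by open stars, and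
  \<open>f x\<close> is a vertex whose star contains the ball around \<open>x\<close>. All points
  near \<open>y\<close> are thus sent to vertices of every simplex containing
  \<open>y\<close>.\<close>

lemma fine_simplicial_approx_exists:
  assumes K: "simplicial_complex K"
  shows "\<exists>f \<delta>. 0 < \<delta> \<and> simplicial_approx K f \<and>
    (\<forall>x\<in>\<Union>K. \<forall>y\<in>\<Union>K. dist x y < \<delta> \<longrightarrow> (\<forall>\<tau>\<in>K. y \<in> \<tau> \<longrightarrow> f x \<in> \<tau>))"
proof -
  \<comment> \<open>An open set of the ambient space that meets the polyhedron in the open star of
    \<open>v\<close>.\<close>
  let ?star = "\<lambda>v. - \<Union>{\<tau> \<in> K. v \<notin> \<tau>}"
  have "compact \<tau>" if "\<tau> \<in> K" for \<tau>
    using K that compact_simplex unfolding simplicial_complex_def by blast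
  then have cpt: "compact (\<Union>K)" using simplicial_complex_finite[OF K] by (intro compact_Union) auto
  have cov: "\<Union>K \<subseteq> \<Union>(?star ` vertices K)"
  proof
    fix x assume "x \<in> \<Union>K"
    then obtain v where "v \<in> vertices K" "\<forall>\<tau>\<in>K. x \<in> \<tau> \<longrightarrow> v \<in> \<tau>" using star_vertex_exists[OF K] by blast
    then show "x \<in> \<Union>(?star ` vertices K)" by blast
  qed
  have op: "open G" if "G \<in> ?star ` vertices K" for G
  proof -
    have "closed (\<Union>{\<tau> \<in> K. v \<notin> \<tau>})" for v
      using simplicial_complex_finite[OF K] simplicial_complex_closed[OF K] by (intro closed_Union) auto
    then show ?thesis using that by (auto simp: open_Compl)
  qed
  obtain \<delta> where \<delta>: "0 < \<delta>" "\<And>x. x \<in> \<Union>K \<Longrightarrow> \<exists>G\<in>?star ` vertices K. ball x \<delta> \<subseteq> G"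
    by (rule Heine_Borel_lemma[OF cpt cov]) (erule op, blast)
  then have "\<forall>x. \<exists>v. x \<in> \<Union>K \<longrightarrow> v \<in> vertices K \<and> ball x \<delta> \<subseteq> ?star v" by blast
  then obtain f where f: "\<And>x. x \<in> \<Union>K \<Longrightarrow> f x \<in> vertices K \<and> ball x \<delta> \<subseteq> ?star (f x)" by metis
  have near: "f x \<in> \<tau>" if "x \<in> \<Union>K" "dist x y < \<delta>" "\<tau> \<in> K" "y \<in> \<tau>" for x y \<tau>
  proof -
    have "y \<in> ?star (f x)" using f[OF that(1)] that(2) by auto
    then show ?thesis using that(3,4) by blast
  qed
  have "simplicial_approx K f"
    unfolding simplicial_approx_def using f near[of x x for x] \<delta>(1) by simp
  then show ?thesis using \<delta>(1) near by blast
qed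

section \<open>Chains supported on a single simplex\<close>

lemma oriented_simplex_span:
  assumes xs: "distinct xs" and zs: "length zs = length xs" "set zs \<subseteq> set xs"
  shows "oriented_simplex zs \<in> span {oriented_simplex xs}"
proof -
  have "oriented_simplex zs = oriented_simplex zs xs *\<^sub>R oriented_simplex xs"
  proof (rule alternating_eq_oriented_simplex[OF alternating_oriented_simplex xs])
    fix ys assume "oriented_simplex zs ys \<noteq> 0"
    then have "mset ys = mset zs" by (rule oriented_simplex_nonzero)
    then show "length ys = length xs \<and> set ys \<subseteq> set xs"
      using mset_eq_setD[of ys zs] mset_eq_length[of ys zs] zs by simp
  qed
  then show ?thesis by (simp add: span_singleton)
qed

text \<open>By the augmentation, this also holds for a single vertex.\<close>

lemma span_oriented_simplex_eqI:
  assumes xs: "distinct xs" "xs \<noteq> []" and X: "finite X" "set xs \<subseteq> X"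
    and c: "c \<in> span {oriented_simplex xs}"
    and eq: "alt_boundary X c = alt_boundary X (oriented_simplex xs)"
  shows "c = oriented_simplex xs"
proof -
  obtain a where a: "c = a *\<^sub>R oriented_simplex xs" using c by (auto simp: span_singleton)
  obtain x ys where x: "xs = x # ys" using xs(2) by (cases xs) auto
  have "oriented_simplex xs (v # ys) = (if v = x then 1 else 0)" for v
  proof (cases "v = x")
    case True
    then show ?thesis using oriented_simplex_self[OF xs(1)] x by simp
  next
    case False
    then have "mset (v # ys) \<noteq> mset xs" using x by simp
    then show ?thesis using oriented_simplex_nonzero(1)[of xs "v # ys"] False by auto
  qed
  then have "alt_boundary X (oriented_simplex xs) ys = 1"
    using X x by (simp add: alt_boundary_def)
  moreover have "alt_boundary X c ys = a * alt_boundary X (oriented_simplex xs) ys"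
    by (simp add: a linear_scale[OF linear_alt_boundary] scaleR_fun_apply)
  ultimately have "a = 1" using eq by simp
  then show ?thesis using a by simp
qed

lemma approx_vertex_in_simplex:
  assumes "simplicial_complex K" "simplicial_approx K f" "\<not> affine_dependent S" "convex hull S \<in> K"
    "x \<in> convex hull S"
  shows "f x \<in> S"
proof (rule vertex_in_simplex[OF assms(1,3,4)])
  show "f x \<in> vertices K" "f x \<in> convex hull S"
    using assms(2,4,5) unfolding simplicial_approx_def by blast+
qed

lemma antisym_push_list_chain: "antisym (push f (list_chain ys)) = oriented_simplex (map f ys)"
  by (simp add: push_list_chain antisym_list_chain)

text \<open>An algebraic form of Sperner's lemma. As \<open>f\<close> keeps points of a simplex in
  that simplex, the result is a multiple of \<open>oriented_simplex xs\<close>; by induction over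
  the faces it has the right boundary, which fixes the multiple.\<close>

lemma approx_sd_list_chain:
  assumes K: "simplicial_complex K" and f: "simplicial_approx K f"
    and "distinct xs" "\<not> affine_dependent (set xs)" "convex hull (set xs) \<in> K"
  shows "antisym (push f ((sd ^^ m) (list_chain xs))) = oriented_simplex xs"
  using assms(3-)
proof (induction xs rule: length_induct)
  case (1 xs)
  note xs = 1(2-4)
  let ?F = "\<lambda>c. antisym (push f ((sd ^^ m) c))"
  have linF: "linear ?F"
    using linear_compose[OF linear_compose[OF linear_sd_iterate linear_push] linear_antisym]
    by (simp add: o_def)
  show ?case
  proof (cases "xs = []")
    case True
    \<comment> \<open>The induction starts at the empty face, so a vertex is not a special
      case.\<close>
    have "(sd ^^ m) (list_chain []) = list_chain ([] :: 'a list)"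
      by (induction m) (simp_all add: sd_list_chain sd_list.simps)
    then show ?thesis using True by (simp add: push_list_chain antisym_list_chain)
  next
    case False
    \<comment> \<open>Serves here to keep all entries in the hull and the length fixed; any bound
      \<open>D\<close> on the distances will do.\<close>
    let ?S = "small_lists (length xs) (convex hull (set xs))"
    obtain D where D: "\<And>p q. p \<in> set xs \<Longrightarrow> q \<in> set xs \<Longrightarrow> dist p q \<le> D"
      using diameter_bounded_bound[OF finite_imp_bounded[OF finite_set]] by metis
    have "list_chain xs \<in> span (list_chain ` ?S D)"
      using D hull_subset[of "set xs" convex] by (intro span_base imageI) (simp add: small_lists_def)
    then have mem: "(sd ^^ m) (list_chain xs) \<in> span (list_chain ` ?S (((real (length xs) - 1) / real (length xs)) ^ m * D))"
      by (rule sd_iterate_small[OF convex_convex_hull order_refl])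
    have fys: "set (map f ys) \<subseteq> set xs" "length (map f ys) = length xs" if "ys \<in> ?S d" for ys d
      using that approx_vertex_in_simplex[OF K f xs(2,3)] by (auto simp: small_lists_def)
    have line: "?F (list_chain xs) \<in> span {oriented_simplex xs}"
    proof (rule linear_image_span_subset[OF _ _ mem, of "\<lambda>c. antisym (push f c)"])
      show "linear (\<lambda>c. antisym (push f c))"
        using linear_compose[OF linear_push linear_antisym] by (simp add: o_def)
      fix e assume "e \<in> list_chain ` ?S (((real (length xs) - 1) / real (length xs)) ^ m * D)"
      then show "antisym (push f e) \<in> span {oriented_simplex xs}"
        using oriented_simplex_span[OF xs(1)] fys by (auto simp: antisym_push_list_chain)
    qed
    have o: "(sd ^^ m) (list_chain xs) \<in> ordered_chains"
      by (intro sd_iterate_ordered list_chain_ordered)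
    have "push f ((sd ^^ m) (list_chain xs)) \<in> span (list_chain ` {ys. set ys \<subseteq> set xs})"
      by (rule linear_image_span_subset[OF linear_push _ mem])
        (use fys in \<open>auto simp: push_list_chain intro!: span_base imageI\<close>)
    then have "alt_boundary (set xs) (?F (list_chain xs)) = antisym (ord_boundary (push f ((sd ^^ m) (list_chain xs))))"
      by (rule alt_boundary_antisym[OF finite_set])
    also have "\<dots> = ?F (ord_boundary (list_chain xs))"
      by (simp add: ord_boundary_push[OF o] ord_boundary_sd_iterate[OF list_chain_ordered])
    also have "\<dots> = (\<Sum>i<length xs. (-1) ^ i *\<^sub>R ?F (list_chain (omit i xs)))"
      by (simp add: ord_boundary_list_chain linear_sum[OF linF] linear_scale[OF linF])
    also have "\<dots> = (\<Sum>i<length xs. (-1) ^ i *\<^sub>R oriented_simplex (omit i xs))"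
    proof (intro sum.cong refl arg_cong[where f = "scaleR _"])
      fix i assume "i \<in> {..<length xs}"
      then show "?F (list_chain (omit i xs)) = oriented_simplex (omit i xs)"
        using affine_dependent_subset[OF _ set_omit_subset] xs
          simplicial_complex_subface[OF K xs(2,3) set_omit_subset]
        by (intro 1(1)[rule_format]) (auto simp: length_omit distinct_omit)
    qed
    also have "\<dots> = alt_boundary (set xs) (oriented_simplex xs)"
      by (simp add: alt_boundary_oriented_simplex boundary_simplex_omit)
    finally show ?thesis
      by (rule span_oriented_simplex_eqI[OF xs(1) False finite_set subset_refl line])
  qed
qed

lemma oriented_simplex_sum:
  "oriented_simplex xs = (\<Sum>p | p permutes {..<length xs}. of_int (sign p) *\<^sub>R list_chain (permute_list p xs))"
proof
  fix ys
  have "(\<Sum>p | p permutes {..<length xs}. of_int (sign p) *\<^sub>R list_chain (permute_list p xs)) ys =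
      (\<Sum>p | p permutes {..<length xs}. if permute_list p xs = ys then of_int (sign p) else 0)"
    by (auto simp: sum_fun_apply scaleR_fun_apply list_chain_def intro!: sum.cong)
  also have "\<dots> = (\<Sum>p\<in>{p. p permutes {..<length xs} \<and> permute_list p xs = ys}. of_int (sign p))"
    by (rule sum.mono_neutral_cong_right) (auto simp: finite_permutes)
  finally show "oriented_simplex xs ys =
      (\<Sum>p | p permutes {..<length xs}. of_int (sign p) *\<^sub>R list_chain (permute_list p xs)) ys"
    by (simp add: oriented_simplex_def)
qed

text \<open>Reordering commutes with \<open>map f\<close>, so \<open>push\<close> acts on
  alternating chains as well; a simplex that \<open>f\<close> collapses becomes 0.\<close>

lemma push_oriented_simplex: "push f (oriented_simplex xs) = oriented_simplex (map f xs)"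
  unfolding oriented_simplex_sum
  by (simp add: push_linear push_list_chain)
    (intro sum.cong refl, simp add: permute_list_map)

section \<open>A subdivision is a quasi-isomorphism\<close>

locale approximated_subdivision =
  fixes N M :: "'a::euclidean_space set set" and \<phi> :: "'a \<Rightarrow> 'a"
  assumes subdiv: "subdivision N M" and approx: "simplicial_approx N \<phi>"
begin

lemma N: "simplicial_complex N" and M: "simplicial_complex M" and Union_eq: "\<Union>M = \<Union>N"
  and carrier: "\<tau> \<in> M \<Longrightarrow> \<exists>\<sigma>\<in>N. \<tau> \<subseteq> \<sigma>"
  using subdiv by (auto simp: subdivision_def)

lemma carrier_simplex:
  assumes "xs \<in> ordered_simplices M k"
  obtains \<sigma> where "\<sigma> \<in> N" "set xs \<subseteq> \<sigma>"
  using assms carrier[of "convex hull (set xs)"] hull_subset[of "set xs" convex]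
  by (auto simp: ordered_simplices_iff)

lemma fX: "finite (vertices M)" by (rule finite_vertices[OF M])

lemma NX: "vertices N \<subseteq> vertices M" by (rule vertices_subdivision[OF subdiv])

lemma push_mem:
  assumes "c \<in> simplicial_chains M k"
  shows "push \<phi> c \<in> simplicial_chains N k"
proof -
  have "push \<phi> c \<in> span (oriented_simplex ` ordered_simplices N k)"
  proof (rule linear_image_span_subset[OF linear_push])
    show "c \<in> span (oriented_simplex ` ordered_simplices M k)"
      using assms by (simp add: simplicial_chains_span[OF M])
    fix e assume "e \<in> oriented_simplex ` ordered_simplices M k"
    then obtain xs where xs: "xs \<in> ordered_simplices M k" "e = oriented_simplex xs" by blast
    show "push \<phi> e \<in> span (oriented_simplex ` ordered_simplices N k)"
    proof (cases "distinct (map \<phi> xs)")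
      case True
      obtain \<sigma> where \<sigma>: "\<sigma> \<in> N" "set xs \<subseteq> \<sigma>" using carrier_simplex[OF xs(1)] .
      obtain C where C: "\<not> affine_dependent C" "\<sigma> = convex hull C"
        by (rule simplicial_complex_simplex[OF N \<sigma>(1)])
      have sub: "set (map \<phi> xs) \<subseteq> C"
        using approx_vertex_in_simplex[OF N approx C(1)] \<sigma> C(2) by auto
      have "map \<phi> xs \<in> ordered_simplices N k"
        using True length_ordered_simplices[OF xs(1)] affine_dependent_subset[OF _ sub] C(1)
          simplicial_complex_subface[OF N C(1) _ sub] \<sigma>(1) C(2)
        by (auto simp: ordered_simplices_iff)
      then show ?thesis by (simp add: xs(2) push_oriented_simplex span_base)
    next
      case False
      then show ?thesis by (simp add: xs(2) push_oriented_simplex oriented_simplex_not_distinct span_zero)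
    qed
  qed
  then show ?thesis by (simp add: simplicial_chains_span[OF N])
qed

lemma alt_boundary_push:
  assumes "c \<in> simplicial_chains M k"
  shows "alt_boundary (vertices M) (push \<phi> c) = push \<phi> (alt_boundary (vertices M) c)"
proof (rule oriented_simplices_eqI[OF M _ _ _ assms])
  show "linear (\<lambda>c. alt_boundary (vertices M) (push \<phi> c))" "linear (\<lambda>c. push \<phi> (alt_boundary (vertices M) c))"
    using linear_compose[OF linear_push linear_alt_boundary] linear_compose[OF linear_alt_boundary linear_push]
    by (simp_all add: o_def)
  fix xs assume xs: "xs \<in> ordered_simplices M k"
  obtain \<sigma> where \<sigma>: "\<sigma> \<in> N" "set xs \<subseteq> \<sigma>" using carrier_simplex[OF xs] .
  then have "\<phi> x \<in> vertices N" if "x \<in> set xs" for x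
    using that approx unfolding simplicial_approx_def by blast
  then have "set (map \<phi> xs) \<subseteq> vertices M" using NX by auto
  then show "alt_boundary (vertices M) (push \<phi> (oriented_simplex xs)) =
      push \<phi> (alt_boundary (vertices M) (oriented_simplex xs))"
    by (simp add: push_oriented_simplex alt_boundary_oriented_simplex[OF fX] ordered_simplices_vertices[OF M xs]
        boundary_simplex_omit push_linear map_omit)
qed

text \<open>The argument of \<open>approx_sd_list_chain\<close> again, with \<open>M\<close> in
  place of a barycentric subdivision: the boundary now comes from
  \<open>alt_boundary_subdivided_simplex\<close>.\<close>

lemma push_subdivided_simplex:
  "xs \<in> ordered_simplices N k \<Longrightarrow> push \<phi> (subdivided_simplex M k xs) = oriented_simplex xs"
proof (induction k arbitrary: xs)
  case 0
  then obtain x where x: "xs = [x]" using length_ordered_simplices[OF 0] by (auto simp: length_Suc_conv)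
  have "{x} \<in> N" using 0 by (simp add: ordered_simplices_iff x)
  \<comment> \<open>A vertex of \<open>N\<close> is a simplex by itself, so \<open>\<phi>\<close>
    has to fix it.\<close>
  then have "\<phi> x \<in> {x}" using approx by (auto simp: simplicial_approx_def)
  then show ?case
    unfolding subdivided_simplex_0[OF subdiv 0] push_oriented_simplex by (simp add: x)
next
  case (Suc k)
  let ?c = "subdivided_simplex M (Suc k) xs"
  have xs: "distinct xs" "\<not> affine_dependent (set xs)" "convex hull (set xs) \<in> N" "length xs = Suc (Suc k)"
    using Suc.prems by (auto simp: ordered_simplices_iff)
  have ne: "xs \<noteq> []" using xs(4) by auto
  have cM: "?c \<in> simplicial_chains M (Suc k)" by (rule subdivided_simplex_mem[OF xs(4)])
  have sX: "set xs \<subseteq> vertices M" using ordered_simplices_vertices[OF N Suc.prems] NX by blast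
  have o: "omit i xs \<in> ordered_simplices N k" if "i < length xs" for i
    by (rule ordered_simplices_sublist[OF N Suc.prems])
      (use xs that in \<open>auto simp: length_omit distinct_omit set_omit_subset\<close>)
  have "push \<phi> ?c = (\<Sum>zs\<in>ordered_simplices M (Suc k). (?c zs / fact (Suc k + 1)) *\<^sub>R oriented_simplex (map \<phi> zs))"
    by (subst simplicial_chain_expansion[OF M cM])
      (simp add: push_linear push_oriented_simplex del: fact_Suc)
  also have "\<dots> \<in> span {oriented_simplex xs}"
  proof (rule span_sum)
    fix zs assume zs: "zs \<in> ordered_simplices M (Suc k)"
    show "(?c zs / fact (Suc k + 1)) *\<^sub>R oriented_simplex (map \<phi> zs) \<in> span {oriented_simplex xs}"
    proof (cases "convex hull (set zs) \<subseteq> convex hull (set xs)")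
      case True
      then have "set (map \<phi> zs) \<subseteq> set xs"
        using approx_vertex_in_simplex[OF N approx xs(2,3)] hull_subset[of "set zs" convex] by auto
      then show ?thesis
        using xs(1,4) length_ordered_simplices[OF zs] by (intro span_scale oriented_simplex_span) auto
    next
      case False
      then show ?thesis by (simp add: subdivided_simplex_def span_zero)
    qed
  qed
  finally have line: "push \<phi> ?c \<in> span {oriented_simplex xs}" .
  have "alt_boundary (vertices M) (push \<phi> ?c) = push \<phi> (alt_boundary (vertices M) ?c)"
    by (rule alt_boundary_push[OF cM])
  also have "\<dots> = (\<Sum>i<length xs. (-1) ^ i *\<^sub>R push \<phi> (subdivided_simplex M k (omit i xs)))"
    by (simp add: alt_boundary_subdivided_simplex[OF subdiv Suc.prems fX subset_refl]
        push_linear)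
  also have "\<dots> = (\<Sum>i<length xs. (-1) ^ i *\<^sub>R oriented_simplex (omit i xs))"
    using Suc.IH o by (intro sum.cong refl) simp
  also have "\<dots> = alt_boundary (vertices M) (oriented_simplex xs)"
    by (simp add: alt_boundary_oriented_simplex[OF fX sX] boundary_simplex_omit)
  finally show ?case
    by (rule span_oriented_simplex_eqI[OF xs(1) ne fX sX line])
qed

lemma push_subdivision_map:
  assumes "c \<in> simplicial_chains N k"
  shows "push \<phi> (subdivision_map N M k c) = c"
proof (rule oriented_simplices_eqI[OF N _ _ _ assms, of "\<lambda>c. push \<phi> (subdivision_map N M k c)" "\<lambda>c. c"])
  show "linear (\<lambda>c. push \<phi> (subdivision_map N M k c))"
    using linear_compose[OF linear_subdivision_map linear_push] by (simp add: o_def)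
  show "linear (\<lambda>c. c)" by (rule linear_id[unfolded id_def])
qed (simp add: subdivision_map_oriented_simplex[OF N M] push_subdivided_simplex)

lemma simplicial_chain_list_span:
  assumes "c \<in> simplicial_chains M k"
  shows "c \<in> span (list_chain ` ordered_simplices M k)"
proof -
  have "c = (\<Sum>xs\<in>ordered_simplices M k. c xs *\<^sub>R list_chain xs)"
    by (rule list_chain_expansion[OF finite_ordered_simplices[OF M] simplicial_chainsD(2)[OF assms]])
  also have "\<dots> \<in> span (list_chain ` ordered_simplices M k)" by (intro span_sum span_scale span_base imageI)
  finally show ?thesis .
qed

text \<open>
  The prism contracts \<open>z\<close> inside the convex simplices of \<open>N\<close>. Its pieces become small after enough
  barycentric subdivisions, so a second simplicial approximation brings the contraction back to
  chains of \<open>M\<close>, without changing \<open>z\<close> itself.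
\<close>

lemma cycle_bounds:
  assumes z: "z \<in> simplicial_chains M k" and cyc: "alt_boundary (vertices M) z = 0" and pz: "push \<phi> z = 0"
  shows "\<exists>w\<in>simplicial_chains M (Suc k). alt_boundary (vertices M) w = z"
proof -
  obtain \<psi> \<delta> where \<delta>: "0 < \<delta>" and \<psi>: "simplicial_approx M \<psi>"
    and fine: "\<And>x y \<tau>. x \<in> \<Union>M \<Longrightarrow> y \<in> \<Union>M \<Longrightarrow> dist x y < \<delta> \<Longrightarrow> \<tau> \<in> M \<Longrightarrow> y \<in> \<tau> \<Longrightarrow> \<psi> x \<in> \<tau>"
    using fine_simplicial_approx_exists[OF M] by blast
  let ?n = "Suc (Suc k)" and ?X = "vertices M"
  have zo: "z \<in> ordered_chains"
    using simplicial_chain_list_span[OF z] span_mono[of "list_chain ` ordered_simplices M k" "range list_chain"] by blast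
  \<comment> \<open>The alternating chain \<open>z\<close> is read as an ordered chain. Its ordered
    boundary is a multiple of the alternating one, so it remains a cycle.\<close>
  have "ord_boundary z = real (Suc k) *\<^sub>R alt_boundary ?X z"
    by (rule ord_boundary_alternating[OF simplicial_chainsD(1)[OF z] finite_ordered_simplices[OF M]
          simplicial_chainsD(2)[OF z] length_ordered_simplices fX ordered_simplices_vertices[OF M]])
  then have oz: "ord_boundary z = 0" using cyc by simp
  define G where "G = prism \<phi> z"
  have Go: "G \<in> ordered_chains" unfolding G_def by (rule prism_ordered[OF zo])
  have bG: "ord_boundary G = - z"
    unfolding G_def using ord_boundary_prism[OF zo, of \<phi>] oz pz by (simp add: linear_0[OF linear_prism])
  \<comment> \<open>A simplex of \<open>N\<close> containing \<open>xs\<close> also contains the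
    images under \<open>\<phi>\<close>. In general no simplex of \<open>M\<close> does, which is why
    the prism has to be subdivided.\<close>
  let ?L = "{ys. length ys = ?n \<and> (\<exists>\<sigma>\<in>N. set ys \<subseteq> \<sigma>)}"
  have GL: "G \<in> span (list_chain ` ?L)"
    unfolding G_def
  proof (rule linear_image_span_subset[OF linear_prism _ simplicial_chain_list_span[OF z]])
    fix e assume "e \<in> list_chain ` ordered_simplices M k"
    then obtain xs where xs: "xs \<in> ordered_simplices M k" "e = list_chain xs" by blast
    obtain \<sigma> where \<sigma>: "\<sigma> \<in> N" "set xs \<subseteq> \<sigma>" using carrier_simplex[OF xs(1)] .
    have "\<phi> ` set xs \<subseteq> \<sigma>" using \<sigma> approx by (auto simp: simplicial_approx_def)
    then have pts: "set xs \<union> \<phi> ` set xs \<subseteq> \<sigma>" using \<sigma> by blast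
    have sub: "{ys. length ys = Suc (length xs) \<and> set ys \<subseteq> set xs \<union> \<phi> ` set xs} \<subseteq> ?L"
      using length_ordered_simplices[OF xs(1)] subset_trans[OF _ pts] \<sigma>(1) by (intro subsetI CollectI) auto
    show "prism \<phi> e \<in> span (list_chain ` ?L)"
      unfolding xs(2) prism_list_chain by (rule subsetD[OF span_mono[OF image_mono[OF sub]] prism_list_mem])
  qed
  \<comment> \<open>A crude initial bound for the mesh; the powers of \<open>?r < 1\<close> bring it
    below \<open>\<delta>\<close>.\<close>
  define D where "D = diameter (\<Union>M)"
  have "bounded \<tau>" if "\<tau> \<in> M" for \<tau>
    using M that compact_simplex compact_imp_bounded unfolding simplicial_complex_def by blast
  then have "bounded (\<Union>M)" using simplicial_complex_finite[OF M] by (intro bounded_Union) auto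
  then have D: "dist x y \<le> D" if "x \<in> \<Union>M" "y \<in> \<Union>M" for x y
    unfolding D_def using that diameter_bounded_bound by blast
  let ?r = "(real ?n - 1) / real ?n"
  have "(\<lambda>m. ?r ^ m * D) \<longlonglongrightarrow> 0 * D"
    by (intro tendsto_mult_right LIMSEQ_power_zero) simp
  then have "\<forall>\<^sub>F m in sequentially. ?r ^ m * D < \<delta>"
    using \<delta> by (intro order_tendstoD(2)[of _ "0 * D"]) auto
  then obtain m where m: "?r ^ m * D < \<delta>" by (auto simp: eventually_sequentially)
  define u where "u = push \<psi> ((sd ^^ m) G)"
  let ?S = "\<Union>\<sigma>\<in>N. small_lists ?n \<sigma> (?r ^ m * D)"
  have sdG: "(sd ^^ m) G \<in> span (list_chain ` ?S)"
  proof (rule linear_image_span_subset[OF linear_sd_iterate _ GL])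
    fix e assume "e \<in> list_chain ` ?L"
    then obtain ys \<sigma> where ys: "e = list_chain ys" "length ys = ?n" "\<sigma> \<in> N" "set ys \<subseteq> \<sigma>" by blast
    have cv: "convex \<sigma>" using simplicial_complex_simplex[OF N ys(3)] convex_convex_hull by metis
    have "\<sigma> \<subseteq> \<Union>M" using ys(3) Union_eq by blast
    then have "e \<in> span (list_chain ` small_lists ?n \<sigma> D)"
      unfolding ys(1) using ys(2,4) by (intro span_base imageI) (auto simp: small_lists_def intro!: D)
    then have "(sd ^^ m) e \<in> span (list_chain ` small_lists ?n \<sigma> (?r ^ m * D))"
      by (rule sd_iterate_small[OF cv order_refl])
    moreover have "span (list_chain ` small_lists ?n \<sigma> (?r ^ m * D)) \<subseteq> span (list_chain ` ?S)"
      using ys(3) by (intro span_mono image_mono) auto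
    ultimately show "(sd ^^ m) e \<in> span (list_chain ` ?S)" by blast
  qed
  have pts: "set ys \<subseteq> \<Union>M" if "ys \<in> ?S" for ys
    using that Union_eq by (auto simp: small_lists_def)
  have uX: "u \<in> span (list_chain ` {ys. set ys \<subseteq> ?X})"
    unfolding u_def
  proof (rule linear_image_span_subset[OF linear_push _ sdG])
    fix e assume "e \<in> list_chain ` ?S"
    then obtain ys where ys: "ys \<in> ?S" "e = list_chain ys" by blast
    have "set (map \<psi> ys) \<subseteq> ?X" using pts[OF ys(1)] \<psi> by (auto simp: simplicial_approx_def)
    then show "push \<psi> e \<in> span (list_chain ` {ys. set ys \<subseteq> ?X})"
      unfolding ys(2) push_list_chain by (intro span_base imageI) simp
  qed
  define w where "w = antisym u"
  have "w \<in> span (oriented_simplex ` ordered_simplices M (Suc k))"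
    unfolding w_def u_def
  proof (rule linear_image_span_subset[OF _ _ sdG, of "\<lambda>c. antisym (push \<psi> c)"])
    show "linear (\<lambda>c. antisym (push \<psi> c))"
      using linear_compose[OF linear_push linear_antisym] by (simp add: o_def)
    fix e assume "e \<in> list_chain ` ?S"
    then obtain ys where ys: "ys \<in> ?S" "e = list_chain ys" by blast
    \<comment> \<open>All entries are within \<open>\<delta>\<close> of one entry \<open>y\<close>,
      so \<open>\<psi>\<close> sends them to vertices of any one simplex of \<open>M\<close>
      containing \<open>y\<close>.\<close>
    have len: "length ys = ?n" and close: "\<And>p q. p \<in> set ys \<Longrightarrow> q \<in> set ys \<Longrightarrow> dist p q < \<delta>"
      using ys(1) m by (auto simp: small_lists_def intro: le_less_trans)
    obtain y where y: "y \<in> set ys" using len by (cases ys) auto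
    obtain \<tau> where \<tau>: "\<tau> \<in> M" "y \<in> \<tau>" using pts[OF ys(1)] y by blast
    obtain C where C: "\<not> affine_dependent C" "\<tau> = convex hull C"
      by (rule simplicial_complex_simplex[OF M \<tau>(1)])
    have sub: "set (map \<psi> ys) \<subseteq> C"
    proof
      fix v assume "v \<in> set (map \<psi> ys)"
      then obtain x where x: "x \<in> set ys" "v = \<psi> x" by auto
      have xM: "x \<in> \<Union>M" "y \<in> \<Union>M" using pts[OF ys(1)] x y by blast+
      have "v \<in> \<tau>" unfolding x(2) by (rule fine[OF xM close[OF x(1) y] \<tau>])
      moreover have "v \<in> vertices M" using \<psi> xM(1) x(2) unfolding simplicial_approx_def by blast
      ultimately show "v \<in> C" using vertex_in_simplex[OF M C(1)] \<tau>(1) C(2) by blast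
    qed
    show "antisym (push \<psi> e) \<in> span (oriented_simplex ` ordered_simplices M (Suc k))"
    proof (cases "distinct (map \<psi> ys)")
      case True
      then have "map \<psi> ys \<in> ordered_simplices M (Suc k)"
        using len affine_dependent_subset[OF _ sub] C(1)
          simplicial_complex_subface[OF M C(1) _ sub] \<tau>(1) C(2)
        by (auto simp: ordered_simplices_iff)
      then show ?thesis by (simp add: ys(2) antisym_push_list_chain span_base)
    next
      case False
      then show ?thesis
        by (simp add: ys(2) antisym_push_list_chain oriented_simplex_not_distinct span_zero)
    qed
  qed
  then have wM: "w \<in> simplicial_chains M (Suc k)" by (simp add: simplicial_chains_span[OF M])
  let ?F = "\<lambda>c. antisym (push \<psi> ((sd ^^ m) c))"
  have linF: "linear ?F"
    using linear_compose[OF linear_compose[OF linear_sd_iterate linear_push] linear_antisym]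
    by (simp add: o_def)
  have "alt_boundary ?X w = antisym (ord_boundary u)"
    unfolding w_def by (rule alt_boundary_antisym[OF fX uX])
  also have "\<dots> = ?F (- z)"
    unfolding u_def by (simp add: ord_boundary_push[OF sd_iterate_ordered[OF Go]] ord_boundary_sd_iterate[OF Go] bG)
  also have "\<dots> = - ?F z" by (rule linear_neg[OF linF])
  also have "?F z = (\<Sum>xs\<in>ordered_simplices M k. z xs *\<^sub>R ?F (list_chain xs))"
    by (subst list_chain_expansion[OF finite_ordered_simplices[OF M] simplicial_chainsD(2)[OF z]], assumption)
      (simp add: linear_sum[OF linF] linear_scale[OF linF])
  also have "\<dots> = (\<Sum>xs\<in>ordered_simplices M k. z xs *\<^sub>R oriented_simplex xs)"
    by (intro sum.cong refl arg_cong[where f = "scaleR _"] approx_sd_list_chain[OF M \<psi>])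
      (auto simp: ordered_simplices_iff)
  also have "\<dots> = fact (Suc k) *\<^sub>R z" by (rule sum_oriented_simplices[OF M z])
  \<comment> \<open>The sign comes from \<open>ord_boundary G = - z\<close>; the factorial arises
    because \<open>z\<close> lists each simplex in all \<open>(k + 1)!\<close> orderings, each of
    which antisymmetrises to the same chain.\<close>
  finally have "alt_boundary ?X ((- 1 / fact (Suc k)) *\<^sub>R w) = z"
    by (simp add: linear_scale[OF linear_alt_boundary] linear_neg[OF linear_alt_boundary] del: fact_Suc)
  moreover have "(- 1 / fact (Suc k)) *\<^sub>R w \<in> simplicial_chains M (Suc k)"
    by (rule subspace_scale[OF subspace_simplicial_chains wM])
  ultimately show ?thesis by blast
qed

lemma boundary_M: "k \<noteq> 0 \<Longrightarrow> c \<in> simplicial_chains M k \<Longrightarrow> boundary M k c = alt_boundary (vertices M) c"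
  by (rule boundary_eq_alt_boundary[OF M fX subset_refl])

lemma boundary_N: "k \<noteq> 0 \<Longrightarrow> c \<in> simplicial_chains N k \<Longrightarrow> boundary N k c = alt_boundary (vertices M) c"
  by (rule boundary_eq_alt_boundary[OF N fX NX])

text \<open>Subtracting the subdivision of \<open>push \<phi> x\<close> from \<open>x\<close> leaves
  a chain that \<open>push \<phi>\<close> kills, as \<open>push \<phi>\<close> inverts the
  subdivision map from the left. It is a cycle because the subdivision of \<open>push \<phi>\<close>
  fixes boundaries that come from \<open>N\<close>.\<close>

lemma relative_cycle_bounds:
  assumes x: "x \<in> simplicial_chains M k"
    and rel: "boundary M k x \<in> subdivision_map N M (k - 1) ` simplicial_chains N (k - 1)"
  shows "\<exists>a\<in>simplicial_chains N k. \<exists>y\<in>simplicial_chains M (Suc k).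
    x = subdivision_map N M k a + boundary M (Suc k) y"
proof -
  let ?b = "alt_boundary (vertices M)" and ?i = "subdivision_map N M"
  note sub = subdivision_map_alt_boundary[OF subdiv fX subset_refl]
  define a where "a = push \<phi> x"
  have a: "a \<in> simplicial_chains N k" unfolding a_def by (rule push_mem[OF x])
  have ia: "?i k a \<in> simplicial_chains M k" by (rule subdivision_map_mem[OF N M a])
  define z where "z = x - ?i k a"
  have z: "z \<in> simplicial_chains M k"
    unfolding z_def by (rule subspace_diff[OF subspace_simplicial_chains x ia])
  have pz: "push \<phi> z = 0"
    by (simp add: z_def linear_diff[OF linear_push] push_subdivision_map[OF a] a_def[symmetric])
  have "?b (?i k a) = ?b x"
  proof (cases k)
    \<comment> \<open>Here \<open>rel\<close> says nothing, as \<open>boundary M 0\<close> is 0,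
      while \<open>cycle_bounds\<close> asks for coefficients of sum zero. This holds because
      \<open>push \<phi>\<close> and the subdivision map preserve the sum of the coefficients of
      \<open>x\<close>.\<close>
    case 0
    have "?b x ys = 0" if "ys \<noteq> []" for ys
      unfolding alt_boundary_def
      by (rule sum.neutral) (use simplicial_chainsD(2)[OF x] length_ordered_simplices[of _ M k] 0 that in fastforce)
    then have bx: "?b x = (\<Sum>ys\<in>{[]}. ?b x ys *\<^sub>R list_chain ys)"
      by (intro list_chain_expansion) auto
    have "?b (?i k a) = ?b a" using sub(2) a 0 by simp
    also have "\<dots> = push \<phi> (?b x)" unfolding a_def by (rule alt_boundary_push[OF x])
    also have "\<dots> = ?b x"
      by (subst (1 2) bx) (simp add: linear_scale[OF linear_push] push_list_chain)
    finally show ?thesis .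
  next
    case (Suc j)
    obtain c where c: "c \<in> simplicial_chains N j" "?b x = ?i j c"
      using rel boundary_M[OF _ x] Suc by auto
    have "?b (?i k a) = ?i j (?b a)" using sub(1) a Suc by simp
    also have "?b a = push \<phi> (?b x)" unfolding a_def by (rule alt_boundary_push[OF x])
    also have "\<dots> = c" unfolding c(2) by (rule push_subdivision_map[OF c(1)])
    finally show ?thesis using c(2) by simp
  qed
  then have "?b z = 0" by (simp add: z_def linear_diff[OF linear_alt_boundary])
  then obtain w where w: "w \<in> simplicial_chains M (Suc k)" "?b w = z"
    using cycle_bounds[OF z _ pz] by blast
  then have "x = ?i k a + boundary M (Suc k) w" using boundary_M[OF _ w(1)] by (simp add: z_def)
  then show ?thesis using a w(1) by blast
qed

end

sublocale approximated_subdivision \<subseteq> chain_embedding "simplicial_chains N" "simplicial_chains M"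
  "boundary N" "boundary M" "subdivision_map N M"
proof (rule chain_embedding.intro)
  show "subspace (simplicial_chains N k)" "subspace (simplicial_chains M k)" for k
    by (rule subspace_simplicial_chains)+
  show "linear (boundary N k)" "linear (boundary M k)" "linear (subdivision_map N M k)" for k
    by (rule linear_boundary linear_subdivision_map)+
  show "boundary N k x \<in> simplicial_chains N (k - 1)" if "x \<in> simplicial_chains N k" for x k
    by (rule boundary_mem[OF N that])
  show "boundary M k x \<in> simplicial_chains M (k - 1)" if "x \<in> simplicial_chains M k" for x k
    by (rule boundary_mem[OF M that])
  show "boundary N 0 x = 0" "boundary M 0 x = 0" for x by (simp_all add: boundary_def)
  show "boundary M k (boundary M (Suc k) x) = 0" if "x \<in> simplicial_chains M (Suc k)" for x k
    by (rule boundary_boundary[OF M that])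
  show "subdivision_map N M k x \<in> simplicial_chains M k" if "x \<in> simplicial_chains N k" for x k
    by (rule subdivision_map_mem[OF N M that])
  \<comment> \<open>Injectivity comes from the left inverse \<open>push \<phi>\<close>.\<close>
  show "x = 0" if "x \<in> simplicial_chains N k" "subdivision_map N M k x = 0" for x k
    using push_subdivision_map[OF that(1)] that(2) by (simp add: linear_0[OF linear_push])
  show "boundary M k (subdivision_map N M k x) = subdivision_map N M (k - 1) (boundary N k x)"
    if x: "x \<in> simplicial_chains N k" for x k
  proof (cases k)
    case 0
    then show ?thesis by (simp add: boundary_def linear_0[OF linear_subdivision_map])
  next
    case (Suc j)
    then show ?thesis
      using subdivision_map_alt_boundary(1)[OF subdiv fX subset_refl, of x j] x
        boundary_M[OF _ subdivision_map_mem[OF N M x]] boundary_N[OF _ x] by simp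
  qed
qed

section \<open>Adjoints and Laplacians of simplicial chains\<close>

lemma boundary_adjoint_eq:
  assumes "is_adjoint (simplicial_chains K) (boundary K) g k y z" "chain_inner_product K g"
  shows "boundary_adjoint K g k y = z"
proof -
  have ip: "inner_product_on (simplicial_chains K k) (g k)"
    using assms(2) by (simp add: chain_inner_product_def)
  have "boundary_adjoint K g k y = (THE z. is_adjoint (simplicial_chains K) (boundary K) g k y z)"
    by (simp add: boundary_adjoint_def is_adjoint_def)
  also have "\<dots> = z"
    by (rule the_equality[where P = "is_adjoint (simplicial_chains K) (boundary K) g k y", OF assms(1)])
      (rule adjoint_unique[OF _ assms(1) subspace_simplicial_chains ip])
  finally show ?thesis .
qed

text \<open>An inner product is a function on the whole type of chains, so \<open>g'\<close> is
  determined as far as its values on \<open>simplicial_chains M k\<close> are concerned, and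
  uniqueness is asserted there.\<close>

theorem theorem1p1:
  fixes N M :: "'a::euclidean_space set set"
  assumes "subdivision N M"
  shows "(\<exists>V. subdivision_decomposition N M V) \<and>
    (\<forall>V g h. subdivision_decomposition N M V \<longrightarrow>
       chain_inner_product M g \<longrightarrow> chain_inner_product N h \<longrightarrow>
       (\<exists>g'. decomposition_inner_product N M V g h g' \<and>
          (\<forall>g''. decomposition_inner_product N M V g h g'' \<longrightarrow>
             (\<forall>k. \<forall>x\<in>simplicial_chains M k. \<forall>y\<in>simplicial_chains M k. g'' k x y = g' k x y)) \<and>
          (\<forall>k. \<forall>c\<in>simplicial_chains N k.
             subdivision_map N M k (laplacian N h k c) = laplacian M g' k (subdivision_map N M k c))))"
proof -
  have N: "simplicial_complex N" using assms by (simp add: subdivision_def)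
  \<comment> \<open>Each simplex of \<open>M\<close> lies in one of \<open>N\<close>, so no fineness
    is demanded of \<open>\<phi>\<close>.\<close>
  obtain \<phi> where "simplicial_approx N \<phi>" using fine_simplicial_approx_exists[OF N] by blast
  then interpret approximated_subdivision N M \<phi> using assms by unfold_locales
  have dec: "subdivision_decomposition N M V \<longleftrightarrow> decomposition V" for V
    by (simp add: subdivision_decomposition_def)
  have ext: "decomposition_inner_product N M V g h g' \<longleftrightarrow> metric_extension V g h g'" for V g h g'
    by (simp add: decomposition_inner_product_def chain_inner_product_def)
  show ?thesis
  proof (intro conjI allI impI)
    show "\<exists>V. subdivision_decomposition N M V"
      unfolding dec by (rule decomposition_exists) (rule relative_cycle_bounds)
  next
    fix V g h
    assume V: "subdivision_decomposition N M V" and g: "chain_inner_product M g" and h: "chain_inner_product N h"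
    have V': "decomposition V" using V unfolding dec .
    have g1: "inner_product_on (simplicial_chains M k) (g k)" and h1: "inner_product_on (simplicial_chains N k) (h k)" for k
      using g h by (simp_all add: chain_inner_product_def)
    obtain g' where g': "metric_extension V g h g'" using metric_extension_exists[OF V' g1 h1] by blast
    have ipM: "chain_inner_product M g'" using g' by (simp add: chain_inner_product_def)
    \<comment> \<open>The image of the adjoint in \<open>N\<close> satisfies the defining property
      of the adjoint in \<open>M\<close>; uniqueness of adjoints turns this into an
      equation.\<close>
    have adj: "boundary_adjoint M g' k (subdivision_map N M (k - 1) y) =
        subdivision_map N M k (boundary_adjoint N h k y)" if y: "y \<in> simplicial_chains N (k - 1)" for k y
    proof -
      obtain z where z: "is_adjoint (simplicial_chains N) (boundary N) h k y z"
        using adjoint_exists[OF V' g1 h1 finite_imageI[OF finite_ordered_simplices[OF N]]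
            simplicial_chains_span[OF N] y] by blast
      show ?thesis
        using boundary_adjoint_eq[OF z h]
          boundary_adjoint_eq[OF adjoint_image[OF V' g1 h1 g' y z] ipM] by simp
    qed
    have adj_mem: "boundary_adjoint N h k y \<in> simplicial_chains N k" if y: "y \<in> simplicial_chains N (k - 1)" for k y
    proof -
      obtain z where z: "is_adjoint (simplicial_chains N) (boundary N) h k y z"
        using adjoint_exists[OF V' g1 h1 finite_imageI[OF finite_ordered_simplices[OF N]]
            simplicial_chains_span[OF N] y] by blast
      then show ?thesis using boundary_adjoint_eq[OF z h] by (simp add: is_adjoint_def)
    qed
    show "\<exists>g'. decomposition_inner_product N M V g h g' \<and>
          (\<forall>g''. decomposition_inner_product N M V g h g'' \<longrightarrow>
             (\<forall>k. \<forall>x\<in>simplicial_chains M k. \<forall>y\<in>simplicial_chains M k. g'' k x y = g' k x y)) \<and>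
          (\<forall>k. \<forall>c\<in>simplicial_chains N k.
             subdivision_map N M k (laplacian N h k c) = laplacian M g' k (subdivision_map N M k c))"
      unfolding ext
    proof (intro exI[of _ g'] conjI[OF g'] conjI allI impI ballI)
      fix g'' k x y assume "metric_extension V g h g''" "x \<in> simplicial_chains M k" "y \<in> simplicial_chains M k"
      then show "g'' k x y = g' k x y" by (rule metric_extension_unique[OF V' g1 h1 g'])
    next
      fix k c assume c: "c \<in> simplicial_chains N k"
      \<comment> \<open>The adjoint of the boundary in degree \<open>k + 1\<close> takes its
        argument in degree \<open>k + 1 - 1\<close>.\<close>
      have c1: "c \<in> simplicial_chains N (k + 1 - 1)" using c by simp
      have "boundary_adjoint M g' (k + 1) (subdivision_map N M k c) =
          subdivision_map N M (k + 1) (boundary_adjoint N h (k + 1) c)"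
        using adj[OF c1] by simp
      then show "subdivision_map N M k (laplacian N h k c) = laplacian M g' k (subdivision_map N M k c)"
        using i_chain_map[OF c] adj[OF dA_mem[OF c]] i_chain_map[OF adj_mem[OF c1]]
        by (simp add: laplacian_def linear_add[OF linear_subdivision_map])
    qed
  qed
qed

end
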